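(* Let $C$ be a smooth projective complex algebraic curve of genus $>1$ with canonical bundle $K$, let $d\geq1$ be an integer, let $N=\dim H^0(C,K^{\otimes d})$, and let $(\omega_1,\ldots,\omega_N)$ be a basis of $H^0(C,K^{\otimes d})$. Let $H_i^{\mathrm{class}}=\Delta_i^{\mathrm{class}}/\Delta_0^{\mathrm{class}}$ ($i=1,\ldots,N$) be the rational functions on $\operatorname{Cone}(C)^N$ defined by $$\Delta_0^{\mathrm{class}}=[\omega_1,\ldots,\omega_N],\qquad \Delta_i^{\mathrm{class}}=[1,\omega_1,\ldots,\check\omega_i,\ldots,\omega_N].$$ Then there exists a family $(H_1,\ldots,H_N)$ of rational differential operators on $C^N$, commuting with each other, with symbols $(H_1^{\mathrm{class}},\ldots,H_N^{\mathrm{class}})$.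
   Context: $\operatorname{Cone}(C)$ is the canonical cone of $C$, with function algebra $A_C=\bigoplus_{i\geq0}H^0(C,K^{\otimes i})$. For $g_1,\ldots,g_N\in A_C$, $[g_1,\ldots,g_N]=\sum_{\sigma\in\mathfrak{S}_N}\epsilon(\sigma)\,g_{\sigma(1)}\otimes\cdots\otimes g_{\sigma(N)}\in A_C^{\otimes N}$, where $\epsilon(\sigma)$ is the sign of $\sigma$, regarded as a function on $\operatorname{Cone}(C)^N$; $\check\omega_i$ means that $\omega_i$ is omitted; $1$ is the unit of $A_C$. Fix a nonzero rational vector field $X$ on $C$ (a derivation of $\mathbb{C}(C)$, and a rational section of $K^{\otimes -1}$). The algebra $\mathrm{DO}_{\mathrm{rat}}(C^N)$ of rational differential operators on $C^N$ is the subalgebra of $\operatorname{End}(\mathbb{C}(C^N))$ of operators which can be written (uniquely) as finite sums $\sum_{\alpha_1,\ldots,\alpha_N\ge0}f_{\alpha_1,\ldots,\alpha_N}X^{\alpha_1}\otimes\cdots\otimes X^{\alpha_N}$ with $f_{\alpha_1,\ldots,\alpha_N}\in\mathbb{C}(C^N)$, where the $k$-th tensor factor acts by differentiating in the $k$-th variable. It is filtered by letting $\mathrm{Fil}_i$ be the set of operators with $f_{\alpha_1,\ldots,\alpha_N}=0$ whenever $\alpha_1+\cdots+\alpha_N>i$; the associated graded algebra is $\mathbb{C}(C^N)[\xi_1,\ldots,\xi_N]$, with $\xi_k$ the class of $X$ acting on the $k$-th variable. The symbol of a nonzero operator is its class in $\mathrm{Fil}_m/\mathrm{Fil}_{m-1}$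 with $m$ minimal such that the operator lies in $\mathrm{Fil}_m$. The graded algebra $\mathbb{C}(C^N)[\xi_1,\ldots,\xi_N]$ is viewed inside $\mathbb{C}(\operatorname{Cone}(C)^N)$ via the algebra morphism sending $f\xi_1^{n_1}\cdots\xi_N^{n_N}$ to $f\,X^{n_1}\boxtimes\cdots\boxtimes X^{n_N}$, a rational section of $K^{\otimes -n_1}\boxtimes\cdots\boxtimes K^{\otimes -n_N}$ over $C^N$; here rational sections of $K^{\otimes i_1}\boxtimes\cdots\boxtimes K^{\otimes i_N}$ ($i_1,\ldots,i_N\in\mathbb{Z}$) are identified with rational functions on $\operatorname{Cone}(C)^N$ homogeneous of degree $(i_1,\ldots,i_N)$ along the fibers of $\operatorname{Cone}(C)^N\to C^N$. Equivalently, $\mathbb{C}(\operatorname{Cone}(C)^N)=\mathbb{C}(C^N)(\xi_1,\ldots,\xi_N)$, and a $d$-differential $\omega$ placed in the $k$-th factor corresponds to $(\omega X^d)(z_k)\,\xi_k^{-d}$, where $\omega X^d\in\mathbb{C}(C)$ and $z_k$ is the $k$-th point. *)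

theory Defs
  imports
    "HOL-Analysis.Analysis"
    "HOL-Algebra.QuotRing"
    "HOL-Combinatorics.Permutations"
    "HOL-Library.Extended_Nat"
begin

section \<open>Projective space and smooth projective curves\<close>

text \<open>Points of the projective space of dimension \<open>CARD('n) - 1\<close> are the lines through the
  origin of \<open>complex ^ 'n\<close>.\<close>

typedef (overloaded) 'n proj = "{L :: (complex ^ 'n::finite) set. \<exists>v. v \<noteq> 0 \<and> L = range (\<lambda>c. c *s v)}"
proof -
  have "(1 :: complex ^ 'n) \<noteq> 0" by simp
  then show ?thesis by blast
qed

definition hcoords :: "'n::finite proj \<Rightarrow> (complex ^ 'n) set" where
  "hcoords p = Rep_proj p - {0}"

text \<open>The algebra of polynomial functions in a given set \<open>X\<close> of coordinate functions.  The
  ground field being infinite, polynomials are identified with polynomial functions.\<close>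

inductive_set poly_funs :: "('v \<Rightarrow> complex) set \<Rightarrow> ('v \<Rightarrow> complex) set"
  for X :: "('v \<Rightarrow> complex) set" where
  const: "(\<lambda>_. c) \<in> poly_funs X"
| coord: "x \<in> X \<Longrightarrow> x \<in> poly_funs X"
| add: "P \<in> poly_funs X \<Longrightarrow> Q \<in> poly_funs X \<Longrightarrow> (\<lambda>v. P v + Q v) \<in> poly_funs X"
| mult: "P \<in> poly_funs X \<Longrightarrow> Q \<in> poly_funs X \<Longrightarrow> (\<lambda>v. P v * Q v) \<in> poly_funs X"

definition forms :: "nat \<Rightarrow> (complex ^ 'n::finite \<Rightarrow> complex) set" where
  "forms e = {P \<in> poly_funs {\<lambda>v. v $ i |i. True}. \<forall>c v. P (c *s v) = c ^ e * P v}"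

definition proj_zeros :: "(complex ^ 'n::finite \<Rightarrow> complex) set \<Rightarrow> 'n proj set" where
  "proj_zeros S = {p. \<forall>P\<in>S. \<forall>v\<in>hcoords p. P v = 0}"

definition zariski :: "'n::finite proj topology" where
  "zariski = topology (\<lambda>U. \<exists>S. S \<subseteq> (\<Union>e. forms e) \<and> U = - proj_zeros S)"

lemma openin_zariski:
  "openin zariski (U :: 'n::finite proj set) \<longleftrightarrow> (\<exists>S. S \<subseteq> (\<Union>e. forms e) \<and> U = - proj_zeros S)"
proof -
  let ?O = "\<lambda>U :: 'n proj set. \<exists>S. S \<subseteq> (\<Union>e. forms e) \<and> U = - proj_zeros S"
  have "istopology ?O"
    unfolding istopology_def
  proof (intro conjI allI impI)
    fix U V :: "'n proj set" assume "?O U" "?O V"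
    then obtain S T where S: "S \<subseteq> (\<Union>e. forms e)" "U = - proj_zeros S"
      and T: "T \<subseteq> (\<Union>e. forms e)" "V = - proj_zeros T" by blast
    let ?ST = "{\<lambda>v. P v * Q v |P Q. P \<in> S \<and> Q \<in> T}"
    have "?ST \<subseteq> (\<Union>e. forms e)"
    proof
      fix R assume "R \<in> ?ST"
      then obtain P Q where R: "R = (\<lambda>v. P v * Q v)" "P \<in> S" "Q \<in> T" by blast
      then obtain e e' where "P \<in> forms e" "Q \<in> forms e'" using S(1) T(1) by blast
      then have "R \<in> forms (e + e')"
        unfolding R forms_def by (auto intro: poly_funs.mult simp: power_add)
      then show "R \<in> (\<Union>e. forms e)" by blast
    qed
    moreover have "U \<inter> V = - proj_zeros ?ST"
    proof (rule Set.set_eqI)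
      fix p :: "'n proj"
      have scale: "P v = 0 \<longleftrightarrow> P w = 0"
        if vw: "v \<in> hcoords p" "w \<in> hcoords p" and PF: "P \<in> (\<Union>e. forms e)" for v w P
      proof -
        obtain u where u: "Rep_proj p = range (\<lambda>c. c *s u)" using Rep_proj[of p] by blast
        obtain a b where ab: "v = a *s u" "w = b *s u" "a \<noteq> 0" "b \<noteq> 0"
          using vw u unfolding hcoords_def by fastforce
        obtain e where "\<And>c v. P (c *s v) = c ^ e * P v" using PF unfolding forms_def by blast
        then show ?thesis using ab by simp
      qed
      have "p \<notin> proj_zeros ?ST" if p: "p \<notin> proj_zeros S" "p \<notin> proj_zeros T"
      proof -
        obtain P v where P: "P \<in> S" "v \<in> hcoords p" "P v \<noteq> 0" using p(1) unfolding proj_zeros_def by blast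
        obtain Q w where Q: "Q \<in> T" "w \<in> hcoords p" "Q w \<noteq> 0" using p(2) unfolding proj_zeros_def by blast
        have "Q v \<noteq> 0" using scale[OF P(2) Q(2) subsetD[OF T(1) Q(1)]] Q(3) by simp
        then have "P v * Q v \<noteq> 0" using P by simp
        moreover have "(\<lambda>v. P v * Q v) \<in> ?ST" by (rule CollectI, intro exI conjI, rule refl, rule P(1), rule Q(1))
        ultimately have "\<exists>R\<in>?ST. \<exists>v\<in>hcoords p. R v \<noteq> 0"
          by (intro bexI[of _ "\<lambda>v. P v * Q v"] bexI[of _ v] P(2))
        then show ?thesis unfolding proj_zeros_def mem_Collect_eq[of p] by meson
      qed
      moreover have "p \<in> proj_zeros ?ST" if "p \<in> proj_zeros S \<or> p \<in> proj_zeros T"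
      proof -
        have "P v * Q v = 0" if "P \<in> S" "Q \<in> T" "v \<in> hcoords p" for P Q v
          using that \<open>p \<in> proj_zeros S \<or> p \<in> proj_zeros T\<close> unfolding proj_zeros_def by auto
        then show ?thesis by (auto simp: proj_zeros_def)
      qed
      ultimately show "p \<in> U \<inter> V \<longleftrightarrow> p \<in> - proj_zeros ?ST"
        unfolding S(2) T(2) by blast
    qed
    ultimately show "?O (U \<inter> V)" by blast
  next
    fix \<U> :: "'n proj set set" assume "\<forall>U\<in>\<U>. ?O U"
    then obtain S where S: "\<And>U. U \<in> \<U> \<Longrightarrow> S U \<subseteq> (\<Union>e. forms e) \<and> U = - proj_zeros (S U)"
      by metis
    have "(\<Union>U\<in>\<U>. S U) \<subseteq> (\<Union>e. forms e)" using S by blast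
    moreover have "\<Union>\<U> = - proj_zeros (\<Union>U\<in>\<U>. S U)"
    proof -
      have "\<Union>\<U> = (\<Union>U\<in>\<U>. - proj_zeros (S U))" using S by auto
      then show ?thesis unfolding proj_zeros_def by blast
    qed
    ultimately show "?O (\<Union>\<U>)" by blast
  qed
  then show ?thesis unfolding zariski_def by simp
qed

definition irreducible_in :: "'a topology \<Rightarrow> 'a set \<Rightarrow> bool" where
  "irreducible_in T Z \<longleftrightarrow> Z \<noteq> {} \<and> Z \<subseteq> topspace T \<and>
     (\<forall>A B. closedin T A \<longrightarrow> closedin T B \<longrightarrow> Z \<subseteq> A \<union> B \<longrightarrow> Z \<subseteq> A \<or> Z \<subseteq> B)"

definition krull_dim :: "'a topology \<Rightarrow> enat" where
  "krull_dim T = Sup {enat m |m. \<exists>Z :: nat \<Rightarrow> 'a set.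
     (\<forall>i\<le>m. closedin T (Z i) \<and> irreducible_in T (Z i)) \<and> (\<forall>i<m. Z i \<subset> Z (Suc i))}"

text \<open>The Zariski tangent space at \<open>v\<close> of the affine cone over \<open>C\<close> (kernel of the Jacobian of
  the homogeneous ideal of \<open>C\<close>).  Its quotient by the line through \<open>v\<close> is the tangent space
  of \<open>C\<close> at the point of \<open>C\<close> with homogeneous coordinates \<open>v\<close>, up to a twist.\<close>

definition cone_tangent :: "'n::finite proj set \<Rightarrow> complex ^ 'n \<Rightarrow> (complex ^ 'n) set" where
  "cone_tangent C v = {w. \<forall>e. \<forall>P\<in>forms e. (\<forall>p\<in>C. \<forall>u\<in>hcoords p. P u = 0) \<longrightarrow>
     deriv (\<lambda>t. P (v + t *s w)) 0 = 0}"

definition smooth_projective_curve :: "'n::finite proj set \<Rightarrow> bool" where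
  "smooth_projective_curve C \<longleftrightarrow>
     closedin zariski C \<and> irreducible_in zariski C \<and> krull_dim (subtopology zariski C) = 1 \<and>
     (\<forall>p\<in>C. \<forall>v\<in>hcoords p. vec.dim (cone_tangent C v) = 2)"

section \<open>Rational functions\<close>

text \<open>We construct the field of rational functions on the product of \<open>N\<close> copies of \<open>C\<close> and
  an affine space of dimension \<open>M\<close>: germs, at the generic point, of functions which are
  quotients of polynomials homogeneous of the same degree in each of the \<open>N\<close> groups of
  projective coordinates.\<close>

type_synonym 'n pt = "(nat \<Rightarrow> 'n proj) \<times> (nat \<Rightarrow> complex)"
type_synonym 'n ratfun = "('n pt \<Rightarrow> complex) set"

definition points :: "'n::finite proj set \<Rightarrow> nat \<Rightarrow> nat \<Rightarrow> 'n pt set" where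
  "points C N M = ({..<N} \<rightarrow>\<^sub>E C) \<times> ({..<M} \<rightarrow>\<^sub>E UNIV)"

definition coords :: "nat \<Rightarrow> 'n::finite pt \<Rightarrow> ((nat \<Rightarrow> complex ^ 'n) \<times> (nat \<Rightarrow> complex)) set" where
  "coords N x = {(v, \<xi>). (\<forall>k<N. v k \<in> hcoords (fst x k)) \<and> \<xi> = snd x}"

definition multiforms ::
  "nat \<Rightarrow> nat \<Rightarrow> (nat \<Rightarrow> nat) \<Rightarrow> ((nat \<Rightarrow> complex ^ 'n::finite) \<times> (nat \<Rightarrow> complex) \<Rightarrow> complex) set" where
  "multiforms N M e =
     {P \<in> poly_funs ({\<lambda>(v, \<xi>). v k $ i |k i. k < N} \<union> {\<lambda>(v, \<xi>). \<xi> j |j. j < M}).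
        \<forall>k<N. \<forall>c v \<xi>. P (v(k := c *s v k), \<xi>) = c ^ e k * P (v, \<xi>)}"

definition nonvanishing ::
  "'n::finite proj set \<Rightarrow> nat \<Rightarrow> nat \<Rightarrow> ((nat \<Rightarrow> complex ^ 'n) \<times> (nat \<Rightarrow> complex) \<Rightarrow> complex) \<Rightarrow> 'n pt set" where
  "nonvanishing C N M Q = {x \<in> points C N M. \<forall>u\<in>coords N x. Q u \<noteq> 0}"

text \<open>Total functions which agree with \<open>P / Q\<close> wherever \<open>Q\<close> does not vanish; their values
  elsewhere are irrelevant.\<close>

definition fraction_reps ::
  "'n::finite proj set \<Rightarrow> nat \<Rightarrow> nat \<Rightarrow> ((nat \<Rightarrow> complex ^ 'n) \<times> (nat \<Rightarrow> complex) \<Rightarrow> complex)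
     \<Rightarrow> ((nat \<Rightarrow> complex ^ 'n) \<times> (nat \<Rightarrow> complex) \<Rightarrow> complex) \<Rightarrow> 'n ratfun" where
  "fraction_reps C N M P Q = {F. \<forall>x\<in>nonvanishing C N M Q. \<forall>u\<in>coords N x. F x = P u / Q u}"

definition rep_ring :: "'n::finite proj set \<Rightarrow> nat \<Rightarrow> nat \<Rightarrow> ('n pt \<Rightarrow> complex) ring" where
  "rep_ring C N M =
     \<lparr>carrier = {F. \<exists>e. \<exists>P\<in>multiforms N M e. \<exists>Q\<in>multiforms N M e.
         nonvanishing C N M Q \<noteq> {} \<and> F \<in> fraction_reps C N M P Q},
      mult = (\<lambda>F G x. F x * G x), one = (\<lambda>x. 1), zero = (\<lambda>x. 0), add = (\<lambda>F G x. F x + G x)\<rparr>"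

definition null_reps :: "'n::finite proj set \<Rightarrow> nat \<Rightarrow> nat \<Rightarrow> ('n pt \<Rightarrow> complex) set" where
  "null_reps C N M = {F \<in> carrier (rep_ring C N M). \<exists>e. \<exists>Q\<in>multiforms N M e.
     nonvanishing C N M Q \<noteq> {} \<and> (\<forall>x\<in>nonvanishing C N M Q. F x = 0)}"

definition rat_field :: "'n::finite proj set \<Rightarrow> nat \<Rightarrow> nat \<Rightarrow> 'n ratfun ring" where
  "rat_field C N M = rep_ring C N M Quot null_reps C N M"

definition germ :: "'n::finite proj set \<Rightarrow> nat \<Rightarrow> nat \<Rightarrow> ('n pt \<Rightarrow> complex) \<Rightarrow> 'n ratfun" where
  "germ C N M F = null_reps C N M +>\<^bsub>rep_ring C N M\<^esub> F"

text \<open>Pullback along \<open>h\<close>: all representatives \<open>F\<close> of \<open>\<phi>\<close> give the same coset.\<close>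

definition pullback :: "'n::finite proj set \<Rightarrow> nat \<Rightarrow> nat \<Rightarrow> ('n pt \<Rightarrow> 'n pt) \<Rightarrow> 'n ratfun \<Rightarrow> 'n ratfun" where
  "pullback C N M h \<phi> = (\<Union>F\<in>\<phi>. germ C N M (F \<circ> h))"

abbreviation fun_field_curve :: "'n::finite proj set \<Rightarrow> 'n ratfun ring" where
  "fun_field_curve C \<equiv> rat_field C 1 0"

abbreviation fun_field_power :: "'n::finite proj set \<Rightarrow> nat \<Rightarrow> 'n ratfun ring" where
  "fun_field_power C N \<equiv> rat_field C N 0"

text \<open>\<open>at_var C N k f\<close> is \<open>f\<close> evaluated at the \<open>k\<close>-th point, for \<open>f\<close> a rational function on
  the curve.\<close>

definition at_var :: "'n::finite proj set \<Rightarrow> nat \<Rightarrow> nat \<Rightarrow> 'n ratfun \<Rightarrow> 'n ratfun" where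
  "at_var C N k = pullback C N 0 (\<lambda>(z, \<xi>). (\<lambda>i\<in>{..<1}. z k, \<lambda>j\<in>{..<0}. \<xi> j))"

definition local_ring :: "'n::finite proj set \<Rightarrow> 'n proj \<Rightarrow> 'n ratfun set" where
  "local_ring C p = {germ C 1 0 F |F. \<exists>e. \<exists>P\<in>multiforms 1 0 e. \<exists>Q\<in>multiforms 1 0 e.
     (\<lambda>i\<in>{..<1}. p, \<lambda>j\<in>{..<0}. 0) \<in> nonvanishing C 1 0 Q \<and> F \<in> fraction_reps C 1 0 P Q}"

section \<open>Vector fields, differentials and the canonical algebra\<close>

definition derivations :: "'n::finite proj set \<Rightarrow> nat \<Rightarrow> ('n ratfun \<Rightarrow> 'n ratfun) set" where
  "derivations C N = {D \<in> carrier (fun_field_power C N) \<rightarrow>\<^sub>E carrier (fun_field_power C N).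
     (\<forall>c. D (germ C N 0 (\<lambda>_. c)) = \<zero>\<^bsub>fun_field_power C N\<^esub>) \<and>
     (\<forall>f\<in>carrier (fun_field_power C N). \<forall>g\<in>carrier (fun_field_power C N).
        D (f \<oplus>\<^bsub>fun_field_power C N\<^esub> g) = D f \<oplus>\<^bsub>fun_field_power C N\<^esub> D g \<and>
        D (f \<otimes>\<^bsub>fun_field_power C N\<^esub> g) =
          (D f \<otimes>\<^bsub>fun_field_power C N\<^esub> g) \<oplus>\<^bsub>fun_field_power C N\<^esub> (f \<otimes>\<^bsub>fun_field_power C N\<^esub> D g))}"

definition vector_fields :: "'n::finite proj set \<Rightarrow> ('n ratfun \<Rightarrow> 'n ratfun) set" where
  "vector_fields C = derivations C 1"

definition zero_op :: "'n::finite proj set \<Rightarrow> nat \<Rightarrow> 'n ratfun \<Rightarrow> 'n ratfun" where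
  "zero_op C N = (\<lambda>\<phi>\<in>carrier (fun_field_power C N). \<zero>\<^bsub>fun_field_power C N\<^esub>)"

definition vf_add :: "'n::finite proj set \<Rightarrow> ('n ratfun \<Rightarrow> 'n ratfun) \<Rightarrow> ('n ratfun \<Rightarrow> 'n ratfun) \<Rightarrow> 'n ratfun \<Rightarrow> 'n ratfun" where
  "vf_add C Y Z = (\<lambda>\<phi>\<in>carrier (fun_field_curve C). Y \<phi> \<oplus>\<^bsub>fun_field_curve C\<^esub> Z \<phi>)"

definition vf_smult :: "'n::finite proj set \<Rightarrow> 'n ratfun \<Rightarrow> ('n ratfun \<Rightarrow> 'n ratfun) \<Rightarrow> 'n ratfun \<Rightarrow> 'n ratfun" where
  "vf_smult C f Y = (\<lambda>\<phi>\<in>carrier (fun_field_curve C). f \<otimes>\<^bsub>fun_field_curve C\<^esub> Y \<phi>)"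

text \<open>\<open>K\<close> is the dual of the tangent bundle, so a rational section of its \<open>d\<close>-th tensor power
  is a form on rational vector fields which is multilinear in \<open>d\<close> arguments over the function
  field.  For \<open>d = 0\<close> this is a rational function.\<close>

type_synonym 'n differential = "(nat \<Rightarrow> 'n ratfun \<Rightarrow> 'n ratfun) \<Rightarrow> 'n ratfun"

definition rat_differentials :: "'n::finite proj set \<Rightarrow> nat \<Rightarrow> 'n differential set" where
  "rat_differentials C d =
     {\<omega> \<in> ({..<d} \<rightarrow>\<^sub>E vector_fields C) \<rightarrow>\<^sub>E carrier (fun_field_curve C).
        \<forall>Y \<in> {..<d} \<rightarrow>\<^sub>E vector_fields C. \<forall>i<d.
          (\<forall>Z\<in>vector_fields C.
             \<omega> (Y(i := vf_add C (Y i) Z)) = \<omega> Y \<oplus>\<^bsub>fun_field_curve C\<^esub> \<omega> (Y(i := Z))) \<and>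
          (\<forall>f\<in>carrier (fun_field_curve C).
             \<omega> (Y(i := vf_smult C f (Y i))) = f \<otimes>\<^bsub>fun_field_curve C\<^esub> \<omega> Y)}"

definition local_vector_fields :: "'n::finite proj set \<Rightarrow> 'n proj \<Rightarrow> ('n ratfun \<Rightarrow> 'n ratfun) set" where
  "local_vector_fields C p = {Y \<in> vector_fields C. Y ` local_ring C p \<subseteq> local_ring C p}"

text \<open>Global sections: regularity at a point \<open>p\<close> is tested on the vector fields regular
  at \<open>p\<close>.\<close>

definition H0 :: "'n::finite proj set \<Rightarrow> nat \<Rightarrow> 'n differential set" where
  "H0 C d = {\<omega> \<in> rat_differentials C d.
     \<forall>p\<in>C. \<forall>Y \<in> {..<d} \<rightarrow>\<^sub>E local_vector_fields C p. \<omega> Y \<in> local_ring C p}"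

definition lincomb_diff ::
  "'n::finite proj set \<Rightarrow> nat \<Rightarrow> nat \<Rightarrow> (nat \<Rightarrow> complex) \<Rightarrow> (nat \<Rightarrow> 'n differential) \<Rightarrow> 'n differential" where
  "lincomb_diff C d m c \<omega> = (\<lambda>Y \<in> {..<d} \<rightarrow>\<^sub>E vector_fields C.
     \<Oplus>\<^bsub>fun_field_curve C\<^esub>i\<in>{..<m}. germ C 1 0 (\<lambda>_. c i) \<otimes>\<^bsub>fun_field_curve C\<^esub> \<omega> i Y)"

text \<open>Families indexed by \<open>1, \<dots>, m\<close> are shifted to \<open>0, \<dots>, m - 1\<close> throughout.\<close>

definition is_basis_H0 :: "'n::finite proj set \<Rightarrow> nat \<Rightarrow> nat \<Rightarrow> (nat \<Rightarrow> 'n differential) \<Rightarrow> bool" where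
  "is_basis_H0 C d m \<omega> \<longleftrightarrow> (\<forall>i<m. \<omega> i \<in> H0 C d) \<and>
     (\<forall>\<eta>\<in>H0 C d. \<exists>!c. c \<in> {..<m} \<rightarrow>\<^sub>E UNIV \<and> \<eta> = lincomb_diff C d m c \<omega>)"

definition dim_H0 :: "'n::finite proj set \<Rightarrow> nat \<Rightarrow> nat" where
  "dim_H0 C d = (THE m. \<exists>\<omega>. is_basis_H0 C d m \<omega>)"

definition genus :: "'n::finite proj set \<Rightarrow> nat" where
  "genus C = dim_H0 C 1"

definition zero_differential :: "'n::finite proj set \<Rightarrow> nat \<Rightarrow> 'n differential" where
  "zero_differential C d = (\<lambda>Y \<in> {..<d} \<rightarrow>\<^sub>E vector_fields C. \<zero>\<^bsub>fun_field_curve C\<^esub>)"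

text \<open>Elements of the canonical algebra are given by their homogeneous components.\<close>

definition canonical_algebra :: "'n::finite proj set \<Rightarrow> (nat \<Rightarrow> 'n differential) set" where
  "canonical_algebra C = {g. (\<forall>i. g i \<in> H0 C i) \<and> finite {i. g i \<noteq> zero_differential C i}}"

definition homogeneous_elt :: "'n::finite proj set \<Rightarrow> nat \<Rightarrow> 'n differential \<Rightarrow> nat \<Rightarrow> 'n differential" where
  "homogeneous_elt C d \<omega> = (\<lambda>i. if i = d then \<omega> else zero_differential C i)"

definition unit_elt :: "'n::finite proj set \<Rightarrow> nat \<Rightarrow> 'n differential" where
  "unit_elt C = homogeneous_elt C 0 (\<lambda>Y \<in> {..<0} \<rightarrow>\<^sub>E vector_fields C. \<one>\<^bsub>fun_field_curve C\<^esub>)"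

section \<open>Rational functions on the power of the cone\<close>

text \<open>The nonzero rational vector field \<open>X\<close> trivializes \<open>K\<close> generically, which identifies the
  function field of the \<open>N\<close>-th power of the cone with the field of rational functions in
  \<open>\<xi>\<^sub>0, \<dots>, \<xi>\<^sub>N\<^sub>-\<^sub>1\<close> over the function field of the \<open>N\<close>-th power of \<open>C\<close>; the latter is
  realized as the function field of the product of this power with affine \<open>N\<close>-space, the
  \<open>\<xi>\<^sub>k\<close> being the affine coordinates.\<close>

abbreviation cone_field :: "'n::finite proj set \<Rightarrow> nat \<Rightarrow> 'n ratfun ring" where
  "cone_field C N \<equiv> rat_field C N N"

definition cone_incl :: "'n::finite proj set \<Rightarrow> nat \<Rightarrow> 'n ratfun \<Rightarrow> 'n ratfun" where
  "cone_incl C N = pullback C N N (\<lambda>(z, \<xi>). (z, \<lambda>j\<in>{..<0}. \<xi> j))"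

definition xi :: "'n::finite proj set \<Rightarrow> nat \<Rightarrow> nat \<Rightarrow> 'n ratfun" where
  "xi C N k = germ C N N (\<lambda>(z, \<xi>). \<xi> k)"

definition contract :: "nat \<Rightarrow> ('n ratfun \<Rightarrow> 'n ratfun) \<Rightarrow> 'n differential \<Rightarrow> 'n::finite ratfun" where
  "contract d X \<omega> = \<omega> (\<lambda>i\<in>{..<d}. X)"

definition place ::
  "'n::finite proj set \<Rightarrow> nat \<Rightarrow> ('n ratfun \<Rightarrow> 'n ratfun) \<Rightarrow> nat \<Rightarrow> (nat \<Rightarrow> 'n differential) \<Rightarrow> 'n ratfun" where
  "place C N X k g = (\<Oplus>\<^bsub>cone_field C N\<^esub>i\<in>{i. g i \<noteq> zero_differential C i}.
     cone_incl C N (at_var C N k (contract i X (g i))) \<otimes>\<^bsub>cone_field C N\<^esub>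
       (inv\<^bsub>cone_field C N\<^esub> xi C N k) [^]\<^bsub>cone_field C N\<^esub> i)"

definition bracket ::
  "'n::finite proj set \<Rightarrow> ('n ratfun \<Rightarrow> 'n ratfun) \<Rightarrow> (nat \<Rightarrow> 'n differential) list \<Rightarrow> 'n ratfun" where
  "bracket C X gs = (let N = length gs in
     \<Oplus>\<^bsub>cone_field C N\<^esub>\<sigma>\<in>{\<sigma>. \<sigma> permutes {..<N}}.
       germ C N N (\<lambda>_. of_int (sign \<sigma>)) \<otimes>\<^bsub>cone_field C N\<^esub>
       (\<Otimes>\<^bsub>cone_field C N\<^esub>k\<in>{..<N}. place C N X k (gs ! \<sigma> k)))"

definition Delta0_class ::
  "'n::finite proj set \<Rightarrow> ('n ratfun \<Rightarrow> 'n ratfun) \<Rightarrow> nat \<Rightarrow> nat \<Rightarrow> (nat \<Rightarrow> 'n differential) \<Rightarrow> 'n ratfun" where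
  "Delta0_class C X d N \<omega> = bracket C X (map (\<lambda>j. homogeneous_elt C d (\<omega> j)) [0..<N])"

definition Delta_class ::
  "'n::finite proj set \<Rightarrow> ('n ratfun \<Rightarrow> 'n ratfun) \<Rightarrow> nat \<Rightarrow> nat \<Rightarrow> (nat \<Rightarrow> 'n differential) \<Rightarrow> nat \<Rightarrow> 'n ratfun" where
  "Delta_class C X d N \<omega> i =
     bracket C X (unit_elt C # map (\<lambda>j. homogeneous_elt C d (\<omega> j)) (filter (\<lambda>j. j \<noteq> i) [0..<N]))"

definition H_class ::
  "'n::finite proj set \<Rightarrow> ('n ratfun \<Rightarrow> 'n ratfun) \<Rightarrow> nat \<Rightarrow> nat \<Rightarrow> (nat \<Rightarrow> 'n differential) \<Rightarrow> nat \<Rightarrow> 'n ratfun" where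
  "H_class C X d N \<omega> i =
     Delta_class C X d N \<omega> i \<otimes>\<^bsub>cone_field C N\<^esub> inv\<^bsub>cone_field C N\<^esub> (Delta0_class C X d N \<omega>)"

section \<open>Rational differential operators\<close>

text \<open>The action of \<open>X\<close> on the \<open>k\<close>-th variable, as a derivation of the function field of the
  \<open>N\<close>-th power of \<open>C\<close>.\<close>

definition vf_at :: "'n::finite proj set \<Rightarrow> nat \<Rightarrow> ('n ratfun \<Rightarrow> 'n ratfun) \<Rightarrow> nat \<Rightarrow> 'n ratfun \<Rightarrow> 'n ratfun" where
  "vf_at C N X k = (THE D. D \<in> derivations C N \<and>
     (\<forall>f\<in>carrier (fun_field_curve C). \<forall>l<N.
        D (at_var C N l f) = (if l = k then at_var C N k (X f) else \<zero>\<^bsub>fun_field_power C N\<^esub>)))"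

definition vf_monomial ::
  "'n::finite proj set \<Rightarrow> nat \<Rightarrow> ('n ratfun \<Rightarrow> 'n ratfun) \<Rightarrow> (nat \<Rightarrow> nat) \<Rightarrow> 'n ratfun \<Rightarrow> 'n ratfun" where
  "vf_monomial C N X \<alpha> = foldr (\<lambda>k. vf_at C N X k ^^ \<alpha> k) [0..<N]"

definition multi_indices :: "nat \<Rightarrow> (nat \<Rightarrow> nat) set" where
  "multi_indices N = {..<N} \<rightarrow>\<^sub>E UNIV"

definition coeff_support :: "'n::finite proj set \<Rightarrow> nat \<Rightarrow> ((nat \<Rightarrow> nat) \<Rightarrow> 'n ratfun) \<Rightarrow> (nat \<Rightarrow> nat) set" where
  "coeff_support C N f = {\<alpha> \<in> multi_indices N. f \<alpha> \<noteq> \<zero>\<^bsub>fun_field_power C N\<^esub>}"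

definition coeff_families :: "'n::finite proj set \<Rightarrow> nat \<Rightarrow> ((nat \<Rightarrow> nat) \<Rightarrow> 'n ratfun) set" where
  "coeff_families C N =
     {f \<in> multi_indices N \<rightarrow>\<^sub>E carrier (fun_field_power C N). finite (coeff_support C N f)}"

definition diff_op ::
  "'n::finite proj set \<Rightarrow> nat \<Rightarrow> ('n ratfun \<Rightarrow> 'n ratfun) \<Rightarrow> ((nat \<Rightarrow> nat) \<Rightarrow> 'n ratfun) \<Rightarrow> 'n ratfun \<Rightarrow> 'n ratfun" where
  "diff_op C N X f = (\<lambda>\<phi>\<in>carrier (fun_field_power C N).
     \<Oplus>\<^bsub>fun_field_power C N\<^esub>\<alpha>\<in>coeff_support C N f. f \<alpha> \<otimes>\<^bsub>fun_field_power C N\<^esub> vf_monomial C N X \<alpha> \<phi>)"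

definition DO_rat :: "'n::finite proj set \<Rightarrow> nat \<Rightarrow> ('n ratfun \<Rightarrow> 'n ratfun) \<Rightarrow> ('n ratfun \<Rightarrow> 'n ratfun) set" where
  "DO_rat C N X = diff_op C N X ` coeff_families C N"

definition do_coeffs ::
  "'n::finite proj set \<Rightarrow> nat \<Rightarrow> ('n ratfun \<Rightarrow> 'n ratfun) \<Rightarrow> ('n ratfun \<Rightarrow> 'n ratfun) \<Rightarrow> (nat \<Rightarrow> nat) \<Rightarrow> 'n ratfun" where
  "do_coeffs C N X D = (THE f. f \<in> coeff_families C N \<and> D = diff_op C N X f)"

definition Fil :: "'n::finite proj set \<Rightarrow> nat \<Rightarrow> ('n ratfun \<Rightarrow> 'n ratfun) \<Rightarrow> nat \<Rightarrow> ('n ratfun \<Rightarrow> 'n ratfun) set" where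
  "Fil C N X i = {D \<in> DO_rat C N X.
     \<forall>\<alpha>\<in>multi_indices N. (\<Sum>k<N. \<alpha> k) > i \<longrightarrow> do_coeffs C N X D \<alpha> = \<zero>\<^bsub>fun_field_power C N\<^esub>}"

definition do_order :: "'n::finite proj set \<Rightarrow> nat \<Rightarrow> ('n ratfun \<Rightarrow> 'n ratfun) \<Rightarrow> ('n ratfun \<Rightarrow> 'n ratfun) \<Rightarrow> nat" where
  "do_order C N X D = (LEAST m. D \<in> Fil C N X m)"

text \<open>The symbol of a nonzero operator \<open>D\<close> of order \<open>m\<close>: the class of \<open>D\<close> in
  \<open>Fil m / Fil (m - 1)\<close> is given by the coefficients of total order \<open>m\<close>; the associated
  graded algebra, polynomials in the \<open>\<xi>\<^sub>k\<close>, is viewed inside the function field of the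
  \<open>N\<close>-th power of the cone.\<close>

definition symbol :: "'n::finite proj set \<Rightarrow> nat \<Rightarrow> ('n ratfun \<Rightarrow> 'n ratfun) \<Rightarrow> ('n ratfun \<Rightarrow> 'n ratfun) \<Rightarrow> 'n ratfun" where
  "symbol C N X D = (let f = do_coeffs C N X D; m = do_order C N X D in
     \<Oplus>\<^bsub>cone_field C N\<^esub>\<alpha>\<in>{\<alpha> \<in> coeff_support C N f. (\<Sum>k<N. \<alpha> k) = m}.
       cone_incl C N (f \<alpha>) \<otimes>\<^bsub>cone_field C N\<^esub>
       (\<Otimes>\<^bsub>cone_field C N\<^esub>k\<in>{..<N}. xi C N k [^]\<^bsub>cone_field C N\<^esub> \<alpha> k))"

definition op_comp :: "'n::finite proj set \<Rightarrow> nat \<Rightarrow> ('n ratfun \<Rightarrow> 'n ratfun) \<Rightarrow> ('n ratfun \<Rightarrow> 'n ratfun) \<Rightarrow> 'n ratfun \<Rightarrow> 'n ratfun" where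
  "op_comp C N D E = compose (carrier (fun_field_power C N)) D E"

end

theory Submission
  imports Defs "Jordan_Normal_Form.Determinant"
begin

text \<open>Contracting \<open>\<omega>\<^sub>j\<close> with \<open>X\<close> gives functions \<open>f\<^sub>j\<close> on \<open>C\<close>.  By Cramer's rule the classical
  Hamiltonians are, up to the sign \<open>(-1)\<^sup>i\<close>, the solution of the linear system
  \<open>\<Sum>\<^sub>i f\<^sub>i(z\<^sub>k) H\<^sub>i = \<xi>\<^sub>k\<^sup>d\<close>.  Replacing \<open>\<xi>\<^sub>k\<^sup>d\<close> by \<open>X\<^sub>k\<^sup>d\<close>, with coefficients on the left, quantizes
  them; the solutions commute because \<open>X\<^sub>k\<close> commutes with the \<open>f\<^sub>i(z\<^sub>l)\<close> for \<open>l \<noteq> k\<close>.  The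
  system is invertible because the \<open>f\<^sub>j\<close> are linearly independent, which uses that rational vector
  fields form a line over the function field: they take values in the tangent lines of \<open>C\<close>.\<close>

text \<open>Invertibility of the matrix \<open>f_j(z_k)\<close> is needed over the field of the
  whole power, yet all that is known is that the \<open>\<omega>\<close> are a basis over the
  constants. The bridge is a point: independent functions have a nonzero determinant at some tuple
  of regular points, and nonvanishing at one point is generic because powers of an irreducible curve
  are irreducible. For this reason germs are handled through total functions modulo generic
  equality, and determinants are evaluated pointwise.

  Two objects are given by definite descriptions, so existence and uniqueness have to be earned
  before they can be used: the action \<open>vf_at\<close> of \<open>X\<close> on one variable,
  obtained by differentiating along slices, and the coefficients of an operator, unique because
  iterated commutators with functions separate the monomials. With coefficients on the left and only
  the pure powers \<open>X_k^d\<close> present, the symbol is then read off without reordering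
  anything.

  The sign \<open>(-1)^i\<close> comes from moving the replaced column of Cramer's rule to the
  front; it is absorbed into the matrix by using \<open>(-1)^j f_j\<close> in place of
  \<open>f_j\<close>.\<close>

declare One_nat_def [simp del]
no_notation Matrix.vec_index (infixl \<open>$\<close> 100)

section \<open>Polynomial functions and multihomogeneous forms\<close>

lemma poly_funs_subst:
  assumes "P \<in> poly_funs X" and "\<And>x. x \<in> X \<Longrightarrow> (\<lambda>u. x (H u)) \<in> poly_funs Y"
  shows "(\<lambda>u. P (H u)) \<in> poly_funs Y"
  using assms(1)
  by induction (auto intro: poly_funs.intros assms(2))

lemma poly_funs_cong:
  assumes "P \<in> poly_funs X" and "\<And>x. x \<in> X \<Longrightarrow> x u = x w"
  shows "P u = P w"
  using assms(1) by induction (auto simp: assms(2))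

lemma poly_funs_univariate:
  fixes P :: "complex \<Rightarrow> complex"
  assumes "P \<in> poly_funs {\<lambda>t. t}"
  shows "\<exists>p. P = poly p"
  using assms
proof induction
  case (const c)
  show ?case by (rule exI[of _ "[:c:]"]) auto
next
  case (coord x)
  then show ?case by (intro exI[of _ "[:0, 1:]"]) auto
next
  case (add P Q)
  then obtain p q where "P = poly p" "Q = poly q" by blast
  then show ?case by (intro exI[of _ "p + q"]) auto
next
  case (mult P Q)
  then obtain p q where "P = poly p" "Q = poly q" by blast
  then show ?case by (intro exI[of _ "p * q"]) auto
qed

text \<open>Irreducibility of the affine line: a product of two nonzero polynomials has only
  finitely many roots. It is applied to the fibre coordinates.\<close>

lemma poly_funs_univariate_common_nonzero:
  fixes P Q :: "complex \<Rightarrow> complex"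
  assumes "P \<in> poly_funs {\<lambda>t. t}" "Q \<in> poly_funs {\<lambda>t. t}" "P a \<noteq> 0" "Q b \<noteq> 0"
  shows "\<exists>t. P t \<noteq> 0 \<and> Q t \<noteq> 0"
proof -
  obtain p q where pq: "P = poly p" "Q = poly q"
    using poly_funs_univariate assms(1,2) by meson
  then have "p * q \<noteq> 0" using assms(3,4) by auto
  then have "finite {t. poly (p * q) t = 0}" by (rule poly_roots_finite)
  then obtain t where "poly (p * q) t \<noteq> 0"
    using ex_new_if_finite[OF infinite_UNIV_char_0, of "{t. poly (p * q) t = 0}"] by auto
  then show ?thesis using pq by auto
qed

lemma hcoords_nonempty: "\<exists>v. v \<in> hcoords p"
proof -
  obtain u where "u \<noteq> 0" "Rep_proj p = range (\<lambda>c. c *s u)" using Rep_proj[of p] by blast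
  then have "u \<in> hcoords p" unfolding hcoords_def
    by (simp add: range_eqI[of _ _ 1])
  then show ?thesis ..
qed

lemma hcoords_nonzero: "v \<in> hcoords p \<Longrightarrow> v \<noteq> 0"
  by (simp add: hcoords_def)

lemma hcoords_eq:
  assumes "v \<in> hcoords p"
  shows "hcoords p = {c *s v |c. c \<noteq> 0}"
proof -
  obtain u where u: "u \<noteq> 0" "Rep_proj p = range (\<lambda>c. c *s u)" using Rep_proj[of p] by blast
  with assms obtain a where a: "v = a *s u" "a \<noteq> 0" unfolding hcoords_def by force
  have "c *s u = (c / a) *s v" for c using a by simp
  then have "hcoords p \<subseteq> {c *s v |c. c \<noteq> 0}" unfolding hcoords_def u(2) by force
  moreover have "{c *s v |c. c \<noteq> 0} \<subseteq> hcoords p" unfolding hcoords_def u(2) using a u(1) by auto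
  ultimately show ?thesis by blast
qed

abbreviation multicoords ::
  "nat \<Rightarrow> nat \<Rightarrow> ((nat \<Rightarrow> complex ^ 'n::finite) \<times> (nat \<Rightarrow> complex) \<Rightarrow> complex) set" where
  "multicoords N M \<equiv> {\<lambda>(v, \<xi>). v k $ i |k i. k < N} \<union> {\<lambda>(v, \<xi>). \<xi> j |j. j < M}"

lemma multiforms_poly: "P \<in> multiforms N M e \<Longrightarrow> P \<in> poly_funs (multicoords N M)"
  by (simp add: multiforms_def)

lemma multiforms_hom:
  "P \<in> multiforms N M e \<Longrightarrow> k < N \<Longrightarrow> P (v(k := c *s v k), \<xi>) = c ^ e k * P (v, \<xi>)"
  by (simp add: multiforms_def)

lemma multiforms_const: "(\<lambda>_. c) \<in> multiforms N M (\<lambda>_. 0)"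
  by (simp add: multiforms_def poly_funs.const)

lemma multiforms_add:
  "P \<in> multiforms N M e \<Longrightarrow> Q \<in> multiforms N M e \<Longrightarrow> (\<lambda>u. P u + Q u) \<in> multiforms N M e"
  by (simp add: multiforms_def poly_funs.add distrib_left)

lemma multiforms_mult:
  "P \<in> multiforms N M e \<Longrightarrow> Q \<in> multiforms N M e' \<Longrightarrow>
     (\<lambda>u. P u * Q u) \<in> multiforms N M (\<lambda>k. e k + e' k)"
  by (simp add: multiforms_def poly_funs.mult power_add)

lemma multiforms_cong:
  assumes "P \<in> multiforms N M e" "\<And>k. k < N \<Longrightarrow> v k = w k" "\<And>j. j < M \<Longrightarrow> \<xi> j = \<eta> j"
  shows "P (v, \<xi>) = P (w, \<eta>)"
  by (rule poly_funs_cong[OF multiforms_poly[OF assms(1)]]) (auto simp: assms(2,3))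

text \<open>The groups are rescaled one at a time, by induction on the number already treated.
  Beyond \<open>N\<close> nothing is known about \<open>w\<close>, which is why the last step
  compares the two families only on indices below \<open>N\<close>.\<close>

lemma multiforms_scale:
  assumes P: "P \<in> multiforms N M e" and w: "\<And>k. k < N \<Longrightarrow> w k = c k *s v k"
  shows "P (w, \<xi>) = (\<Prod>k<N. c k ^ e k) * P (v, \<xi>)"
proof -
  have "P (\<lambda>k. if k < n then c k *s v k else v k, \<xi>) = (\<Prod>k<n. c k ^ e k) * P (v, \<xi>)"
    if "n \<le> N" for n using that
  proof (induction n)
    case (Suc n)
    let ?v = "\<lambda>k. if k < n then c k *s v k else v k"
    have "(\<lambda>k. if k < Suc n then c k *s v k else v k) = ?v(n := c n *s ?v n)" by auto
    then show ?case using Suc multiforms_hom[OF P, of n ?v "c n" \<xi>] by simp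
  qed simp
  from this[of N] show ?thesis
    using multiforms_cong[OF P, of w "\<lambda>k. if k < N then c k *s v k else v k" \<xi> \<xi>] w by simp
qed

text \<open>Freezing all points but one leaves a homogeneous form in a single point, to which
  irreducibility of \<open>C\<close> applies.\<close>

lemma multiforms_slice_forms:
  fixes P :: "(nat \<Rightarrow> complex ^ 'n::finite) \<times> (nat \<Rightarrow> complex) \<Rightarrow> complex"
  assumes "P \<in> multiforms N M e" "k < N"
  shows "(\<lambda>a. P (v(k := a), \<xi>)) \<in> forms (e k)"
  unfolding forms_def
proof (intro CollectI conjI allI)
  show "(\<lambda>a. P (v(k := a), \<xi>)) \<in> poly_funs {\<lambda>v. v $ i |i. True}"
  proof (rule poly_funs_subst[OF multiforms_poly[OF assms(1)]])
    fix x :: "(nat \<Rightarrow> complex ^ 'n) \<times> (nat \<Rightarrow> complex) \<Rightarrow> complex"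
    assume "x \<in> multicoords N M"
    then consider j i where "x = (\<lambda>(v, \<xi>). v j $ i)" | i where "x = (\<lambda>(v, \<xi>). \<xi> i)" by blast
    then show "(\<lambda>a. x (v(k := a), \<xi>)) \<in> poly_funs {\<lambda>v. v $ i |i. True}"
    proof cases
      case (1 j i)
      then show ?thesis by (cases "j = k") (auto intro: poly_funs.const poly_funs.coord)
    qed (simp add: poly_funs.const)
  qed
  show "P (v(k := c *s a), \<xi>) = c ^ e k * P (v(k := a), \<xi>)" for c a
    using multiforms_hom[OF assms, of "v(k := a)" c \<xi>] by simp
qed

lemma multiforms_slice_affine:
  fixes P :: "(nat \<Rightarrow> complex ^ 'n::finite) \<times> (nat \<Rightarrow> complex) \<Rightarrow> complex"
  assumes "P \<in> multiforms N M e"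
  shows "(\<lambda>t. P (v, \<xi>(j := t))) \<in> poly_funs {\<lambda>t. t}"
proof (rule poly_funs_subst[OF multiforms_poly[OF assms]])
  fix x :: "(nat \<Rightarrow> complex ^ 'n) \<times> (nat \<Rightarrow> complex) \<Rightarrow> complex"
  assume "x \<in> multicoords N M"
  then consider i k where "x = (\<lambda>(v, \<xi>). v k $ i)" | i where "x = (\<lambda>(v, \<xi>). \<xi> i)" by blast
  then show "(\<lambda>t. x (v, \<xi>(j := t))) \<in> poly_funs {\<lambda>t. t}"
  proof cases
    case (2 i)
    then show ?thesis by (cases "i = j") (auto intro: poly_funs.const poly_funs.coord)
  qed (simp add: poly_funs.const)
qed

text \<open>One arbitrary lift of a point to homogeneous coordinates. Conditions on all lifts reduce
  to this one by homogeneity, which removes a quantifier from \<open>nonvanishing\<close> and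
  \<open>fraction_reps\<close>.\<close>

definition std_coords :: "'n::finite pt \<Rightarrow> (nat \<Rightarrow> complex ^ 'n) \<times> (nat \<Rightarrow> complex)" where
  "std_coords x = ((\<lambda>k. SOME v. v \<in> hcoords (fst x k)), snd x)"

lemma std_coords_hcoords: "fst (std_coords x) k \<in> hcoords (fst x k)"
  unfolding std_coords_def fst_conv by (rule someI_ex) (rule hcoords_nonempty)

lemma snd_std_coords [simp]: "snd (std_coords x) = snd x"
  by (simp add: std_coords_def)

lemma std_coords_in_coords: "std_coords x \<in> coords N x"
  using std_coords_hcoords[of x] by (cases "std_coords x") (auto simp: coords_def std_coords_def)

text \<open>The scalars \<open>c\<close> relate the two lifts and do not depend on the form, so the
  factor is common to numerator and denominator of equal multidegree and cancels in
  quotients.\<close>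

lemma coords_scale:
  assumes "u \<in> coords N x" "u' \<in> coords N x"
  shows "\<exists>c. (\<forall>k<N. c k \<noteq> (0::complex)) \<and>
    (\<forall>M e. \<forall>P\<in>multiforms N M e. P u' = (\<Prod>k<N. c k ^ e k) * P u)"
proof -
  have uu: "fst u k \<in> hcoords (fst x k)" "fst u' k \<in> hcoords (fst x k)" if "k < N" for k
    using assms that by (auto simp: coords_def)
  have sn: "snd u = snd u'" using assms by (auto simp: coords_def)
  have "\<exists>c. k < N \<longrightarrow> c \<noteq> 0 \<and> fst u' k = c *s fst u k" for k
    using uu[of k] hcoords_eq[of "fst u k" "fst x k"] by auto
  then obtain c where c: "\<And>k. k < N \<Longrightarrow> c k \<noteq> 0 \<and> fst u' k = c k *s fst u k" by metis
  have "P u' = (\<Prod>k<N. c k ^ e k) * P u" if "P \<in> multiforms N M e" for P e M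
  proof -
    have "(fst u', snd u) = u'" using sn by (simp add: prod_eq_iff)
    then show ?thesis using multiforms_scale[OF that, of "fst u'" c "fst u" "snd u"] c by simp
  qed
  with c show ?thesis by blast
qed

lemma multiforms_zero_coords:
  assumes "u \<in> coords N x" "u' \<in> coords N x" "P \<in> multiforms N M e"
  shows "P u' = 0 \<longleftrightarrow> P u = 0"
proof -
  obtain c where c: "\<And>k. k < N \<Longrightarrow> c k \<noteq> (0::complex)"
    "\<And>P e M. P \<in> multiforms N M e \<Longrightarrow> P u' = (\<Prod>k<N. c k ^ e k) * P u"
    using coords_scale[OF assms(1,2)] by blast
  show ?thesis using c(2)[OF assms(3)] c(1) by simp
qed

lemma multiforms_ratio_coords:
  assumes "u \<in> coords N x" "u' \<in> coords N x" "P \<in> multiforms N M e" "Q \<in> multiforms N M e"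
  shows "P u' / Q u' = P u / Q u"
proof -
  obtain c where c: "\<And>k. k < N \<Longrightarrow> c k \<noteq> (0::complex)"
    "\<And>P e M. P \<in> multiforms N M e \<Longrightarrow> P u' = (\<Prod>k<N. c k ^ e k) * P u"
    using coords_scale[OF assms(1,2)] by blast
  show ?thesis using c(2)[OF assms(3)] c(2)[OF assms(4)] c(1) by simp
qed

lemma nonvanishing_iff:
  assumes "Q \<in> multiforms N M e"
  shows "x \<in> nonvanishing C N M Q \<longleftrightarrow> x \<in> points C N M \<and> Q (std_coords x) \<noteq> 0"
  unfolding nonvanishing_def
  using multiforms_zero_coords[OF std_coords_in_coords _ assms] std_coords_in_coords[of x N]
  by blast

lemma nonvanishing_coords_iff:
  assumes "Q \<in> multiforms N M e" "x \<in> points C N M" "u \<in> coords N x"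
  shows "x \<in> nonvanishing C N M Q \<longleftrightarrow> Q u \<noteq> 0"
  using nonvanishing_iff[OF assms(1)] assms(2) multiforms_zero_coords[OF std_coords_in_coords assms(3,1)]
  by blast

lemma nonvanishing_mult:
  "nonvanishing C N M (\<lambda>u. P u * Q u) = nonvanishing C N M P \<inter> nonvanishing C N M Q"
  using std_coords_in_coords by (fastforce simp: nonvanishing_def)

lemma fraction_reps_iff:
  assumes "P \<in> multiforms N M e" "Q \<in> multiforms N M e"
  shows "F \<in> fraction_reps C N M P Q \<longleftrightarrow>
    (\<forall>x\<in>nonvanishing C N M Q. F x = P (std_coords x) / Q (std_coords x))"
proof -
  have "(\<forall>u\<in>coords N x. F x = P u / Q u) \<longleftrightarrow> F x = P (std_coords x) / Q (std_coords x)" for x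
    using multiforms_ratio_coords[OF std_coords_in_coords _ assms] std_coords_in_coords[of x N]
    by (metis (no_types))
  then show ?thesis unfolding fraction_reps_def by simp
qed

section \<open>Generic properties and regular functions\<close>

text \<open>The generic point as a filter: a property is generic when it holds on some nonempty
  basic open set. That these properties form a filter rests on irreducibility of the power, so
  nothing can be derived from \<open>Abs_filter\<close> before
  \<open>eventually_generic\<close>.\<close>

definition generic :: "'n::finite proj set \<Rightarrow> nat \<Rightarrow> nat \<Rightarrow> 'n pt filter" where
  "generic C N M = Abs_filter (\<lambda>p. \<exists>e. \<exists>Q\<in>multiforms N M e.
     nonvanishing C N M Q \<noteq> {} \<and> (\<forall>x\<in>nonvanishing C N M Q. p x))"

text \<open>Membership in the local ring at \<open>x\<close>, stated for total functions and not for
  germs: \<open>F\<close> equals a fraction on a whole neighbourhood of \<open>x\<close>, so its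
  value at \<open>x\<close> is meaningful.\<close>

definition regular_at :: "'n::finite proj set \<Rightarrow> nat \<Rightarrow> nat \<Rightarrow> 'n pt \<Rightarrow> ('n pt \<Rightarrow> complex) \<Rightarrow> bool" where
  "regular_at C N M x F \<longleftrightarrow> (\<exists>e. \<exists>P\<in>multiforms N M e. \<exists>Q\<in>multiforms N M e.
     x \<in> nonvanishing C N M Q \<and> F \<in> fraction_reps C N M P Q)"

lemma regular_at_points: "regular_at C N M x F \<Longrightarrow> x \<in> points C N M"
  by (auto simp: regular_at_def nonvanishing_def)

lemma regular_atE:
  assumes "regular_at C N M x F"
  obtains e P Q where "P \<in> multiforms N M e" "Q \<in> multiforms N M e" "x \<in> nonvanishing C N M Q"
    "\<And>y. y \<in> nonvanishing C N M Q \<Longrightarrow> F y = P (std_coords y) / Q (std_coords y)"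
    "\<And>y. y \<in> nonvanishing C N M Q \<Longrightarrow> Q (std_coords y) \<noteq> 0"
  using assms unfolding regular_at_def
  by (metis fraction_reps_iff nonvanishing_iff)

lemma regular_atI:
  assumes "P \<in> multiforms N M e" "Q \<in> multiforms N M e" "x \<in> nonvanishing C N M Q"
    "\<And>y. y \<in> nonvanishing C N M Q \<Longrightarrow> Q (std_coords y) \<noteq> 0 \<Longrightarrow> F y = P (std_coords y) / Q (std_coords y)"
  shows "regular_at C N M x F"
  unfolding regular_at_def using assms
  by (metis fraction_reps_iff nonvanishing_iff)

lemma carrier_rep_ring: "carrier (rep_ring C N M) = {F. \<exists>x. regular_at C N M x F}"
  unfolding rep_ring_def regular_at_def by auto

lemma rep_ring_simps [simp]:
  "\<one>\<^bsub>rep_ring C N M\<^esub> = (\<lambda>x. 1)" "\<zero>\<^bsub>rep_ring C N M\<^esub> = (\<lambda>x. 0)"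
  "F \<otimes>\<^bsub>rep_ring C N M\<^esub> G = (\<lambda>x. F x * G x)" "F \<oplus>\<^bsub>rep_ring C N M\<^esub> G = (\<lambda>x. F x + G x)"
  by (simp_all add: rep_ring_def)

lemma regular_at_const: "x \<in> points C N M \<Longrightarrow> regular_at C N M x (\<lambda>_. c)"
  by (rule regular_atI[OF multiforms_const[of c] multiforms_const[of 1]])
    (auto simp: nonvanishing_def)

lemma regular_at_mult:
  assumes "regular_at C N M x F" "regular_at C N M x G"
  shows "regular_at C N M x (\<lambda>x. F x * G x)"
proof -
  obtain e P Q where 1: "P \<in> multiforms N M e" "Q \<in> multiforms N M e" "x \<in> nonvanishing C N M Q"
    "\<And>y. y \<in> nonvanishing C N M Q \<Longrightarrow> F y = P (std_coords y) / Q (std_coords y)"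
    using regular_atE[OF assms(1)] by metis
  obtain e' P' Q' where 2: "P' \<in> multiforms N M e'" "Q' \<in> multiforms N M e'" "x \<in> nonvanishing C N M Q'"
    "\<And>y. y \<in> nonvanishing C N M Q' \<Longrightarrow> G y = P' (std_coords y) / Q' (std_coords y)"
    using regular_atE[OF assms(2)] by metis
  show ?thesis
    by (rule regular_atI[OF multiforms_mult[OF 1(1) 2(1)] multiforms_mult[OF 1(2) 2(2)]])
      (use 1 2 in \<open>auto simp: nonvanishing_mult\<close>)
qed

lemma regular_at_add:
  assumes "regular_at C N M x F" "regular_at C N M x G"
  shows "regular_at C N M x (\<lambda>x. F x + G x)"
proof -
  obtain e P Q where 1: "P \<in> multiforms N M e" "Q \<in> multiforms N M e" "x \<in> nonvanishing C N M Q"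
    "\<And>y. y \<in> nonvanishing C N M Q \<Longrightarrow> F y = P (std_coords y) / Q (std_coords y)"
    using regular_atE[OF assms(1)] by metis
  obtain e' P' Q' where 2: "P' \<in> multiforms N M e'" "Q' \<in> multiforms N M e'" "x \<in> nonvanishing C N M Q'"
    "\<And>y. y \<in> nonvanishing C N M Q' \<Longrightarrow> G y = P' (std_coords y) / Q' (std_coords y)"
    using regular_atE[OF assms(2)] by metis
  have "(\<lambda>u. P' u * Q u) \<in> multiforms N M (\<lambda>k. e k + e' k)"
    using multiforms_mult[OF 2(1) 1(2)] by (simp add: add.commute)
  from regular_atI[OF multiforms_add[OF multiforms_mult[OF 1(1) 2(2)] this] multiforms_mult[OF 1(2) 2(2)]]
  show ?thesis
    using 1 2 by (auto simp: nonvanishing_mult field_simps)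
qed

lemma regular_at_sum:
  assumes "x \<in> points C N M" "\<And>i. i \<in> I \<Longrightarrow> regular_at C N M x (F i)"
  shows "regular_at C N M x (\<lambda>x. \<Sum>i\<in>I. F i x)"
  using assms(2)
  by (induction I rule: infinite_finite_induct) (auto intro: regular_at_const regular_at_add assms(1))

lemma regular_at_prod:
  assumes "x \<in> points C N M" "\<And>i. i \<in> I \<Longrightarrow> regular_at C N M x (F i)"
  shows "regular_at C N M x (\<lambda>x. \<Prod>i\<in>I. F i x)"
  using assms(2)
  by (induction I rule: infinite_finite_induct) (auto intro: regular_at_const regular_at_mult assms(1))

lemma regular_at_inverse:
  assumes "regular_at C N M x F" "F x \<noteq> 0"
  shows "regular_at C N M x (\<lambda>x. inverse (F x))"
proof -
  obtain e P Q where 1: "P \<in> multiforms N M e" "Q \<in> multiforms N M e" "x \<in> nonvanishing C N M Q"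
    "\<And>y. y \<in> nonvanishing C N M Q \<Longrightarrow> F y = P (std_coords y) / Q (std_coords y)"
    using regular_atE[OF assms(1)] by metis
  have "x \<in> nonvanishing C N M P"
    using 1(3) 1(4)[OF 1(3)] assms(2) nonvanishing_iff[OF 1(1)] nonvanishing_iff[OF 1(2)] by auto
  \<comment> \<open>The inverse is written \<open>Q Q / (P Q)\<close>, whose domain lies inside that
    of \<open>P / Q\<close>, where the values of \<open>F\<close> are known.\<close>
  then show ?thesis
    by (intro regular_atI[OF multiforms_mult[OF 1(2) 1(2)] multiforms_mult[OF 1(1) 1(2)]])
      (use 1 in \<open>auto simp: nonvanishing_mult\<close>)
qed

section \<open>Irreducibility of the powers of the curve\<close>

locale irreducible_curve =
  fixes C :: "'n::finite proj set"
  assumes irreducible: "irreducible_in zariski C"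
begin

definition cone_points :: "(complex ^ 'n) set" where
  "cone_points = (\<Union>p\<in>C. hcoords p)"

text \<open>Otherwise \<open>C\<close> would be covered by the zero loci of \<open>P\<close> and
  \<open>Q\<close>, two closed sets neither of which contains it.\<close>

lemma forms_common_nonzero:
  assumes "P \<in> forms e" "Q \<in> forms e'" "a \<in> cone_points" "P a \<noteq> 0" "b \<in> cone_points" "Q b \<noteq> 0"
  shows "\<exists>v\<in>cone_points. P v \<noteq> 0 \<and> Q v \<noteq> 0"
proof (rule ccontr)
  assume neg: "\<not> ?thesis"
  \<comment> \<open>\<open>closedin\<close> refers to the underlying set of the topology; it is
    everything, because the constant form \<open>1\<close> has no zeros.\<close>
  have UN: "topspace zariski = (UNIV :: 'n proj set)"
  proof -
    have "UNIV = - proj_zeros {\<lambda>_::complex^'n. 1}"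
      using hcoords_nonempty by (auto simp: proj_zeros_def)
    moreover have "(\<lambda>_. 1) \<in> forms 0" by (simp add: forms_def poly_funs.const)
    ultimately have "openin zariski (UNIV :: 'n proj set)"
      unfolding openin_zariski by (intro exI[of _ "{\<lambda>_. 1}"]) auto
    then show ?thesis by (meson openin_subset top.extremum_uniqueI)
  qed
  have cl: "closedin zariski (proj_zeros {R})" if "R \<in> forms k" for R :: "complex^'n \<Rightarrow> complex" and k
    unfolding closedin_def UN Compl_eq_Diff_UNIV[symmetric] openin_zariski
    by (intro conjI subset_UNIV exI[of _ "{R}"] refl) (use that in blast)
  have "C \<subseteq> proj_zeros {P} \<union> proj_zeros {Q}"
  proof
    fix p assume p: "p \<in> C"
    obtain v where v: "v \<in> hcoords p" using hcoords_nonempty by blast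
    have zero: "p \<in> proj_zeros {R}" if R: "R \<in> forms k" "R v = 0" for R k
      using R hcoords_eq[OF v] by (auto simp: proj_zeros_def forms_def)
    have "P v = 0 \<or> Q v = 0" using neg v p unfolding cone_points_def by blast
    then show "p \<in> proj_zeros {P} \<union> proj_zeros {Q}" using zero assms(1,2) by blast
  qed
  then have "C \<subseteq> proj_zeros {P} \<or> C \<subseteq> proj_zeros {Q}"
    using irreducible cl[OF assms(1)] cl[OF assms(2)] unfolding irreducible_in_def by blast
  then show False using assms(3-6) unfolding proj_zeros_def cone_points_def by blast
qed

lemma cone_point_to_point:
  assumes "\<And>k. k < N \<Longrightarrow> v k \<in> cone_points"
  obtains x where "x \<in> points C N M" "\<And>k. k < N \<Longrightarrow> v k \<in> hcoords (fst x k)"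
    "\<And>j. j < M \<Longrightarrow> snd x j = \<xi> j"
proof -
  have "\<exists>p. k < N \<longrightarrow> p \<in> C \<and> v k \<in> hcoords p" for k using assms cone_points_def by blast
  then obtain p where "\<And>k. k < N \<Longrightarrow> p k \<in> C \<and> v k \<in> hcoords (p k)" by metis
  then show thesis
    by (intro that[of "(\<lambda>k\<in>{..<N}. p k, \<lambda>j\<in>{..<M}. \<xi> j)"]) (auto simp: points_def)
qed

text \<open>The variables are made equal one after the other: first the points of the curve, by
  irreducibility, then the affine coordinates.\<close>

lemma nonvanishing_Int_nonempty:
  assumes P: "P \<in> multiforms N M e" and Q: "Q \<in> multiforms N M e'"
    and "nonvanishing C N M P \<noteq> {}" "nonvanishing C N M Q \<noteq> {}"
  shows "nonvanishing C N M P \<inter> nonvanishing C N M Q \<noteq> {}"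
proof -
  have ex: "\<exists>v \<xi>. (\<forall>k<N. v k \<in> cone_points) \<and> R (v, \<xi>) \<noteq> 0"
    if R: "R \<in> multiforms N M e" "nonvanishing C N M R \<noteq> {}" for R e
  proof -
    obtain x where x: "x \<in> points C N M" "R (std_coords x) \<noteq> 0"
      using R(2) nonvanishing_iff[OF R(1)] by blast
    then have "fst x k \<in> C" if "k < N" for k using that by (auto simp: points_def)
    then have "\<forall>k<N. fst (std_coords x) k \<in> cone_points"
      unfolding cone_points_def using std_coords_hcoords by blast
    then show ?thesis using x(2) by (metis prod.collapse)
  qed
  have 1: "\<exists>v w \<xi> \<eta>. (\<forall>k<N. v k \<in> cone_points) \<and> (\<forall>k<N. w k \<in> cone_points) \<and> (\<forall>k<n. v k = w k)
     \<and> P (v, \<xi>) \<noteq> 0 \<and> Q (w, \<eta>) \<noteq> 0" if "n \<le> N" for n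
    using that
  proof (induction n)
    case 0
    then show ?case using ex[OF P assms(3)] ex[OF Q assms(4)] by auto
  next
    case (Suc n)
    then obtain v w \<xi> \<eta> where vw: "\<forall>k<N. v k \<in> cone_points" "\<forall>k<N. w k \<in> cone_points" "\<forall>k<n. v k = w k"
      "P (v, \<xi>) \<noteq> 0" "Q (w, \<eta>) \<noteq> 0" by auto
    have n: "n < N" using Suc by simp
    obtain a where a: "a \<in> cone_points" "P (v(n := a), \<xi>) \<noteq> 0" "Q (w(n := a), \<eta>) \<noteq> 0"
      using forms_common_nonzero[OF multiforms_slice_forms[OF P n, of v \<xi>]
          multiforms_slice_forms[OF Q n, of w \<eta>], of "v n" "w n"] vw n by auto
    show ?case
      by (rule exI[of _ "v(n := a)"], rule exI[of _ "w(n := a)"], rule exI[of _ \<xi>], rule exI[of _ \<eta>])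
        (use a vw in \<open>simp add: less_Suc_eq del: fun_upd_apply, simp\<close>)
  qed
  obtain v w \<xi>0 \<eta>0 where vw: "\<forall>k<N. v k \<in> cone_points" "\<forall>k<N. v k = w k"
      "P (v, \<xi>0) \<noteq> 0" "Q (w, \<eta>0) \<noteq> 0" using 1[of N] by blast
  \<comment> \<open>The points now agree, but the two families of fibre coordinates may still
    differ.\<close>
  have Qv: "Q (v, \<eta>0) \<noteq> 0" using vw multiforms_cong[OF Q, of v w \<eta>0 \<eta>0] by simp
  have "\<exists>\<xi> \<eta>. (\<forall>j<n. \<xi> j = \<eta> j) \<and> P (v, \<xi>) \<noteq> 0 \<and> Q (v, \<eta>) \<noteq> 0" for n
  proof (induction n)
    case 0
    then show ?case using vw Qv by auto
  next
    case (Suc n)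
    then obtain \<xi> \<eta> where x: "\<forall>j<n. \<xi> j = \<eta> j" "P (v, \<xi>) \<noteq> 0" "Q (v, \<eta>) \<noteq> 0" by blast
    obtain t where t: "P (v, \<xi>(n := t)) \<noteq> 0" "Q (v, \<eta>(n := t)) \<noteq> 0"
      using poly_funs_univariate_common_nonzero[OF multiforms_slice_affine[OF P, of v \<xi> n]
          multiforms_slice_affine[OF Q, of v \<eta> n], of "\<xi> n" "\<eta> n"] x by auto
    show ?case
      by (rule exI[of _ "\<xi>(n := t)"], rule exI[of _ "\<eta>(n := t)"]) (use x t in \<open>simp add: less_Suc_eq del: fun_upd_apply, simp\<close>)
  qed
  then obtain \<xi> \<eta> where x: "\<forall>j<M. \<xi> j = \<eta> j" "P (v, \<xi>) \<noteq> 0" "Q (v, \<eta>) \<noteq> 0" by meson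
  obtain z where z: "z \<in> points C N M" "\<And>k. k < N \<Longrightarrow> v k \<in> hcoords (fst z k)"
    "\<And>j. j < M \<Longrightarrow> snd z j = \<xi> j"
    using cone_point_to_point[of N v M \<xi>] vw(1) by metis
  have u: "(v, snd z) \<in> coords N z" using z(2) by (simp add: coords_def)
  have "P (v, snd z) \<noteq> 0" "Q (v, snd z) \<noteq> 0"
    using multiforms_cong[OF P, of v v "snd z" \<xi>] multiforms_cong[OF Q, of v v "snd z" \<eta>] x z(3) by simp_all
  then show ?thesis
    using nonvanishing_coords_iff[OF P z(1) u] nonvanishing_coords_iff[OF Q z(1) u] by blast
qed

lemma points_nonempty: "points C N M \<noteq> {}"
proof -
  obtain p where "p \<in> C" using irreducible unfolding irreducible_in_def by blast
  then have "(\<lambda>k\<in>{..<N}. p, \<lambda>j\<in>{..<M}. 0) \<in> points C N M" by (auto simp: points_def)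
  then show ?thesis by blast
qed

lemma eventually_generic:
  "eventually p (generic C N M) \<longleftrightarrow> (\<exists>e. \<exists>Q\<in>multiforms N M e.
     nonvanishing C N M Q \<noteq> {} \<and> (\<forall>x\<in>nonvanishing C N M Q. p x))"
  unfolding generic_def
proof (rule eventually_Abs_filter, standard, goal_cases)
  case 1
  have "nonvanishing C N M (\<lambda>_. 1) = points C N M" by (simp add: nonvanishing_def)
  then show ?case using multiforms_const[of 1 N M] points_nonempty by metis
next
  case (2 p q)
  then obtain e P e' Q where *: "P \<in> multiforms N M e" "Q \<in> multiforms N M e'"
    "nonvanishing C N M P \<noteq> {}" "nonvanishing C N M Q \<noteq> {}"
    "\<forall>x\<in>nonvanishing C N M P. p x" "\<forall>x\<in>nonvanishing C N M Q. q x" by metis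
  show ?case
    by (rule exI, rule bexI[OF _ multiforms_mult[OF *(1,2)]])
      (use nonvanishing_Int_nonempty[OF *(1-4)] * in \<open>auto simp: nonvanishing_mult\<close>)
next
  case (3 p q)
  then show ?case by metis
qed

lemma eventually_genericI:
  "Q \<in> multiforms N M e \<Longrightarrow> x \<in> nonvanishing C N M Q \<Longrightarrow> (\<And>y. y \<in> nonvanishing C N M Q \<Longrightarrow> p y)
    \<Longrightarrow> eventually p (generic C N M)"
  unfolding eventually_generic by blast

lemma generic_neq_bot: "generic C N M \<noteq> bot"
  unfolding trivial_limit_def eventually_generic by blast

lemma eventually_generic_ex: "eventually p (generic C N M) \<Longrightarrow> \<exists>x. p x"
  by (rule eventually_happens'[OF generic_neq_bot])

lemma eventually_generic_points: "\<forall>\<^sub>F x in generic C N M. x \<in> points C N M"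
  unfolding eventually_generic
  using multiforms_const[of 1 N M] points_nonempty by (force simp: nonvanishing_def)

lemma regular_at_eventually:
  assumes "regular_at C N M x F"
  shows "\<forall>\<^sub>F y in generic C N M. regular_at C N M y F"
proof -
  obtain e P Q where *: "P \<in> multiforms N M e" "Q \<in> multiforms N M e" "x \<in> nonvanishing C N M Q"
    "F \<in> fraction_reps C N M P Q" using assms unfolding regular_at_def by blast
  then show ?thesis
    by (intro eventually_genericI[OF *(2,3)]) (auto simp: regular_at_def)
qed

lemma regular_at_nonzero_eventually:
  assumes "regular_at C N M x F" "F x \<noteq> 0"
  shows "\<forall>\<^sub>F y in generic C N M. F y \<noteq> 0"
proof -
  obtain e P Q where 1: "P \<in> multiforms N M e" "Q \<in> multiforms N M e" "x \<in> nonvanishing C N M Q"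
    "\<And>y. y \<in> nonvanishing C N M Q \<Longrightarrow> F y = P (std_coords y) / Q (std_coords y)"
    using regular_atE[OF assms(1)] by metis
  have "x \<in> nonvanishing C N M P"
    using 1(3) 1(4)[OF 1(3)] assms(2) nonvanishing_iff[OF 1(1)] nonvanishing_iff[OF 1(2)] by auto
  then show ?thesis
    by (intro eventually_genericI[OF multiforms_mult[OF 1(1,2)], of x])
      (use 1 nonvanishing_iff[OF 1(1)] nonvanishing_iff[OF 1(2)] in \<open>auto simp: nonvanishing_mult\<close>)
qed

text \<open>A nonzero value at \<open>x\<close> would spread to a nonempty open set. This is the
  passage from generic identities to values at a chosen point.\<close>

lemma regular_at_zero:
  assumes "regular_at C N M x F" "\<forall>\<^sub>F y in generic C N M. F y = 0"
  shows "F x = 0"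
proof (rule ccontr)
  assume "F x \<noteq> 0"
  from eventually_conj[OF regular_at_nonzero_eventually[OF assms(1) this] assms(2)]
  show False using eventually_generic_ex by fastforce
qed

section \<open>Representatives of rational functions\<close>

abbreviation reps :: "nat \<Rightarrow> nat \<Rightarrow> ('n pt \<Rightarrow> complex) set" where
  "reps N M \<equiv> carrier (rep_ring C N M)"

abbreviation \<F> :: "nat \<Rightarrow> 'n ratfun ring" where
  "\<F> N \<equiv> fun_field_power C N"

text \<open>Regularity at one point is regularity at generic points; closure properties of
  representatives thereby reduce to those of \<open>regular_at\<close> at a common point.\<close>

lemma reps_iff: "F \<in> reps N M \<longleftrightarrow> (\<forall>\<^sub>F x in generic C N M. regular_at C N M x F)"
  unfolding carrier_rep_ring using regular_at_eventually eventually_generic_ex by blast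

lemma regular_at_reps: "regular_at C N M x F \<Longrightarrow> F \<in> reps N M"
  unfolding carrier_rep_ring by blast

lemma reps_const: "(\<lambda>_. c) \<in> reps N M"
  unfolding reps_iff
  by (rule eventually_mono[OF eventually_generic_points]) (rule regular_at_const)

lemma reps_mult: "F \<in> reps N M \<Longrightarrow> G \<in> reps N M \<Longrightarrow> (\<lambda>x. F x * G x) \<in> reps N M"
  unfolding reps_iff by (erule (1) eventually_elim2) (rule regular_at_mult)

lemma reps_add: "F \<in> reps N M \<Longrightarrow> G \<in> reps N M \<Longrightarrow> (\<lambda>x. F x + G x) \<in> reps N M"
  unfolding reps_iff by (erule (1) eventually_elim2) (rule regular_at_add)

lemma reps_uminus: "F \<in> reps N M \<Longrightarrow> (\<lambda>x. - F x) \<in> reps N M"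
  using reps_mult[OF reps_const[of "-1"]] by simp

lemma reps_sum: "(\<And>i. i \<in> I \<Longrightarrow> F i \<in> reps N M) \<Longrightarrow> (\<lambda>x. \<Sum>i\<in>I. F i x) \<in> reps N M"
  by (induction I rule: infinite_finite_induct) (auto intro: reps_const reps_add)

lemma reps_prod: "(\<And>i. i \<in> I \<Longrightarrow> F i \<in> reps N M) \<Longrightarrow> (\<lambda>x. \<Prod>i\<in>I. F i x) \<in> reps N M"
  by (induction I rule: infinite_finite_induct) (auto intro: reps_const reps_mult)

lemma reps_power: "F \<in> reps N M \<Longrightarrow> (\<lambda>x. F x ^ n) \<in> reps N M"
  by (induction n) (auto intro: reps_const reps_mult)

lemma reps_cong:
  assumes "F \<in> reps N M" "\<forall>\<^sub>F x in generic C N M. F x = G x"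
  shows "G \<in> reps N M"
proof -
  obtain x e P Q where 1: "P \<in> multiforms N M e" "Q \<in> multiforms N M e" "x \<in> nonvanishing C N M Q"
    "\<And>y. y \<in> nonvanishing C N M Q \<Longrightarrow> F y = P (std_coords y) / Q (std_coords y)"
    using assms(1) unfolding carrier_rep_ring by (auto elim!: regular_atE)
  obtain e' R where R: "R \<in> multiforms N M e'" "nonvanishing C N M R \<noteq> {}"
    "\<forall>x\<in>nonvanishing C N M R. F x = G x" using assms(2) unfolding eventually_generic by blast
  obtain y where y: "y \<in> nonvanishing C N M Q" "y \<in> nonvanishing C N M R"
    using nonvanishing_Int_nonempty[OF 1(2) R(1) _ R(2)] 1(3) by blast
  \<comment> \<open>Multiplying numerator and denominator by \<open>R\<close> shrinks the domain to
    points where \<open>F\<close> and \<open>G\<close> agree.\<close>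
  have "regular_at C N M y G"
    by (rule regular_atI[OF multiforms_mult[OF 1(1) R(1)] multiforms_mult[OF 1(2) R(1)]])
      (use y 1 R in \<open>auto simp: nonvanishing_mult\<close>)
  then show ?thesis by (rule regular_at_reps)
qed

text \<open>A nonzero value at a regular point persists on an open set; if there is none, the
  function vanishes at all its regular points. This dichotomy is what makes the ring of germs a
  field.\<close>

lemma reps_zero_or_nonzero:
  assumes "F \<in> reps N M"
  shows "(\<forall>\<^sub>F x in generic C N M. F x = 0) \<or> (\<forall>\<^sub>F x in generic C N M. F x \<noteq> 0)"
proof (cases "\<exists>x. regular_at C N M x F \<and> F x \<noteq> 0")
  case True
  then show ?thesis using regular_at_nonzero_eventually by blast
next
  case False
  then show ?thesis using assms unfolding reps_iff by (auto elim: eventually_mono)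
qed

text \<open>With \<open>inverse 0 = 0\<close> a function that vanishes generically is generically
  its own inverse, so inverses can be formed without a nonvanishing condition.\<close>

lemma reps_inverse:
  assumes "F \<in> reps N M"
  shows "(\<lambda>x. inverse (F x)) \<in> reps N M"
  using reps_zero_or_nonzero[OF assms]
proof
  assume "\<forall>\<^sub>F x in generic C N M. F x = 0"
  then show ?thesis by (intro reps_cong[OF assms]) (auto elim: eventually_mono)
next
  assume "\<forall>\<^sub>F x in generic C N M. F x \<noteq> 0"
  with assms show ?thesis unfolding reps_iff
    by (rule eventually_elim2) (rule regular_at_inverse)
qed

lemma null_reps_iff: "F \<in> null_reps C N M \<longleftrightarrow> F \<in> reps N M \<and> (\<forall>\<^sub>F x in generic C N M. F x = 0)"
  by (simp add: null_reps_def eventually_generic)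

lemma cring_rep_ring: "cring (rep_ring C N M)"
proof (rule cringI)
  show "abelian_group (rep_ring C N M)"
    by (rule abelian_groupI)
      (auto simp: reps_add reps_const add.assoc add.commute intro!: bexI[OF _ reps_uminus])
  show "Group.comm_monoid (rep_ring C N M)"
    by (rule comm_monoidI) (auto simp: reps_mult reps_const mult.assoc mult.commute)
qed (auto simp: distrib_right)

lemma rep_ring_a_inv: "F \<in> reps N M \<Longrightarrow> \<ominus>\<^bsub>rep_ring C N M\<^esub> F = (\<lambda>x. - F x)"
proof -
  interpret cring "rep_ring C N M" by (rule cring_rep_ring)
  assume "F \<in> reps N M"
  then show ?thesis using minus_equality[of "\<lambda>x. - F x" F] by (simp add: reps_uminus)
qed

lemma ideal_null_reps: "ideal (null_reps C N M) (rep_ring C N M)"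
proof (rule idealI)
  interpret cring "rep_ring C N M" by (rule cring_rep_ring)
  show "ring (rep_ring C N M)" by (rule ring_axioms)
  show "subgroup (null_reps C N M) (add_monoid (rep_ring C N M))"
  proof (rule add.subgroupI)
    show "null_reps C N M \<subseteq> reps N M" by (auto simp: null_reps_iff)
    show "null_reps C N M \<noteq> {}" using reps_const[of 0 N M] null_reps_iff[of "\<lambda>_. 0" N M] by auto
    show "\<ominus>\<^bsub>rep_ring C N M\<^esub> F \<in> null_reps C N M" if "F \<in> null_reps C N M" for F
      using that by (simp add: null_reps_iff rep_ring_a_inv reps_uminus)
    show "F \<oplus>\<^bsub>rep_ring C N M\<^esub> G \<in> null_reps C N M" if "F \<in> null_reps C N M" "G \<in> null_reps C N M" for F G
      using that by (auto simp: null_reps_iff reps_add elim: eventually_elim2)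
  qed
qed (auto simp: null_reps_iff reps_mult elim: eventually_mono)

section \<open>The field of rational functions\<close>

text \<open>Cosets of the null ideal become classes for generic equality, so identities between
  germs can be checked on values.\<close>

lemma mem_germ_iff:
  assumes "F \<in> reps N M"
  shows "G \<in> germ C N M F \<longleftrightarrow> G \<in> reps N M \<and> (\<forall>\<^sub>F x in generic C N M. F x = G x)"
proof -
  interpret cring "rep_ring C N M" by (rule cring_rep_ring)
  have "germ C N M F = {H \<oplus>\<^bsub>rep_ring C N M\<^esub> F |H. H \<in> null_reps C N M}"
    unfolding germ_def a_r_coset_def' by blast
  then have *: "G \<in> germ C N M F \<longleftrightarrow> (\<exists>H\<in>null_reps C N M. G = (\<lambda>x. H x + F x))" by auto
  show ?thesis
  proof
    assume "G \<in> germ C N M F"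
    then obtain H where "H \<in> null_reps C N M" and G: "G = (\<lambda>x. H x + F x)"
      using * by blast
    then have "H \<in> reps N M" "\<forall>\<^sub>F x in generic C N M. H x = 0" by (simp_all add: null_reps_iff)
    with G show "G \<in> reps N M \<and> (\<forall>\<^sub>F x in generic C N M. F x = G x)"
      by (auto intro: reps_add assms elim: eventually_mono)
  next
    assume G: "G \<in> reps N M \<and> (\<forall>\<^sub>F x in generic C N M. F x = G x)"
    then have "(\<lambda>x. G x + - F x) \<in> null_reps C N M"
      unfolding null_reps_iff
      by (intro conjI reps_add reps_uminus assms) (auto elim: eventually_mono)
    then show "G \<in> germ C N M F"
      unfolding * by (intro bexI[of _ "\<lambda>x. G x + - F x"]) auto
  qed
qed

lemma germ_eq_iff:
  assumes "F \<in> reps N M" "G \<in> reps N M"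
  shows "germ C N M F = germ C N M G \<longleftrightarrow> (\<forall>\<^sub>F x in generic C N M. F x = G x)"
proof
  assume "germ C N M F = germ C N M G"
  then have "G \<in> germ C N M F" using mem_germ_iff[OF assms(2), of G] assms(2) by simp
  then show "\<forall>\<^sub>F x in generic C N M. F x = G x" using mem_germ_iff[OF assms(1)] by blast
next
  assume FG: "\<forall>\<^sub>F x in generic C N M. F x = G x"
  have "(\<forall>\<^sub>F x in generic C N M. F x = H x) \<longleftrightarrow> (\<forall>\<^sub>F x in generic C N M. G x = H x)" for H
    by (rule eventually_cong[OF FG]) simp
  then show "germ C N M F = germ C N M G"
    using mem_germ_iff[OF assms(1)] mem_germ_iff[OF assms(2)] by blast
qed

lemma germ_cong:
  assumes "F \<in> reps N M" "\<forall>\<^sub>F x in generic C N M. F x = G x"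
  shows "germ C N M F = germ C N M G"
  using germ_eq_iff[OF assms(1) reps_cong[OF assms]] assms(2) by blast

lemma germ_ring_hom: "germ C N M \<in> Ring.ring_hom (rep_ring C N M) (rat_field C N M)"
proof -
  have "germ C N M = (+>\<^bsub>rep_ring C N M\<^esub>) (null_reps C N M)" by (simp add: fun_eq_iff germ_def)
  then show ?thesis unfolding rat_field_def by (simp add: ideal.rcos_ring_hom[OF ideal_null_reps])
qed

lemma cring_rat_field: "cring (rat_field C N M)"
  unfolding rat_field_def by (rule ideal.quotient_is_cring[OF ideal_null_reps cring_rep_ring])

lemma carrier_rat_field: "carrier (rat_field C N M) = germ C N M ` reps N M"
  by (auto simp: rat_field_def FactRing_def A_RCOSETS_def' germ_def)

lemma germ_closed: "F \<in> reps N M \<Longrightarrow> germ C N M F \<in> carrier (rat_field C N M)"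
  by (simp add: carrier_rat_field)

lemma germ_add:
  assumes "F \<in> reps N M" "G \<in> reps N M"
  shows "germ C N M F \<oplus>\<^bsub>rat_field C N M\<^esub> germ C N M G = germ C N M (\<lambda>x. F x + G x)"
  using ring_hom_add[OF germ_ring_hom assms] by simp

lemma germ_mult:
  assumes "F \<in> reps N M" "G \<in> reps N M"
  shows "germ C N M F \<otimes>\<^bsub>rat_field C N M\<^esub> germ C N M G = germ C N M (\<lambda>x. F x * G x)"
  using ring_hom_mult[OF germ_ring_hom assms] by simp

lemma one_rat_field: "\<one>\<^bsub>rat_field C N M\<^esub> = germ C N M (\<lambda>_. 1)"
  using ring_hom_one[OF germ_ring_hom] by simp

lemma zero_rat_field: "\<zero>\<^bsub>rat_field C N M\<^esub> = germ C N M (\<lambda>_. 0)"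
  using ring_hom_zero[OF germ_ring_hom cring.axioms(1)[OF cring_rep_ring] cring.axioms(1)[OF cring_rat_field]]
  by simp

lemma germ_eq_zero_iff:
  assumes "F \<in> reps N M"
  shows "germ C N M F = \<zero>\<^bsub>rat_field C N M\<^esub> \<longleftrightarrow> (\<forall>\<^sub>F x in generic C N M. F x = 0)"
  unfolding zero_rat_field using germ_eq_iff[OF assms reps_const] .

lemma germ_mult_inverse:
  assumes "F \<in> reps N M" "germ C N M F \<noteq> \<zero>\<^bsub>rat_field C N M\<^esub>"
  shows "germ C N M F \<otimes>\<^bsub>rat_field C N M\<^esub> germ C N M (\<lambda>x. inverse (F x)) = \<one>\<^bsub>rat_field C N M\<^esub>"
proof -
  have "\<forall>\<^sub>F x in generic C N M. F x \<noteq> 0"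
    using assms germ_eq_zero_iff reps_zero_or_nonzero by blast
  then have "\<forall>\<^sub>F x in generic C N M. F x * inverse (F x) = 1"
    by (rule eventually_mono) simp
  then show ?thesis
    unfolding one_rat_field germ_mult[OF assms(1) reps_inverse[OF assms(1)]]
    by (intro germ_cong reps_mult reps_inverse assms)
qed

lemma field_rat_field: "field (rat_field C N M)"
proof (rule cring.cring_fieldI2[OF cring_rat_field])
  show "\<zero>\<^bsub>rat_field C N M\<^esub> \<noteq> \<one>\<^bsub>rat_field C N M\<^esub>"
    unfolding one_rat_field zero_rat_field germ_eq_iff[OF reps_const reps_const]
    using generic_neq_bot by simp
  show "\<exists>b\<in>carrier (rat_field C N M). a \<otimes>\<^bsub>rat_field C N M\<^esub> b = \<one>\<^bsub>rat_field C N M\<^esub>"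
    if a: "a \<in> carrier (rat_field C N M)" "a \<noteq> \<zero>\<^bsub>rat_field C N M\<^esub>" for a
  proof -
    obtain F where "F \<in> reps N M" "a = germ C N M F" using a(1) unfolding carrier_rat_field by blast
    then show ?thesis
      using germ_mult_inverse a(2) by (intro bexI[OF _ germ_closed[OF reps_inverse]]) auto
  qed
qed

lemma germ_inv:
  assumes "F \<in> reps N M" "germ C N M F \<noteq> \<zero>\<^bsub>rat_field C N M\<^esub>"
  shows "inv\<^bsub>rat_field C N M\<^esub> germ C N M F = germ C N M (\<lambda>x. inverse (F x))"
proof -
  interpret cring "rat_field C N M" by (rule cring_rat_field)
  show ?thesis
    by (rule comm_inv_char) (intro germ_closed reps_inverse germ_mult_inverse assms)+
qed

lemma germ_finsum:
  assumes "\<And>i. i \<in> I \<Longrightarrow> F i \<in> reps N M"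
  shows "(\<Oplus>\<^bsub>rat_field C N M\<^esub>i\<in>I. germ C N M (F i)) = germ C N M (\<lambda>x. \<Sum>i\<in>I. F i x)"
proof -
  interpret cring "rat_field C N M" by (rule cring_rat_field)
  show ?thesis using assms
  proof (induction I rule: infinite_finite_induct)
    case (insert i I)
    then have "(\<Oplus>\<^bsub>rat_field C N M\<^esub>j\<in>insert i I. germ C N M (F j)) =
        germ C N M (F i) \<oplus>\<^bsub>rat_field C N M\<^esub> germ C N M (\<lambda>x. \<Sum>i\<in>I. F i x)"
      by (subst finsum_insert) (auto intro: germ_closed)
    also have "\<dots> = germ C N M (\<lambda>x. \<Sum>i\<in>insert i I. F i x)"
      using insert by (subst germ_add) (auto intro: reps_sum)
    finally show ?case .
  qed (auto simp: zero_rat_field finsum_infinite)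
qed

lemma germ_finsum_mult:
  assumes "\<And>k. k \<in> I \<Longrightarrow> P k \<in> reps N M" "\<And>k. k \<in> I \<Longrightarrow> Q k \<in> reps N M"
  shows "(\<Oplus>\<^bsub>rat_field C N M\<^esub>k\<in>I. germ C N M (P k) \<otimes>\<^bsub>rat_field C N M\<^esub> germ C N M (Q k)) =
    germ C N M (\<lambda>x. \<Sum>k\<in>I. P k x * Q k x)"
proof -
  interpret cring "rat_field C N M" by (rule cring_rat_field)
  have "(\<Oplus>\<^bsub>rat_field C N M\<^esub>k\<in>I. germ C N M (P k) \<otimes>\<^bsub>rat_field C N M\<^esub> germ C N M (Q k)) =
      (\<Oplus>\<^bsub>rat_field C N M\<^esub>k\<in>I. germ C N M (\<lambda>x. P k x * Q k x))"
    by (rule finsum_cong') (use assms in \<open>auto simp: germ_mult intro!: germ_closed reps_mult\<close>)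
  also have "\<dots> = germ C N M (\<lambda>x. \<Sum>k\<in>I. P k x * Q k x)"
    by (rule germ_finsum) (use assms in \<open>auto intro: reps_mult\<close>)
  finally show ?thesis .
qed

lemma germ_finprod:
  assumes "\<And>i. i \<in> I \<Longrightarrow> F i \<in> reps N M"
  shows "(\<Otimes>\<^bsub>rat_field C N M\<^esub>i\<in>I. germ C N M (F i)) = germ C N M (\<lambda>x. \<Prod>i\<in>I. F i x)"
proof -
  interpret cring "rat_field C N M" by (rule cring_rat_field)
  show ?thesis using assms
  proof (induction I rule: infinite_finite_induct)
    case (insert i I)
    then have "(\<Otimes>\<^bsub>rat_field C N M\<^esub>j\<in>insert i I. germ C N M (F j)) =
        germ C N M (F i) \<otimes>\<^bsub>rat_field C N M\<^esub> germ C N M (\<lambda>x. \<Prod>i\<in>I. F i x)"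
      by (subst finprod_insert) (auto intro: germ_closed)
    also have "\<dots> = germ C N M (\<lambda>x. \<Prod>i\<in>insert i I. F i x)"
      using insert by (subst germ_mult) (auto intro: reps_prod)
    finally show ?case .
  qed (auto simp: one_rat_field finprod_infinite)
qed

lemma germ_pow:
  assumes "F \<in> reps N M"
  shows "germ C N M F [^]\<^bsub>rat_field C N M\<^esub> (n::nat) = germ C N M (\<lambda>x. F x ^ n)"
proof -
  interpret cring "rat_field C N M" by (rule cring_rat_field)
  show ?thesis
    by (induction n) (simp_all add: one_rat_field germ_mult assms reps_power mult.commute)
qed

end

section \<open>Pullbacks and slices\<close>

text \<open>A map of points induced by a polynomial map \<open>H\<close> of homogeneous coordinates; \<open>T\<close> tells how
  multidegrees are transformed.\<close>

locale polynomial_map = irreducible_curve C for C :: "'n::finite proj set" +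
  fixes N M N' M' :: nat and h :: "'n pt \<Rightarrow> 'n pt"
    and H :: "(nat \<Rightarrow> complex ^ 'n) \<times> (nat \<Rightarrow> complex) \<Rightarrow> (nat \<Rightarrow> complex ^ 'n) \<times> (nat \<Rightarrow> complex)"
    and T :: "(nat \<Rightarrow> nat) \<Rightarrow> nat \<Rightarrow> nat"
  assumes map_points: "x \<in> points C N M \<Longrightarrow> h x \<in> points C N' M'"
    and map_coords: "x \<in> points C N M \<Longrightarrow> u \<in> coords N x \<Longrightarrow> H u \<in> coords N' (h x)"
    and map_multiforms: "P \<in> multiforms N' M' e \<Longrightarrow> (\<lambda>u. P (H u)) \<in> multiforms N M (T e)"
begin

lemma map_nonvanishing:
  assumes "x \<in> points C N M" "Q \<in> multiforms N' M' e"
  shows "x \<in> nonvanishing C N M (\<lambda>u. Q (H u)) \<longleftrightarrow> h x \<in> nonvanishing C N' M' Q"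
  using nonvanishing_iff[OF map_multiforms[OF assms(2)], where x = x and C = C] assms(1)
    nonvanishing_coords_iff[OF assms(2) map_points map_coords, OF assms(1) assms(1) std_coords_in_coords]
  by blast

lemma map_regular_at:
  assumes "x \<in> points C N M" "regular_at C N' M' (h x) F"
  shows "regular_at C N M x (\<lambda>x. F (h x))"
proof -
  obtain e P Q where 1: "P \<in> multiforms N' M' e" "Q \<in> multiforms N' M' e" "h x \<in> nonvanishing C N' M' Q"
    "\<And>y. y \<in> nonvanishing C N' M' Q \<Longrightarrow> F y = P (std_coords y) / Q (std_coords y)"
    using regular_atE[OF assms(2)] by metis
  show ?thesis
  proof (rule regular_atI[OF map_multiforms[OF 1(1)] map_multiforms[OF 1(2)]])
    show "x \<in> nonvanishing C N M (\<lambda>u. Q (H u))" using map_nonvanishing[OF assms(1) 1(2)] 1(3) by blast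
    fix y assume y: "y \<in> nonvanishing C N M (\<lambda>u. Q (H u))"
    then have yp: "y \<in> points C N M" by (simp add: nonvanishing_def)
    then have "h y \<in> nonvanishing C N' M' Q" using map_nonvanishing[OF _ 1(2)] y by blast
    then have "F (h y) = P (std_coords (h y)) / Q (std_coords (h y))" by (rule 1(4))
    also have "\<dots> = P (H (std_coords y)) / Q (H (std_coords y))"
      by (rule multiforms_ratio_coords[OF map_coords[OF yp std_coords_in_coords] std_coords_in_coords 1(1,2)])
    finally show "F (h y) = P (H (std_coords y)) / Q (H (std_coords y))" .
  qed
qed

text \<open>The preimage of a nonempty open set may be empty, hence the demand for a point
  \<open>x\<close> that maps into it. Surjective maps always supply one; for a slice it is the
  parameter of the point through which the slice is drawn.\<close>

lemma map_eventually:
  assumes "Q \<in> multiforms N' M' e" "\<forall>x\<in>nonvanishing C N' M' Q. p x"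
    "x \<in> points C N M" "h x \<in> nonvanishing C N' M' Q"
  shows "\<forall>\<^sub>F x in generic C N M. p (h x)"
proof (rule eventually_genericI[OF map_multiforms[OF assms(1)]])
  show "x \<in> nonvanishing C N M (\<lambda>u. Q (H u))" using map_nonvanishing[OF assms(3,1)] assms(4) by blast
  show "p (h y)" if "y \<in> nonvanishing C N M (\<lambda>u. Q (H u))" for y
  proof -
    have "y \<in> points C N M" using that by (simp add: nonvanishing_def)
    then show ?thesis using map_nonvanishing[OF _ assms(1)] that assms(2) by blast
  qed
qed

lemma surj_eventually:
  assumes "points C N' M' \<subseteq> h ` points C N M" "\<forall>\<^sub>F x in generic C N' M'. p x"
  shows "\<forall>\<^sub>F x in generic C N M. p (h x)"
proof -
  obtain e Q y where Q: "Q \<in> multiforms N' M' e" "y \<in> nonvanishing C N' M' Q"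
    "\<forall>x\<in>nonvanishing C N' M' Q. p x"
    using assms(2) unfolding eventually_generic by blast
  then obtain x where "x \<in> points C N M" "y = h x" using assms(1) by (auto simp: nonvanishing_def)
  then show ?thesis using map_eventually[OF Q(1,3)] Q(2) by blast
qed

lemma surj_reps:
  assumes "points C N' M' \<subseteq> h ` points C N M" "F \<in> reps N' M'"
  shows "(\<lambda>x. F (h x)) \<in> reps N M"
proof -
  have "\<forall>\<^sub>F x in generic C N M. regular_at C N' M' (h x) F"
    using surj_eventually[OF assms(1)] assms(2) unfolding reps_iff by blast
  from eventually_conj[OF this eventually_generic_points] show ?thesis
    unfolding reps_iff by (rule eventually_mono) (auto intro: map_regular_at)
qed

lemma pullback_germ:
  assumes "points C N' M' \<subseteq> h ` points C N M" "F \<in> reps N' M'"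
  shows "pullback C N M h (germ C N' M' F) = germ C N M (\<lambda>x. F (h x))"
proof -
  have "germ C N M (G \<circ> h) = germ C N M (\<lambda>x. F (h x))" if "G \<in> germ C N' M' F" for G
  proof -
    have "\<forall>\<^sub>F x in generic C N' M'. F x = G x" using that mem_germ_iff[OF assms(2)] by blast
    from surj_eventually[OF assms(1) this] show ?thesis
      using germ_cong[OF surj_reps[OF assms]] by (simp add: comp_def)
  qed
  moreover have "F \<in> germ C N' M' F" using mem_germ_iff[OF assms(2)] assms(2) by simp
  ultimately show ?thesis unfolding pullback_def by blast
qed

end

section \<open>Projections to a factor, projections along the fibres, and slices\<close>

definition factor_point :: "nat \<Rightarrow> 'n::finite pt \<Rightarrow> 'n pt" where
  "factor_point k = (\<lambda>(z, \<xi>). (\<lambda>i\<in>{..<1}. z k, \<lambda>j\<in>{..<0}. \<xi> j))"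

definition drop_fibre :: "'n::finite pt \<Rightarrow> 'n pt" where
  "drop_fibre = (\<lambda>(z, \<xi>). (z, \<lambda>j\<in>{..<0}. \<xi> j))"

text \<open>Parametrizes the slice through \<open>z\<close> in the \<open>k\<close>-th direction;
  the parameter \<open>factor_point k z\<close> gives back \<open>z\<close>.\<close>

definition put_point :: "nat \<Rightarrow> 'n::finite pt \<Rightarrow> 'n pt \<Rightarrow> 'n pt" where
  "put_point k z s = ((fst z)(k := fst s 0), snd z)"

definition const_point :: "'n::finite proj \<Rightarrow> 'n pt" where
  "const_point p = (\<lambda>i\<in>{..<1}. p, \<lambda>j\<in>{..<0}. 0)"

lemma points_iff:
  "x \<in> points C N M \<longleftrightarrow> (\<forall>k<N. fst x k \<in> C) \<and> (\<forall>k\<ge>N. fst x k = undefined)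
     \<and> (\<forall>j\<ge>M. snd x j = undefined)"
  by (simp add: points_def mem_Times_iff PiE_iff extensional_def not_less Ball_def)

lemma restrict_empty [simp]: "restrict f {} = (\<lambda>_. undefined)"
  by (simp add: restrict_def)

lemma points_curve: "points C 1 0 = const_point ` C"
proof
  show "points C 1 0 \<subseteq> const_point ` C"
  proof
    fix x assume x: "x \<in> points C 1 0"
    then have "x = const_point (fst x 0)"
      by (auto simp: points_iff const_point_def prod_eq_iff fun_eq_iff restrict_def)
    moreover have "fst x 0 \<in> C" using x by (simp add: points_iff)
    ultimately show "x \<in> const_point ` C" by blast
  qed
qed (auto simp: points_iff const_point_def)

lemma factor_point_const: "factor_point k x = const_point (fst x k)"
  by (simp add: factor_point_def const_point_def case_prod_beta)

lemma fst_const_point [simp]: "fst (const_point p) 0 = p"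
  by (simp add: const_point_def)

context irreducible_curve
begin

lemma polynomial_map_factor_point:
  assumes "k < N"
  shows "polynomial_map C N 0 1 0 (factor_point k) (\<lambda>(v, \<xi>). (\<lambda>_. v k, \<lambda>_. undefined))
    (\<lambda>e l. if l = k then e 0 else 0)"
proof (unfold_locales, goal_cases)
  case (1 x)
  then have "fst x k \<in> C" using assms by (simp add: points_iff)
  then show ?case by (simp add: factor_point_const points_curve)
next
  case (2 x u)
  then show ?case using assms by (auto simp: factor_point_const const_point_def coords_def)
next
  case (3 P e)
  let ?H = "\<lambda>(v :: nat \<Rightarrow> complex ^ 'n, \<xi> :: nat \<Rightarrow> complex). (\<lambda>_ :: nat. v k, \<lambda>_ :: nat. undefined :: complex)"
  have "(\<lambda>u. P (?H u)) \<in> poly_funs (multicoords N 0)"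
    by (rule poly_funs_subst[OF multiforms_poly[OF 3]])
      (use assms in \<open>force intro!: poly_funs.coord simp: case_prod_beta\<close>)
  moreover have "P (?H (v(l := c *s v l), \<xi>)) = c ^ (if l = k then e 0 else 0) * P (?H (v, \<xi>))"
    if "l < N" for l c v \<xi>
  proof (cases "l = k")
    case True
    have "P (?H (v(l := c *s v l), \<xi>)) = P ((\<lambda>_. v k)(0 := c *s v k), \<lambda>_. undefined)"
      using True by (auto intro!: multiforms_cong[OF 3])
    then show ?thesis using True multiforms_hom[OF 3, of 0 "\<lambda>_. v k" c] by simp
  qed simp
  ultimately show ?case unfolding multiforms_def by blast
qed

lemma factor_point_surj: "k < N \<Longrightarrow> points C 1 0 \<subseteq> factor_point k ` points C N 0"
proof
  fix x assume k: "k < N" and "x \<in> points C 1 0"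
  then obtain p where p: "x = const_point p" "p \<in> C" unfolding points_curve by blast
  then have "x = factor_point k (\<lambda>i\<in>{..<N}. p, \<lambda>j\<in>{..<0}. 0)"
    using k by (simp add: factor_point_const)
  moreover have "(\<lambda>i\<in>{..<N}. p, \<lambda>j\<in>{..<0}. 0) \<in> points C N 0" using p by (auto simp: points_iff)
  ultimately show "x \<in> factor_point k ` points C N 0" by blast
qed

lemma at_var_germ:
  assumes "k < N" "F \<in> reps 1 0"
  shows "at_var C N k (germ C 1 0 F) = germ C N 0 (\<lambda>z. F (factor_point k z))"
  unfolding at_var_def
  using polynomial_map.pullback_germ[OF polynomial_map_factor_point factor_point_surj, OF assms(1) assms(1,2)]
  by (simp add: factor_point_def)

lemma factor_point_reps: "k < N \<Longrightarrow> F \<in> reps 1 0 \<Longrightarrow> (\<lambda>z. F (factor_point k z)) \<in> reps N 0"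
  using polynomial_map.surj_reps[OF polynomial_map_factor_point factor_point_surj] .

lemma factor_point_eventually:
  "k < N \<Longrightarrow> eventually p (generic C 1 0) \<Longrightarrow> \<forall>\<^sub>F z in generic C N 0. p (factor_point k z)"
  using polynomial_map.surj_eventually[OF polynomial_map_factor_point factor_point_surj] .

lemma factor_point_regular_at:
  "k < N \<Longrightarrow> z \<in> points C N 0 \<Longrightarrow> regular_at C 1 0 (factor_point k z) F
    \<Longrightarrow> regular_at C N 0 z (\<lambda>z. F (factor_point k z))"
  using polynomial_map.map_regular_at[OF polynomial_map_factor_point] .

lemma at_var_closed:
  assumes "k < N" "f \<in> carrier (\<F> 1)"
  shows "at_var C N k f \<in> carrier (\<F> N)"
proof -
  obtain F where "F \<in> reps 1 0" "f = germ C 1 0 F" using assms(2) by (auto simp: carrier_rat_field)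
  then show ?thesis using assms(1) by (simp add: at_var_germ germ_closed factor_point_reps)
qed

lemma polynomial_map_drop_fibre:
  "polynomial_map C N M N 0 drop_fibre (\<lambda>(v, \<xi>). (v, \<lambda>_. undefined)) (\<lambda>e. e)"
proof (unfold_locales, goal_cases)
  case (1 x)
  then show ?case by (auto simp: drop_fibre_def points_def)
next
  case (2 x u)
  then show ?case by (cases x) (auto simp: drop_fibre_def coords_def)
next
  case (3 P e)
  have "(\<lambda>u. P (case u of (v, \<xi>) \<Rightarrow> (v, \<lambda>_. undefined))) \<in> poly_funs (multicoords N M)"
    by (rule poly_funs_subst[OF multiforms_poly[OF 3]])
      (force intro!: poly_funs.coord simp: case_prod_beta)
  then show ?case using multiforms_hom[OF 3] by (auto simp: multiforms_def)
qed

lemma drop_fibre_surj: "points C N 0 \<subseteq> drop_fibre ` points C N M"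
proof
  fix x assume x: "x \<in> points C N 0"
  then have "x = drop_fibre (fst x, \<lambda>j\<in>{..<M}. 0)"
    by (cases x) (auto simp: points_def drop_fibre_def fun_eq_iff)
  moreover have "fst x \<in> {..<N} \<rightarrow>\<^sub>E C" using x by (simp add: points_def mem_Times_iff)
  then have "(fst x, \<lambda>j\<in>{..<M}. 0) \<in> points C N M" by (simp add: points_def)
  ultimately show "x \<in> drop_fibre ` points C N M" by blast
qed

lemma cone_incl_germ:
  assumes "F \<in> reps N 0"
  shows "cone_incl C N (germ C N 0 F) = germ C N N (\<lambda>x. F (drop_fibre x))"
  unfolding cone_incl_def
  using polynomial_map.pullback_germ[OF polynomial_map_drop_fibre drop_fibre_surj assms]
  by (simp add: drop_fibre_def)

lemma drop_fibre_reps: "F \<in> reps N 0 \<Longrightarrow> (\<lambda>x. F (drop_fibre x)) \<in> reps N M"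
  using polynomial_map.surj_reps[OF polynomial_map_drop_fibre drop_fibre_surj] .

lemma drop_fibre_eventually:
  "eventually p (generic C N 0) \<Longrightarrow> \<forall>\<^sub>F x in generic C N M. p (drop_fibre x)"
  using polynomial_map.surj_eventually[OF polynomial_map_drop_fibre drop_fibre_surj] .

text \<open>All points except the \<open>k\<close>-th are frozen at the chosen lifts of
  \<open>z\<close>, so only the degree in the \<open>k\<close>-th group survives.\<close>

lemma polynomial_map_put_point:
  assumes "k < N" "z \<in> points C N M"
  shows "polynomial_map C 1 0 N M (put_point k z)
    (\<lambda>(w, \<eta>). ((fst (std_coords z))(k := w 0), snd z)) (\<lambda>e _. e k)"
proof (unfold_locales, goal_cases)
  case (1 x)
  then show ?case using assms by (auto simp: put_point_def points_def PiE_def extensional_def)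
next
  case (2 x u)
  then show ?case using std_coords_hcoords[of z] by (auto simp: put_point_def coords_def)
next
  case (3 P e)
  let ?H = "\<lambda>(w :: nat \<Rightarrow> complex ^ 'n, \<eta> :: nat \<Rightarrow> complex). ((fst (std_coords z))(k := w 0), snd z)"
  have "(\<lambda>u. P (?H u)) \<in> poly_funs (multicoords 1 0)"
  proof (rule poly_funs_subst[OF multiforms_poly[OF 3]])
    fix x :: "(nat \<Rightarrow> complex ^ 'n) \<times> (nat \<Rightarrow> complex) \<Rightarrow> complex"
    assume "x \<in> multicoords N M"
    then consider j i where "x = (\<lambda>(v, \<xi>). v j $ i)" | i where "x = (\<lambda>(v, \<xi>). \<xi> i)" by blast
    then show "(\<lambda>u. x (?H u)) \<in> poly_funs (multicoords 1 0)"
    proof cases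
      case (1 j i)
      show ?thesis
      proof (cases "j = k")
        case True
        then show ?thesis using 1 by (force simp: case_prod_beta intro!: poly_funs.coord)
      qed (simp add: 1 case_prod_beta poly_funs.const)
    qed (simp add: poly_funs.const case_prod_beta)
  qed
  then show ?case
    using multiforms_hom[OF 3 assms(1), of "(fst (std_coords z))(k := _)" _ "snd z"]
    by (auto simp: multiforms_def)
qed

lemma put_point_factor_point:
  assumes "z \<in> points C N M"
  shows "put_point k z (factor_point k z) = z"
  by (simp add: put_point_def factor_point_const)

lemma factor_point_points: "k < N \<Longrightarrow> z \<in> points C N M \<Longrightarrow> factor_point k z \<in> points C 1 0"
  unfolding factor_point_const points_curve by (rule imageI) (auto simp: points_iff)

text \<open>If \<open>z\<close> lies in the open set, its slice meets that set, namely at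
  \<open>z\<close>, and therefore in a nonempty open set.\<close>

lemma slice_eventually:
  assumes "k < N" "eventually p (generic C N M)"
  shows "\<forall>\<^sub>F z in generic C N M. \<forall>\<^sub>F s in generic C 1 0. p (put_point k z s)"
proof -
  obtain e Q where Q: "Q \<in> multiforms N M e" "nonvanishing C N M Q \<noteq> {}" "\<forall>x\<in>nonvanishing C N M Q. p x"
    using assms(2) unfolding eventually_generic by blast
  have "\<forall>\<^sub>F s in generic C 1 0. p (put_point k z s)" if z: "z \<in> nonvanishing C N M Q" for z
  proof -
    have zp: "z \<in> points C N M" using z by (simp add: nonvanishing_def)
    show ?thesis
      by (rule polynomial_map.map_eventually[OF polynomial_map_put_point[OF assms(1) zp] Q(1,3)
            factor_point_points[OF assms(1) zp]]) (simp add: put_point_factor_point[OF zp] z)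
  qed
  then show ?thesis unfolding eventually_generic using Q(1,2) by blast
qed

lemma slice_regular_at:
  assumes "k < N" "regular_at C N M z F"
  shows "regular_at C 1 0 (factor_point k z) (\<lambda>s. F (put_point k z s))"
proof -
  have zp: "z \<in> points C N M" by (rule regular_at_points[OF assms(2)])
  show ?thesis
    by (rule polynomial_map.map_regular_at[OF polynomial_map_put_point[OF assms(1) zp]
          factor_point_points[OF assms(1) zp]]) (simp add: put_point_factor_point[OF zp] assms(2))
qed

lemma slice_reps:
  assumes "k < N" "F \<in> reps N M"
  shows "\<forall>\<^sub>F z in generic C N M. (\<lambda>s. F (put_point k z s)) \<in> reps 1 0"
  using assms(2) unfolding reps_iff[of F]
  by (rule eventually_mono) (rule regular_at_reps[OF slice_regular_at[OF assms(1)]])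

text \<open>Converse to slicing: along the slice \<open>G\<close> is regular at the parameter of
  \<open>z\<close>, so generic vanishing on the slice forces \<open>G z = 0\<close>.\<close>

lemma slice_zero:
  assumes "k < N" "G \<in> reps N M"
    "\<forall>\<^sub>F z in generic C N M. \<forall>\<^sub>F s in generic C 1 0. G (put_point k z s) = 0"
  shows "\<forall>\<^sub>F z in generic C N M. G z = 0"
proof -
  have "\<forall>\<^sub>F z in generic C N M. regular_at C N M z G" using assms(2) reps_iff by blast
  then show ?thesis using assms(3)
  proof (rule eventually_elim2)
    fix z assume z: "regular_at C N M z G" "\<forall>\<^sub>F s in generic C 1 0. G (put_point k z s) = 0"
    from regular_at_zero[OF slice_regular_at[OF assms(1) z(1)] z(2)]
    show "G z = 0" by (simp add: put_point_factor_point[OF regular_at_points[OF z(1)]])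
  qed
qed

section \<open>Generators of the function field\<close>

text \<open>Selects an affine chart of projective space that meets \<open>C\<close>.\<close>

definition base_index :: 'n where
  "base_index = (SOME i. \<exists>v\<in>cone_points. v $ i \<noteq> 0)"

lemma base_index: "\<exists>v\<in>cone_points. v $ base_index \<noteq> 0"
proof -
  obtain p where p: "p \<in> C" using irreducible unfolding irreducible_in_def by blast
  obtain v where v: "v \<in> hcoords p" using hcoords_nonempty by blast
  then obtain i where "v $ i \<noteq> 0" using hcoords_nonzero[OF v] by (auto simp: Finite_Cartesian_Product.vec_eq_iff)
  then have "\<exists>i. \<exists>v\<in>cone_points. v $ i \<noteq> 0" using p v unfolding cone_points_def by blast
  then show ?thesis unfolding base_index_def by (rule someI_ex)
qed

text \<open>Its entries are the affine coordinates \<open>v_i / v_b\<close> of the chart. Off the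
  chart the vector is \<open>0\<close>, since \<open>inverse 0 = 0\<close>.\<close>

definition affine_vec :: "'n pt \<Rightarrow> complex ^ 'n" where
  "affine_vec s = inverse (fst (std_coords s) 0 $ base_index) *s fst (std_coords s) 0"

definition affine_point :: "'n pt \<Rightarrow> bool" where
  "affine_point s \<longleftrightarrow> fst (std_coords s) 0 $ base_index \<noteq> 0"

lemma affine_vec_base: "affine_point s \<Longrightarrow> affine_vec s $ base_index = 1"
  by (simp add: affine_vec_def affine_point_def)

lemma affine_vec_hcoords: "affine_point s \<Longrightarrow> affine_vec s \<in> hcoords (fst s 0)"
  unfolding affine_vec_def affine_point_def
  using hcoords_eq[OF std_coords_hcoords[of s 0]] by auto

lemma multiforms_coord: "(\<lambda>(v, \<xi>). v 0 $ i) \<in> multiforms 1 0 (\<lambda>_. 1)"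
  unfolding multiforms_def by (auto intro!: poly_funs.coord)

lemma affine_point_eventually: "\<forall>\<^sub>F s in generic C 1 0. affine_point s \<and> s \<in> points C 1 0"
proof -
  obtain v where "v \<in> cone_points" "v $ base_index \<noteq> 0" using base_index by blast
  then obtain p where p: "p \<in> C" "v \<in> hcoords p" "v $ base_index \<noteq> 0" unfolding cone_points_def by blast
  have pt: "const_point p \<in> points C 1 0" using p(1) by (simp add: points_curve)
  have "(\<lambda>_. v, snd (const_point p)) \<in> coords 1 (const_point p)" using p(2) by (simp add: coords_def)
  then have "const_point p \<in> nonvanishing C 1 0 (\<lambda>(v, \<xi>). v 0 $ base_index)"
    using nonvanishing_coords_iff[OF multiforms_coord pt] p(3) by fastforce
  then show ?thesis
    by (rule eventually_genericI[OF multiforms_coord])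
      (simp add: nonvanishing_iff[OF multiforms_coord] affine_point_def case_prod_beta)
qed

lemma affine_vec_regular_at:
  assumes "s \<in> points C 1 0" "affine_point s"
  shows "regular_at C 1 0 s (\<lambda>s. affine_vec s $ i)"
  by (rule regular_atI[OF multiforms_coord multiforms_coord[of base_index]])
    (use assms in \<open>auto simp: nonvanishing_iff[OF multiforms_coord] affine_point_def affine_vec_def
       case_prod_beta field_simps\<close>)

lemma affine_vec_reps: "(\<lambda>s. affine_vec s $ i) \<in> reps 1 0"
  using affine_point_eventually unfolding reps_iff
  by (rule eventually_mono) (blast intro: affine_vec_regular_at)

text \<open>The affine coordinates of the factors generate the function field: numerator and
  denominator have the same multidegree, so the quotient may be computed from normalized vectors.
  This holds only where all points lie in the chart, hence the \<open>cong\<close> case.\<close>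

lemma reps_induct [consumes 1, case_names cong const add mult inverse coord]:
  assumes "F \<in> reps N 0"
    and cong: "\<And>F G. F \<in> reps N 0 \<Longrightarrow> A F \<Longrightarrow> \<forall>\<^sub>F z in generic C N 0. F z = G z \<Longrightarrow> A G"
    and const: "\<And>c. A (\<lambda>_. c)"
    and add: "\<And>F G. F \<in> reps N 0 \<Longrightarrow> G \<in> reps N 0 \<Longrightarrow> A F \<Longrightarrow> A G \<Longrightarrow> A (\<lambda>z. F z + G z)"
    and mult: "\<And>F G. F \<in> reps N 0 \<Longrightarrow> G \<in> reps N 0 \<Longrightarrow> A F \<Longrightarrow> A G \<Longrightarrow> A (\<lambda>z. F z * G z)"
    and inverse: "\<And>F. F \<in> reps N 0 \<Longrightarrow> A F \<Longrightarrow> A (\<lambda>z. inverse (F z))"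
    and coord: "\<And>k i. k < N \<Longrightarrow> A (\<lambda>z. affine_vec (factor_point k z) $ i)"
  shows "A F"
proof -
  let ?Y = "\<lambda>z. (\<lambda>k. affine_vec (factor_point k z), snd z)"
  have poly: "(\<lambda>z. R (?Y z)) \<in> reps N 0 \<and> A (\<lambda>z. R (?Y z))" if "R \<in> poly_funs (multicoords N 0)" for R
    using that
  proof induction
    case (coord x)
    then show ?case by (auto intro: assms(7) factor_point_reps affine_vec_reps)
  qed (auto intro: const add mult reps_const reps_add reps_mult)
  obtain x e P Q where 1: "P \<in> multiforms N 0 e" "Q \<in> multiforms N 0 e" "x \<in> nonvanishing C N 0 Q"
    "\<And>y. y \<in> nonvanishing C N 0 Q \<Longrightarrow> F y = P (std_coords y) / Q (std_coords y)"
    using assms(1) unfolding carrier_rep_ring by (auto elim!: regular_atE)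
  have P: "(\<lambda>z. P (?Y z)) \<in> reps N 0" "A (\<lambda>z. P (?Y z))"
    and Q: "(\<lambda>z. Q (?Y z)) \<in> reps N 0" "A (\<lambda>z. Q (?Y z))"
    using poly[OF multiforms_poly] 1(1,2) by blast+
  have "\<forall>\<^sub>F z in generic C N 0. \<forall>k\<in>{..<N}. affine_point (factor_point k z)"
    using factor_point_eventually[OF _ eventually_mono[OF affine_point_eventually]]
    by (intro eventually_ball_finite) blast+
  moreover have "\<forall>\<^sub>F z in generic C N 0. z \<in> nonvanishing C N 0 Q"
    by (rule eventually_genericI[OF 1(2,3)])
  ultimately have "\<forall>\<^sub>F z in generic C N 0. P (?Y z) * inverse (Q (?Y z)) = F z"
  proof (rule eventually_elim2)
    fix z assume z: "\<forall>k\<in>{..<N}. affine_point (factor_point k z)" "z \<in> nonvanishing C N 0 Q"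
    have "?Y z \<in> coords N z"
      using affine_vec_hcoords[of "factor_point _ z"] z(1) by (simp add: coords_def factor_point_const)
    from multiforms_ratio_coords[OF std_coords_in_coords this 1(1,2)]
    show "P (?Y z) * inverse (Q (?Y z)) = F z" using 1(4)[OF z(2)] by (simp add: divide_inverse)
  qed
  then show ?thesis
    by (rule cong[rotated 2]) (intro reps_mult reps_inverse mult inverse P Q)+
qed

section \<open>Derivations\<close>

lemma derivation_closed:
  "D \<in> derivations C N \<Longrightarrow> f \<in> carrier (\<F> N) \<Longrightarrow> D f \<in> carrier (\<F> N)"
  unfolding derivations_def by (auto dest: PiE_mem)

lemma derivation_const:
  "D \<in> derivations C N \<Longrightarrow> D (germ C N 0 (\<lambda>_. c)) = germ C N 0 (\<lambda>_. 0)"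
  unfolding derivations_def by (simp add: zero_rat_field)

lemma derivation_zero:
  "D \<in> derivations C N \<Longrightarrow> D \<zero>\<^bsub>\<F> N\<^esub> = \<zero>\<^bsub>\<F> N\<^esub>"
  unfolding zero_rat_field by (rule derivation_const)

lemma derivation_add:
  "D \<in> derivations C N \<Longrightarrow> f \<in> carrier (\<F> N) \<Longrightarrow> g \<in> carrier (\<F> N) \<Longrightarrow>
    D (f \<oplus>\<^bsub>\<F> N\<^esub> g) = D f \<oplus>\<^bsub>\<F> N\<^esub> D g"
  unfolding derivations_def by blast

lemma derivation_mult:
  "D \<in> derivations C N \<Longrightarrow> f \<in> carrier (\<F> N) \<Longrightarrow> g \<in> carrier (\<F> N) \<Longrightarrow>
    D (f \<otimes>\<^bsub>\<F> N\<^esub> g) =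
      (D f \<otimes>\<^bsub>\<F> N\<^esub> g) \<oplus>\<^bsub>\<F> N\<^esub> (f \<otimes>\<^bsub>\<F> N\<^esub> D g)"
  unfolding derivations_def by blast

lemma derivation_germ_ex:
  assumes "D \<in> derivations C N" "F \<in> reps N 0"
  obtains G where "G \<in> reps N 0" "D (germ C N 0 F) = germ C N 0 G"
  using derivation_closed[OF assms(1) germ_closed[OF assms(2)]] unfolding carrier_rat_field by blast

lemma derivation_germ_add:
  assumes "D \<in> derivations C N" "F \<in> reps N 0" "G \<in> reps N 0" "F' \<in> reps N 0" "G' \<in> reps N 0"
    "D (germ C N 0 F) = germ C N 0 F'" "D (germ C N 0 G) = germ C N 0 G'"
  shows "D (germ C N 0 (\<lambda>z. F z + G z)) = germ C N 0 (\<lambda>z. F' z + G' z)"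
  using derivation_add[OF assms(1) germ_closed[OF assms(2)] germ_closed[OF assms(3)]] assms
  by (simp add: germ_add)

lemma derivation_germ_mult:
  assumes "D \<in> derivations C N" "F \<in> reps N 0" "G \<in> reps N 0" "F' \<in> reps N 0" "G' \<in> reps N 0"
    "D (germ C N 0 F) = germ C N 0 F'" "D (germ C N 0 G) = germ C N 0 G'"
  shows "D (germ C N 0 (\<lambda>z. F z * G z)) = germ C N 0 (\<lambda>z. F' z * G z + F z * G' z)"
  using derivation_mult[OF assms(1) germ_closed[OF assms(2)] germ_closed[OF assms(3)]] assms
  by (simp add: germ_mult germ_add reps_mult)

text \<open>With \<open>inverse 0 = 0\<close> the formula also holds for the zero germ.\<close>

lemma derivation_germ_inverse:
  assumes D: "D \<in> derivations C N" and F: "F \<in> reps N 0" "F' \<in> reps N 0"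
    and DF: "D (germ C N 0 F) = germ C N 0 F'"
  shows "D (germ C N 0 (\<lambda>z. inverse (F z))) = germ C N 0 (\<lambda>z. - F' z * inverse (F z) ^ 2)"
  using reps_zero_or_nonzero[OF F(1)]
proof
  assume z: "\<forall>\<^sub>F z in generic C N 0. F z = 0"
  then have "\<forall>\<^sub>F z in generic C N 0. inverse (F z) = 0" by (rule eventually_mono) simp
  then have "germ C N 0 (\<lambda>z. inverse (F z)) = germ C N 0 (\<lambda>_. 0)"
    by (rule germ_cong[OF reps_inverse[OF F(1)]])
  moreover have "\<forall>\<^sub>F z in generic C N 0. - F' z * inverse (F z) ^ 2 = 0"
    using z by (rule eventually_mono) simp
  then have "germ C N 0 (\<lambda>z. - F' z * inverse (F z) ^ 2) = germ C N 0 (\<lambda>_. 0)"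
    by (rule germ_cong[OF reps_mult[OF reps_uminus[OF F(2)] reps_power[OF reps_inverse[OF F(1)]]]])
  ultimately show ?thesis using derivation_const[OF D] by simp
next
  assume nz: "\<forall>\<^sub>F z in generic C N 0. F z \<noteq> 0"
  obtain G where G: "G \<in> reps N 0" "D (germ C N 0 (\<lambda>z. inverse (F z))) = germ C N 0 G"
    using derivation_germ_ex[OF D reps_inverse[OF F(1)]] .
  have "\<forall>\<^sub>F z in generic C N 0. F z * inverse (F z) = 1"
    using nz by (rule eventually_mono) simp
  \<comment> \<open>Differentiating \<open>F * inverse F = 1\<close> determines the derivative
    \<open>G\<close> of the inverse.\<close>
  then have "germ C N 0 (\<lambda>z. F z * inverse (F z)) = germ C N 0 (\<lambda>_. 1)"
    by (rule germ_cong[OF reps_mult[OF F(1) reps_inverse[OF F(1)]]])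
  then have "germ C N 0 (\<lambda>z. F' z * inverse (F z) + F z * G z) = germ C N 0 (\<lambda>_. 0)"
    using derivation_germ_mult[OF D F(1) reps_inverse[OF F(1)] F(2) G(1) DF G(2)] derivation_const[OF D]
    by simp
  then have "\<forall>\<^sub>F z in generic C N 0. F' z * inverse (F z) + F z * G z = 0"
    by (subst (asm) germ_eq_iff) (intro reps_add reps_mult reps_inverse reps_const F G)+
  then have "\<forall>\<^sub>F z in generic C N 0. G z = - F' z * inverse (F z) ^ 2"
    using nz
  proof (rule eventually_elim2)
    fix z assume a: "F' z * inverse (F z) + F z * G z = 0" and "F z \<noteq> 0"
    then have "G z = inverse (F z) * (F z * G z)" by simp
    also have "F z * G z = - (F' z * inverse (F z))" using a by (simp add: add_eq_0_iff)
    finally show "G z = - F' z * inverse (F z) ^ 2" by (simp add: power2_eq_square)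
  qed
  from germ_cong[OF G(1) this] show ?thesis using G(2) by simp
qed

text \<open>The germs on which \<open>D\<close> and \<open>E\<close> agree are closed under the
  field operations, and the affine coordinates generate.\<close>

lemma derivation_eq_on_generators:
  assumes D: "D \<in> derivations C N" and E: "E \<in> derivations C N"
    and coord: "\<And>k i. k < N \<Longrightarrow> D (germ C N 0 (\<lambda>z. affine_vec (factor_point k z) $ i)) =
      E (germ C N 0 (\<lambda>z. affine_vec (factor_point k z) $ i))"
  shows "D = E"
proof
  have *: "D (germ C N 0 F) = E (germ C N 0 F)" if "F \<in> reps N 0" for F
    using that
  proof (induction rule: reps_induct)
    case (cong F G)
    show ?case using germ_cong[OF cong(1,2)] cong(3) by simp
  next
    case (const c)
    show ?case using derivation_const[OF D] derivation_const[OF E] by simp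
  next
    case (add F G)
    obtain F' G' where "F' \<in> reps N 0" "D (germ C N 0 F) = germ C N 0 F'"
      "G' \<in> reps N 0" "D (germ C N 0 G) = germ C N 0 G'"
      using derivation_germ_ex[OF D] add(1,2) by metis
    then show ?case
      using derivation_germ_add[OF D add(1,2), of F' G'] derivation_germ_add[OF E add(1,2), of F' G'] add(3,4)
      by simp
  next
    case (mult F G)
    obtain F' G' where "F' \<in> reps N 0" "D (germ C N 0 F) = germ C N 0 F'"
      "G' \<in> reps N 0" "D (germ C N 0 G) = germ C N 0 G'"
      using derivation_germ_ex[OF D] mult(1,2) by metis
    then show ?case
      using derivation_germ_mult[OF D mult(1,2), of F' G'] derivation_germ_mult[OF E mult(1,2), of F' G'] mult(3,4)
      by simp
  next
    case (inverse F)
    obtain F' where "F' \<in> reps N 0" "D (germ C N 0 F) = germ C N 0 F'"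
      using derivation_germ_ex[OF D inverse(1)] .
    then show ?case
      using derivation_germ_inverse[OF D inverse(1), of F'] derivation_germ_inverse[OF E inverse(1), of F']
        inverse(2) by simp
  qed (rule coord)
  fix f
  show "D f = E f"
  proof (cases "f \<in> carrier (\<F> N)")
    case True
    then show ?thesis using * unfolding carrier_rat_field by blast
  next
    case False
    \<comment> \<open>Outside the carrier both maps are \<open>undefined\<close> by
      extensionality.\<close>
    then show ?thesis using D E unfolding derivations_def by (auto simp: PiE_def extensional_def)
  qed
qed

lemma zero_op_derivation: "zero_op C N \<in> derivations C N"
proof -
  interpret cring "\<F> N" by (rule cring_rat_field)
  show ?thesis by (auto simp: derivations_def zero_op_def germ_closed reps_const)
qed

section \<open>Lifting a vector field to one variable\<close>

text \<open>The lift is computed on the slices in the \<open>k\<close>-th variable.  It is defined everywhere because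
  the functions which have a derivative form a field containing the generators.\<close>

definition slice_derivative ::
  "('n ratfun \<Rightarrow> 'n ratfun) \<Rightarrow> nat \<Rightarrow> nat \<Rightarrow> ('n pt \<Rightarrow> complex) \<Rightarrow> ('n pt \<Rightarrow> complex) \<Rightarrow> bool" where
  "slice_derivative X N k F G \<longleftrightarrow> (\<forall>\<^sub>F z in generic C N 0.
     X (germ C 1 0 (\<lambda>s. F (put_point k z s))) = germ C 1 0 (\<lambda>s. G (put_point k z s)))"

text \<open>The two derivatives agree on generic slices, hence generically by
  \<open>slice_zero\<close>. So the germ of \<open>G\<close> depends only on the germ of
  \<open>F\<close>, which makes \<open>lift_vf\<close> well defined.\<close>

lemma slice_derivative_unique:
  assumes k: "k < N" and F: "F \<in> reps N 0" "F' \<in> reps N 0" and G: "G \<in> reps N 0" "G' \<in> reps N 0"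
    and FG: "slice_derivative X N k F G" "slice_derivative X N k F' G'"
    and eq: "germ C N 0 F = germ C N 0 F'"
  shows "germ C N 0 G = germ C N 0 G'"
proof -
  have "\<forall>\<^sub>F z in generic C N 0. F z = F' z" using germ_eq_iff[OF F] eq by blast
  note sl = slice_eventually[OF k this]
  have "\<forall>\<^sub>F z in generic C N 0. \<forall>\<^sub>F s in generic C 1 0. G (put_point k z s) - G' (put_point k z s) = 0"
    using sl slice_reps[OF k F(1)] slice_reps[OF k G(1)] slice_reps[OF k G(2)]
      FG[unfolded slice_derivative_def]
  proof eventually_elim
    case (elim z)
    from germ_cong[OF elim(2,1)] elim(5,6)
    have "germ C 1 0 (\<lambda>s. G (put_point k z s)) = germ C 1 0 (\<lambda>s. G' (put_point k z s))" by simp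
    then have "\<forall>\<^sub>F s in generic C 1 0. G (put_point k z s) = G' (put_point k z s)"
      using germ_eq_iff[OF elim(3,4)] by blast
    then show ?case by (rule eventually_mono) simp
  qed
  then have "\<forall>\<^sub>F z in generic C N 0. G z - G' z = 0"
    using slice_zero[OF k, of "\<lambda>z. G z + - G' z"] reps_add[OF G(1) reps_uminus[OF G(2)]] by simp
  then have "\<forall>\<^sub>F z in generic C N 0. G z = G' z" by (rule eventually_mono) simp
  then show ?thesis by (rule germ_cong[OF G(1)])
qed

lemma slice_derivative_cong:
  assumes k: "k < N" and F: "F \<in> reps N 0" "\<forall>\<^sub>F z in generic C N 0. F z = F' z"
    and FG: "slice_derivative X N k F G"
  shows "slice_derivative X N k F' G"
  using slice_eventually[OF k F(2)] slice_reps[OF k F(1)] FG unfolding slice_derivative_def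
proof eventually_elim
  case (elim z)
  from germ_cong[OF elim(2,1)] elim(3) show ?case by simp
qed

lemma slice_derivative_add:
  assumes k: "k < N" and X: "X \<in> vector_fields C"
    and F: "F \<in> reps N 0" "F' \<in> reps N 0" and G: "G \<in> reps N 0" "G' \<in> reps N 0"
    and FG: "slice_derivative X N k F F'" "slice_derivative X N k G G'"
  shows "slice_derivative X N k (\<lambda>z. F z + G z) (\<lambda>z. F' z + G' z)"
  unfolding slice_derivative_def
  using slice_reps[OF k F(1)] slice_reps[OF k F(2)] slice_reps[OF k G(1)] slice_reps[OF k G(2)]
    FG[unfolded slice_derivative_def]
proof eventually_elim
  case (elim z)
  from derivation_germ_add[OF X[unfolded vector_fields_def] elim(1,3,2,4) elim(5,6)] show ?case .
qed

lemma slice_derivative_mult: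
  assumes k: "k < N" and X: "X \<in> vector_fields C"
    and F: "F \<in> reps N 0" "F' \<in> reps N 0" and G: "G \<in> reps N 0" "G' \<in> reps N 0"
    and FG: "slice_derivative X N k F F'" "slice_derivative X N k G G'"
  shows "slice_derivative X N k (\<lambda>z. F z * G z) (\<lambda>z. F' z * G z + F z * G' z)"
  unfolding slice_derivative_def
  using slice_reps[OF k F(1)] slice_reps[OF k F(2)] slice_reps[OF k G(1)] slice_reps[OF k G(2)]
    FG[unfolded slice_derivative_def]
proof eventually_elim
  case (elim z)
  from derivation_germ_mult[OF X[unfolded vector_fields_def] elim(1,3,2,4) elim(5,6)] show ?case .
qed

lemma slice_derivative_inverse:
  assumes k: "k < N" and X: "X \<in> vector_fields C"
    and F: "F \<in> reps N 0" "F' \<in> reps N 0" and FG: "slice_derivative X N k F F'"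
  shows "slice_derivative X N k (\<lambda>z. inverse (F z)) (\<lambda>z. - F' z * inverse (F z) ^ 2)"
  unfolding slice_derivative_def
  using slice_reps[OF k F(1)] slice_reps[OF k F(2)] FG[unfolded slice_derivative_def]
proof eventually_elim
  case (elim z)
  from derivation_germ_inverse[OF X[unfolded vector_fields_def] elim(1,2,3)] show ?case .
qed

lemma slice_derivative_const:
  "X \<in> vector_fields C \<Longrightarrow> slice_derivative X N k (\<lambda>_. c) (\<lambda>_. 0)"
  unfolding slice_derivative_def vector_fields_def by (simp add: derivation_const)

text \<open>On a slice in the \<open>k\<close>-th variable, a function of the \<open>l\<close>-th
  variable is the function itself when \<open>l = k\<close>, and constant otherwise.\<close>

lemma slice_derivative_factor_point:
  assumes k: "k < N" and X: "X \<in> vector_fields C" and F: "F \<in> reps 1 0" "G \<in> reps 1 0"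
    and FG: "X (germ C 1 0 F) = germ C 1 0 G"
  shows "slice_derivative X N k (\<lambda>z. F (factor_point l z)) (\<lambda>z. if l = k then G (factor_point k z) else 0)"
proof (cases "l = k")
  case True
  have *: "germ C 1 0 (\<lambda>s. H (factor_point k (put_point k z s))) = germ C 1 0 H" if "H \<in> reps 1 0" for H z
  proof (rule germ_cong[OF that, symmetric])
    show "\<forall>\<^sub>F s in generic C 1 0. H s = H (factor_point k (put_point k z s))"
      using eventually_generic_points
    proof eventually_elim
      case (elim s)
      then have "s = factor_point k (put_point k z s)"
        by (auto simp: factor_point_const put_point_def points_curve)
      then show ?case by simp
    qed
  qed
  show ?thesis unfolding slice_derivative_def using True *[OF F(1)] *[OF F(2)] FG by simp
next
  case False
  then have "factor_point l (put_point k z s) = factor_point l z" for z s :: "'n pt"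
    by (simp add: factor_point_const put_point_def)
  then show ?thesis
    using False X unfolding slice_derivative_def vector_fields_def by (simp add: derivation_const)
qed

lemma slice_derivative_ex:
  assumes k: "k < N" and X: "X \<in> vector_fields C" and "F \<in> reps N 0"
  shows "\<exists>G\<in>reps N 0. slice_derivative X N k F G"
  using assms(3)
proof (induction rule: reps_induct)
  case (cong F F')
  then show ?case using slice_derivative_cong[OF k cong(1,2)] cong(3) by blast
next
  case (const c)
  then show ?case using slice_derivative_const[OF X] reps_const by blast
next
  case (add F G)
  then obtain F' G' where "F' \<in> reps N 0" "slice_derivative X N k F F'"
      "G' \<in> reps N 0" "slice_derivative X N k G G'" by blast
  then show ?case
    using slice_derivative_add[OF k X add(1) _ add(2)] by (intro bexI[OF _ reps_add])
next
  case (mult F G)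
  then obtain F' G' where "F' \<in> reps N 0" "slice_derivative X N k F F'"
      "G' \<in> reps N 0" "slice_derivative X N k G G'" by blast
  then show ?case
    using slice_derivative_mult[OF k X mult(1) _ mult(2)] mult(1,2)
    by (intro bexI[OF _ reps_add[OF reps_mult reps_mult]])
next
  case (inverse F)
  then obtain F' where "F' \<in> reps N 0" "slice_derivative X N k F F'" by blast
  then show ?case
    using slice_derivative_inverse[OF k X inverse(1)] inverse(1)
    by (intro bexI[OF _ reps_mult[OF reps_uminus reps_power[OF reps_inverse]]])
next
  case (coord l i)
  obtain G where G: "G \<in> reps 1 0" "X (germ C 1 0 (\<lambda>s. affine_vec s $ i)) = germ C 1 0 G"
    using derivation_germ_ex[OF X[unfolded vector_fields_def] affine_vec_reps] .
  show ?case
  proof (rule bexI)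
    show "slice_derivative X N k (\<lambda>z. affine_vec (factor_point l z) $ i)
        (\<lambda>z. if l = k then G (factor_point k z) else 0)"
      by (rule slice_derivative_factor_point[OF k X affine_vec_reps G])
    show "(\<lambda>z. if l = k then G (factor_point k z) else 0) \<in> reps N 0"
      by (cases "l = k") (simp_all add: factor_point_reps k G(1) reps_const)
  qed
qed

definition lift_vf :: "('n ratfun \<Rightarrow> 'n ratfun) \<Rightarrow> nat \<Rightarrow> nat \<Rightarrow> 'n ratfun \<Rightarrow> 'n ratfun" where
  "lift_vf X N k = (\<lambda>\<phi>\<in>carrier (\<F> N). THE \<psi>. \<exists>F\<in>reps N 0. \<exists>G\<in>reps N 0.
     \<phi> = germ C N 0 F \<and> \<psi> = germ C N 0 G \<and> slice_derivative X N k F G)"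

lemma lift_vf_germ:
  assumes "k < N" "X \<in> vector_fields C" "F \<in> reps N 0" "G \<in> reps N 0" "slice_derivative X N k F G"
  shows "lift_vf X N k (germ C N 0 F) = germ C N 0 G"
proof -
  have "(THE \<psi>. \<exists>F'\<in>reps N 0. \<exists>G\<in>reps N 0.
     germ C N 0 F = germ C N 0 F' \<and> \<psi> = germ C N 0 G \<and> slice_derivative X N k F' G) = germ C N 0 G"
    by (rule the_equality) (use assms slice_derivative_unique[OF assms(1)] in blast)+
  then show ?thesis using assms(3) by (simp add: lift_vf_def germ_closed)
qed

lemma lift_vf_derivation:
  assumes k: "k < N" and X: "X \<in> vector_fields C"
  shows "lift_vf X N k \<in> derivations C N"
proof -
  note lift = lift_vf_germ[OF k X]
  have ex: "\<exists>F G. F \<in> reps N 0 \<and> G \<in> reps N 0 \<and> f = germ C N 0 F \<and> lift_vf X N k f = germ C N 0 G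
      \<and> slice_derivative X N k F G"
    if "f \<in> carrier (\<F> N)" for f
    using that slice_derivative_ex[OF k X] lift unfolding carrier_rat_field by blast
  show ?thesis
    unfolding derivations_def
  proof (intro CollectI conjI ballI allI)
    have "lift_vf X N k f \<in> carrier (\<F> N)" if "f \<in> carrier (\<F> N)" for f
      using ex[OF that] germ_closed by metis
    moreover have "lift_vf X N k \<in> extensional (carrier (\<F> N))"
      by (simp add: lift_vf_def)
    ultimately show "lift_vf X N k \<in> carrier (\<F> N) \<rightarrow>\<^sub>E carrier (\<F> N)"
      by (auto simp: PiE_def)
    show "lift_vf X N k (germ C N 0 (\<lambda>_. c)) = \<zero>\<^bsub>\<F> N\<^esub>" for c
      unfolding zero_rat_field by (rule lift[OF reps_const reps_const slice_derivative_const[OF X]])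
    fix f g assume fg: "f \<in> carrier (\<F> N)" "g \<in> carrier (\<F> N)"
    obtain F F' where F: "F \<in> reps N 0" "F' \<in> reps N 0" "f = germ C N 0 F"
      "lift_vf X N k f = germ C N 0 F'" "slice_derivative X N k F F'" using ex[OF fg(1)] by blast
    obtain G G' where G: "G \<in> reps N 0" "G' \<in> reps N 0" "g = germ C N 0 G"
      "lift_vf X N k g = germ C N 0 G'" "slice_derivative X N k G G'" using ex[OF fg(2)] by blast
    have "lift_vf X N k (f \<oplus>\<^bsub>\<F> N\<^esub> g) = germ C N 0 (\<lambda>z. F' z + G' z)"
      unfolding F(3) G(3) germ_add[OF F(1) G(1)]
      by (rule lift[OF reps_add[OF F(1) G(1)] reps_add[OF F(2) G(2)]
          slice_derivative_add[OF k X F(1,2) G(1,2) F(5) G(5)]])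
    then show "lift_vf X N k (f \<oplus>\<^bsub>\<F> N\<^esub> g) =
        lift_vf X N k f \<oplus>\<^bsub>\<F> N\<^esub> lift_vf X N k g"
      unfolding F(4) G(4) by (simp add: germ_add F G)
    have "lift_vf X N k (f \<otimes>\<^bsub>\<F> N\<^esub> g) = germ C N 0 (\<lambda>z. F' z * G z + F z * G' z)"
      unfolding F(3) G(3) germ_mult[OF F(1) G(1)]
      by (rule lift[OF reps_mult[OF F(1) G(1)] reps_add[OF reps_mult[OF F(2) G(1)] reps_mult[OF F(1) G(2)]]
          slice_derivative_mult[OF k X F(1,2) G(1,2) F(5) G(5)]])
    then show "lift_vf X N k (f \<otimes>\<^bsub>\<F> N\<^esub> g) =
        (lift_vf X N k f \<otimes>\<^bsub>\<F> N\<^esub> g) \<oplus>\<^bsub>\<F> N\<^esub>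
          (f \<otimes>\<^bsub>\<F> N\<^esub> lift_vf X N k g)"
      unfolding F(4) G(4) unfolding F(3) G(3) by (simp add: germ_mult germ_add reps_mult F G)
  qed
qed

text \<open>Unique existence behind the description \<open>vf_at\<close>: the slice-wise lift has
  the required values, and the affine coordinates of the factors, where these values are prescribed,
  determine a derivation.\<close>

lemma vf_at_spec:
  assumes k: "k < N" and X: "X \<in> vector_fields C"
  shows "vf_at C N X k \<in> derivations C N \<and> (\<forall>f\<in>carrier (\<F> 1). \<forall>l<N.
    vf_at C N X k (at_var C N l f) = (if l = k then at_var C N k (X f) else \<zero>\<^bsub>\<F> N\<^esub>))"
proof -
  let ?P = "\<lambda>D. D \<in> derivations C N \<and> (\<forall>f\<in>carrier (\<F> 1). \<forall>l<N.
    D (at_var C N l f) = (if l = k then at_var C N k (X f) else \<zero>\<^bsub>\<F> N\<^esub>))"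
  have "lift_vf X N k (at_var C N l f) = (if l = k then at_var C N k (X f) else \<zero>\<^bsub>\<F> N\<^esub>)"
    if f: "f \<in> carrier (\<F> 1)" and l: "l < N" for f l
  proof -
    obtain F where F: "F \<in> reps 1 0" "f = germ C 1 0 F" using f unfolding carrier_rat_field by blast
    obtain G where G: "G \<in> reps 1 0" "X (germ C 1 0 F) = germ C 1 0 G"
      using derivation_germ_ex[OF X[unfolded vector_fields_def] F(1)] .
    have "(\<lambda>z. if l = k then G (factor_point k z) else 0) \<in> reps N 0"
      by (cases "l = k") (simp_all add: factor_point_reps k G(1) reps_const)
    from lift_vf_germ[OF k X factor_point_reps[OF l F(1)] this slice_derivative_factor_point[OF k X F(1) G]]
    show ?thesis unfolding F(2) G(2) at_var_germ[OF l F(1)] at_var_germ[OF k G(1)]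
      by (auto simp: zero_rat_field)
  qed
  then have L: "?P (lift_vf X N k)" using lift_vf_derivation[OF assms] by blast
  have uniq: "D = lift_vf X N k" if D: "?P D" for D
  proof (rule derivation_eq_on_generators)
    fix l i assume l: "l < N"
    have "germ C 1 0 (\<lambda>s. affine_vec s $ i) \<in> carrier (\<F> 1)"
      by (rule germ_closed[OF affine_vec_reps])
    then have "D (at_var C N l (germ C 1 0 (\<lambda>s. affine_vec s $ i))) =
        lift_vf X N k (at_var C N l (germ C 1 0 (\<lambda>s. affine_vec s $ i)))"
      using D L l by simp
    then show "D (germ C N 0 (\<lambda>z. affine_vec (factor_point l z) $ i)) =
        lift_vf X N k (germ C N 0 (\<lambda>z. affine_vec (factor_point l z) $ i))"
      unfolding at_var_germ[OF l affine_vec_reps] .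
  qed (use D L in blast)+
  have "\<exists>!D. ?P D" by (rule ex1I[of ?P, OF L]) (rule uniq)
  then show ?thesis unfolding vf_at_def by (rule theI')
qed

lemmas vf_at_derivation = vf_at_spec[THEN conjunct1]

lemma vf_at_at_var:
  "k < N \<Longrightarrow> l < N \<Longrightarrow> X \<in> vector_fields C \<Longrightarrow> f \<in> carrier (\<F> 1) \<Longrightarrow>
    vf_at C N X k (at_var C N l f) = (if l = k then at_var C N k (X f) else \<zero>\<^bsub>\<F> N\<^esub>)"
  using vf_at_spec by blast

lemma derivation_commutator:
  assumes D: "D \<in> derivations C N" and E: "E \<in> derivations C N"
  shows "(\<lambda>f\<in>carrier (\<F> N). D (E f) \<ominus>\<^bsub>\<F> N\<^esub> E (D f)) \<in> derivations C N" (is "?K \<in> _")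
proof -
  interpret F: cring "\<F> N" by (rule cring_rat_field)
  note cl = derivation_closed[OF D] derivation_closed[OF E]
  show ?thesis
    unfolding derivations_def
  proof (intro CollectI conjI ballI allI)
    show "?K (germ C N 0 (\<lambda>_. c))
        = \<zero>\<^bsub>\<F> N\<^esub>" for c
      using derivation_const[OF D] derivation_const[OF E] derivation_zero[OF D] derivation_zero[OF E]
        germ_closed[OF reps_const] by (simp add: zero_rat_field[symmetric] a_minus_def)
    fix f g assume fg: "f \<in> carrier (\<F> N)" "g \<in> carrier (\<F> N)"
    show "?K (f \<oplus>\<^bsub>\<F> N\<^esub> g)
      = ?K f \<oplus>\<^bsub>\<F> N\<^esub>
        ?K g"
      using fg cl
      by (simp add: derivation_add[OF D] derivation_add[OF E] a_minus_def F.minus_add F.a_ac)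
    have "D (E (f \<otimes>\<^bsub>\<F> N\<^esub> g)) \<ominus>\<^bsub>\<F> N\<^esub> E (D (f \<otimes>\<^bsub>\<F> N\<^esub> g)) =
      ((D (E f) \<otimes>\<^bsub>\<F> N\<^esub> g \<oplus>\<^bsub>\<F> N\<^esub> E f \<otimes>\<^bsub>\<F> N\<^esub> D g)
        \<oplus>\<^bsub>\<F> N\<^esub>
        (D f \<otimes>\<^bsub>\<F> N\<^esub> E g \<oplus>\<^bsub>\<F> N\<^esub> f \<otimes>\<^bsub>\<F> N\<^esub> D (E g)))
      \<ominus>\<^bsub>\<F> N\<^esub>
      ((E (D f) \<otimes>\<^bsub>\<F> N\<^esub> g \<oplus>\<^bsub>\<F> N\<^esub> D f \<otimes>\<^bsub>\<F> N\<^esub> E g)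
        \<oplus>\<^bsub>\<F> N\<^esub>
        (E f \<otimes>\<^bsub>\<F> N\<^esub> D g \<oplus>\<^bsub>\<F> N\<^esub> f \<otimes>\<^bsub>\<F> N\<^esub> E (D g)))"
      using fg cl by (simp add: derivation_add[OF D] derivation_add[OF E] derivation_mult[OF D] derivation_mult[OF E])
    \<comment> \<open>The mixed products of first derivatives occur in both orders and
      cancel.\<close>
    also have "\<dots> = ((D (E f) \<ominus>\<^bsub>\<F> N\<^esub> E (D f)) \<otimes>\<^bsub>\<F> N\<^esub> g) \<oplus>\<^bsub>\<F> N\<^esub>
        (f \<otimes>\<^bsub>\<F> N\<^esub> (D (E g) \<ominus>\<^bsub>\<F> N\<^esub> E (D g)))"
    proof -
      note c = fg cl[OF fg(1)] cl[OF fg(2)] cl(1)[OF cl(2)[OF fg(1)]] cl(2)[OF cl(1)[OF fg(1)]]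
        cl(1)[OF cl(2)[OF fg(2)]] cl(2)[OF cl(1)[OF fg(2)]]
      from c show ?thesis by algebra
    qed
    finally show "?K (f \<otimes>\<^bsub>\<F> N\<^esub> g)
      = (?K f \<otimes>\<^bsub>\<F> N\<^esub> g) \<oplus>\<^bsub>\<F> N\<^esub>
        (f \<otimes>\<^bsub>\<F> N\<^esub> ?K g)"
      using fg cl by simp
  qed (use cl in auto)
qed

text \<open>The commutator is a derivation, so it is enough to test generators. Each depends on one
  variable, as do its derivatives, and for \<open>k \<noteq> l\<close> one of the two derivations
  kills it.\<close>

lemma vf_at_commute:
  assumes k: "k < N" and l: "l < N" and X: "X \<in> vector_fields C" and f: "f \<in> carrier (\<F> N)"
  shows "vf_at C N X k (vf_at C N X l f) = vf_at C N X l (vf_at C N X k f)"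
proof (cases "k = l")
  case False
  interpret F: cring "\<F> N" by (rule cring_rat_field)
  let ?D = "vf_at C N X k" and ?E = "vf_at C N X l"
  note D = vf_at_derivation[OF k X] and E = vf_at_derivation[OF l X]
  let ?K = "\<lambda>f\<in>carrier (\<F> N). ?D (?E f) \<ominus>\<^bsub>\<F> N\<^esub> ?E (?D f)"
  have "?K = zero_op C N"
  proof (rule derivation_eq_on_generators[OF derivation_commutator[OF D E] zero_op_derivation])
    fix m i assume m: "m < N"
    let ?a = "germ C 1 0 (\<lambda>s. affine_vec s $ i)"
    have a: "?a \<in> carrier (\<F> 1)" by (rule germ_closed[OF affine_vec_reps])
    have Xa: "X ?a \<in> carrier (\<F> 1)"
      using derivation_closed[OF X[unfolded vector_fields_def] a] .
    have am: "germ C N 0 (\<lambda>z. affine_vec (factor_point m z) $ i) = at_var C N m ?a"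
      using at_var_germ[OF m affine_vec_reps] by simp
    have "?D (?E (at_var C N m ?a)) = \<zero>\<^bsub>\<F> N\<^esub>"
      "?E (?D (at_var C N m ?a)) = \<zero>\<^bsub>\<F> N\<^esub>"
      using False derivation_zero[OF D] derivation_zero[OF E]
      by (auto simp: vf_at_at_var k l m X a Xa)
    then show "?K (germ C N 0 (\<lambda>z. affine_vec (factor_point m z) $ i)) =
        zero_op C N (germ C N 0 (\<lambda>z. affine_vec (factor_point m z) $ i))"
      unfolding am using at_var_closed[OF m a] by (simp add: zero_op_def a_minus_def)
  qed
  then have "?K f = zero_op C N f" by simp
  then have "?D (?E f) \<ominus>\<^bsub>\<F> N\<^esub> ?E (?D f) = \<zero>\<^bsub>\<F> N\<^esub>"
    using f by (simp add: zero_op_def)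
  then have "?D (?E f) = \<ominus>\<^bsub>\<F> N\<^esub> (\<ominus>\<^bsub>\<F> N\<^esub> ?E (?D f))"
    unfolding a_minus_def using derivation_closed[OF D] derivation_closed[OF E] f
    by (intro F.minus_equality[symmetric]) simp_all
  then show ?thesis using derivation_closed[OF D] derivation_closed[OF E] f by simp
qed simp

end

section \<open>Determinants of complex matrices\<close>

text \<open>Determinants are taken over the complex numbers, one point at a time. Index functions
  are used so that entries can be representatives evaluated at a point.\<close>

definition fun_mat :: "nat \<Rightarrow> (nat \<Rightarrow> nat \<Rightarrow> complex) \<Rightarrow> complex Matrix.mat" where
  "fun_mat n a = Matrix.mat n n (\<lambda>(k, j). a k j)"

definition fun_det :: "nat \<Rightarrow> (nat \<Rightarrow> nat \<Rightarrow> complex) \<Rightarrow> complex" where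
  "fun_det n a = Determinant.det (fun_mat n a)"

definition fun_cofactor :: "nat \<Rightarrow> (nat \<Rightarrow> nat \<Rightarrow> complex) \<Rightarrow> nat \<Rightarrow> nat \<Rightarrow> complex" where
  "fun_cofactor n a k j = Determinant.cofactor (fun_mat n a) k j"

lemma fun_mat_carrier [simp]: "fun_mat n a \<in> carrier_mat n n"
  by (simp add: fun_mat_def)

lemma fun_mat_index [simp]: "k < n \<Longrightarrow> j < n \<Longrightarrow> fun_mat n a $$ (k, j) = a k j"
  by (simp add: fun_mat_def)

lemma fun_det_cong: "(\<And>k j. k < n \<Longrightarrow> j < n \<Longrightarrow> a k j = b k j) \<Longrightarrow> fun_det n a = fun_det n b"
  unfolding fun_det_def fun_mat_def by (rule arg_cong[of _ _ Determinant.det]) (auto intro!: eq_matI)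

lemma fun_det_permutations:
  "fun_det n a = (\<Sum>\<sigma>\<in>{\<sigma>. \<sigma> permutes {..<n}}. of_int (sign \<sigma>) * (\<Prod>k<n. a k (\<sigma> k)))"
proof -
  have "(\<Prod>k = 0..<n. fun_mat n a $$ (k, \<sigma> k)) = (\<Prod>k<n. a k (\<sigma> k))" if "\<sigma> permutes {0..<n}" for \<sigma>
    unfolding atLeast0LessThan
    by (rule prod.cong) (use permutes_in_image[OF that] in \<open>auto simp: atLeast0LessThan\<close>)
  then show ?thesis
    unfolding fun_det_def det_def'[OF fun_mat_carrier] by (simp add: atLeast0LessThan)
qed

lemma fun_cofactor_det:
  assumes "k < n" "j < n"
  shows "fun_cofactor n a k j = (-1) ^ (k + j) *
    fun_det (n - 1) (\<lambda>k' j'. a (if k' < k then k' else Suc k') (if j' < j then j' else Suc j'))"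
proof -
  have "mat_delete (fun_mat n a) k j =
      fun_mat (n - 1) (\<lambda>k' j'. a (if k' < k then k' else Suc k') (if j' < j then j' else Suc j'))"
    by (rule eq_matI) (use assms in \<open>auto simp: mat_delete_def fun_mat_def\<close>)
  then show ?thesis unfolding fun_cofactor_def cofactor_def fun_det_def by simp
qed

lemma fun_mat_mult_cofactor:
  assumes "k < n" "l < n"
  shows "(\<Sum>i<n. a k i * fun_cofactor n a l i) = (if k = l then fun_det n a else 0)"
proof -
  have "(fun_mat n a * adj_mat (fun_mat n a)) $$ (k, l) = (\<Sum>i<n. a k i * fun_cofactor n a l i)"
    using assms by (simp add: times_mat_def scalar_prod_def adj_mat_def fun_cofactor_def
        fun_mat_def atLeast0LessThan)
  then show ?thesis
    using assms by (cases "k = l") (simp_all add: adj_mat(2)[OF fun_mat_carrier] fun_det_def)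
qed

lemma fun_cofactor_mult_mat:
  assumes "i < n" "j < n"
  shows "(\<Sum>k<n. fun_cofactor n a k i * a k j) = (if i = j then fun_det n a else 0)"
proof -
  have "(adj_mat (fun_mat n a) * fun_mat n a) $$ (i, j) = (\<Sum>k<n. fun_cofactor n a k i * a k j)"
    using assms by (simp add: times_mat_def scalar_prod_def adj_mat_def fun_cofactor_def
        fun_mat_def atLeast0LessThan)
  then show ?thesis
    using assms by (cases "i = j") (simp_all add: adj_mat(3)[OF fun_mat_carrier] fun_det_def)
qed

lemma fun_det_row:
  assumes "k < n"
  shows "fun_det n a = (\<Sum>j<n. a k j * fun_cofactor n a k j)"
  using fun_mat_mult_cofactor[OF assms assms, of a] by simp

lemma nth_filter_neq:
  assumes "i < n" "m < n - 1"
  shows "filter (\<lambda>j. j \<noteq> i) [0..<n] ! m = (if m < i then m else Suc m)"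
proof -
  have "[0..<n] = [0..<i] @ i # [Suc i..<n]"
    using assms(1) by (metis le0 le_add_diff_inverse less_imp_le upt_add_eq_append upt_conv_Cons)
  moreover have "filter (\<lambda>j. j \<noteq> i) [0..<i] = [0..<i]" "filter (\<lambda>j. j \<noteq> i) [Suc i..<n] = [Suc i..<n]"
    by (simp_all add: filter_id_conv)
  ultimately have "filter (\<lambda>j. j \<noteq> i) [0..<n] = [0..<i] @ [Suc i..<n]" by simp
  then show ?thesis using assms by (auto simp: nth_append)
qed

text \<open>Cramer's rule, with the replaced column moved to the front.\<close>

lemma fun_det_unit_column:
  assumes i: "i < n" and y: "\<And>k. k < n \<Longrightarrow> (\<Sum>j<n. a k j * y j) = 1"
  shows "fun_det n (\<lambda>k j. if j = 0 then 1 else a k (filter (\<lambda>j. j \<noteq> i) [0..<n] ! (j - 1))) =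
    (-1) ^ i * y i * fun_det n a" (is "fun_det n ?b = _")
proof -
  have n: "0 < n" using i by simp
  \<comment> \<open>The product \<open>a y\<close> is the vector of ones, so this is the matrix with
    its \<open>i\<close>-th column replaced by ones.\<close>
  let ?r = "replace_col (fun_mat n a) (fun_mat n a *\<^sub>v Matrix.vec n y) i"
  have r: "?r = fun_mat n (\<lambda>k j. if j = i then 1 else a k j)"
    by (rule eq_matI)
      (auto simp: replace_col_def fun_mat_def scalar_prod_def atLeast0LessThan y)
  \<comment> \<open>Removing the column of ones leaves the same columns in the same order, so the
    two Laplace expansions differ only by the sign \<open>(-1)^i\<close>.\<close>
  have del: "mat_delete (fun_mat n ?b) k 0 = mat_delete ?r k i" if "k < n" for k
    unfolding r
    by (rule eq_matI) (use that i in \<open>auto simp: mat_delete_def fun_mat_def nth_filter_neq\<close>)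
  have "fun_det n ?b = (\<Sum>k<n. fun_mat n ?b $$ (k, 0) * Determinant.cofactor (fun_mat n ?b) k 0)"
    unfolding fun_det_def by (rule laplace_expansion_column[OF fun_mat_carrier n])
  also have "\<dots> = (\<Sum>k<n. (-1) ^ i * (?r $$ (k, i) * Determinant.cofactor ?r k i))"
  proof (rule sum.cong[OF refl])
    fix k assume "k \<in> {..<n}"
    then have k: "k < n" by simp
    have "?r $$ (k, i) = 1" "fun_mat n ?b $$ (k, 0) = 1" using k i n unfolding r by simp_all
    then show "fun_mat n ?b $$ (k, 0) * Determinant.cofactor (fun_mat n ?b) k 0 =
        (-1) ^ i * (?r $$ (k, i) * Determinant.cofactor ?r k i)"
      unfolding cofactor_def del[OF k] by (simp add: power_add mult.assoc[symmetric] power_mult_distrib[symmetric])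
  qed
  also have "\<dots> = (-1) ^ i * Determinant.det ?r"
    using laplace_expansion_column[of ?r n i] i r by (simp add: sum_distrib_left[symmetric])
  also have "Determinant.det ?r = y i * fun_det n a"
    using cramer_lemma_mat[OF fun_mat_carrier, of "Matrix.vec n y" n i a] i by (simp add: fun_det_def)
  finally show ?thesis by simp
qed

text \<open>Expand along the last row. The cofactors do not involve the last point, and the last of
  them is the nonzero determinant of size \<open>n\<close>, so independence provides a last point
  for which the expansion does not vanish.\<close>

lemma independent_functions_det:
  fixes f :: "nat \<Rightarrow> 'p \<Rightarrow> complex"
  assumes "\<And>c. (\<And>p. p \<in> G \<Longrightarrow> (\<Sum>j<n. c j * f j p) = 0) \<Longrightarrow> \<forall>j<n. c j = 0"
  shows "\<exists>z. (\<forall>k<n. z k \<in> G) \<and> fun_det n (\<lambda>k j. f j (z k)) \<noteq> 0"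
  using assms
proof (induction n)
  case 0
  show ?case by (simp add: fun_det_permutations)
next
  case (Suc n)
  have "\<forall>j<n. c j = 0" if "\<And>p. p \<in> G \<Longrightarrow> (\<Sum>j<n. c j * f j p) = 0" for c
  proof -
    have "\<forall>j<Suc n. (if j < n then c j else 0) = 0"
      by (rule Suc.prems) (simp add: that)
    then show ?thesis by (auto dest: less_SucI)
  qed
  from Suc.IH[OF this] obtain z where z: "\<forall>k<n. z k \<in> G" "fun_det n (\<lambda>k j. f j (z k)) \<noteq> 0" by blast
  let ?a = "\<lambda>p k j. f j ((z(n := p)) k)"
  \<comment> \<open>Any value could stand for the last point: the cofactors of its row do not see
    it.\<close>
  define c where "c j = fun_cofactor (Suc n) (?a undefined) n j" for j
  have c: "fun_cofactor (Suc n) (?a p) n j = c j" if "j < Suc n" for p j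
    unfolding c_def by (subst (1 2) fun_cofactor_det) (use that in \<open>auto intro!: fun_det_cong\<close>)
  have det: "fun_det (Suc n) (?a p) = (\<Sum>j<Suc n. c j * f j p)" for p
    unfolding fun_det_row[of n "Suc n" "?a p", OF lessI]
    by (rule sum.cong) (use c in \<open>auto simp: mult.commute\<close>)
  have "c n = fun_det n (\<lambda>k j. f j (z k))"
    unfolding c_def by (subst fun_cofactor_det) (auto intro!: fun_det_cong)
  then have "c n \<noteq> 0" using z(2) by simp
  then obtain p where "p \<in> G" "fun_det (Suc n) (?a p) \<noteq> 0"
    unfolding det using Suc.prems[of c] by blast
  then show ?case by (intro exI[of _ "z(n := p)"]) (use z in \<open>auto simp: less_Suc_eq\<close>)
qed

section \<open>Vector fields form a line\<close>

lemma poly_funs_line_differentiable: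
  assumes "P \<in> poly_funs {\<lambda>v :: complex ^ 'n::finite. v $ i |i. True}"
  shows "(\<lambda>t. P (v + t *s w)) field_differentiable at t"
  using assms
proof induction
  case (coord x)
  then obtain i where "x = (\<lambda>v. v $ i)" by blast
  then show ?case by (auto intro!: derivative_intros)
qed (auto intro!: derivative_intros)

text \<open>Otherwise \<open>v\<close> and \<open>w\<close> are independent and lie in the
  hyperplane \<open>x $ b = 0\<close>, which \<open>u\<close> avoids; this gives three independent
  vectors in \<open>T\<close>.\<close>

lemma minors_zero_of_dim_two:
  fixes T :: "(complex ^ 'n::finite) set"
  assumes dim: "vec.dim T = 2" and T: "u \<in> T" "v \<in> T" "w \<in> T"
    and b: "u $ b \<noteq> 0" "v $ b = 0" "w $ b = 0"
  shows "v $ i * w $ j = v $ j * w $ i"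
proof (rule ccontr)
  assume ne: "v $ i * w $ j \<noteq> v $ j * w $ i"
  have w: "w \<noteq> 0" using ne by auto
  have "v \<notin> vec.span {w}"
  proof
    assume "v \<in> vec.span {w}"
    then obtain c where "v = c *s w" unfolding vec.span_singleton by auto
    then show False using ne by simp
  qed
  moreover have "vec.subspace {x :: complex ^ 'n. x $ b = 0}" by (simp add: vec.subspace_def)
  then have "vec.span {v, w} \<subseteq> {x. x $ b = 0}" by (rule vec.span_minimal[rotated]) (use b in auto)
  then have "u \<notin> vec.span {v, w}" using b(1) by blast
  moreover have "vec.independent {w}" using w by simp
  moreover have "v \<noteq> w" "u \<noteq> v" "u \<noteq> w" using ne b by auto
  ultimately have "vec.independent {u, v, w}" by (simp add: vec.independent_insert)
  then have "card {u, v, w} \<le> vec.dim T" using T by (intro vec.independent_card_le_dim) auto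
  then show False using dim \<open>v \<noteq> w\<close> \<open>u \<noteq> v\<close> \<open>u \<noteq> w\<close> by simp
qed

section \<open>Vector fields as tangent vectors\<close>

context irreducible_curve
begin

lemma vector_field_eq_on_generators:
  assumes "X \<in> vector_fields C" "Y \<in> vector_fields C"
    and "\<And>i. X (germ C 1 0 (\<lambda>s. affine_vec s $ i)) = Y (germ C 1 0 (\<lambda>s. affine_vec s $ i))"
  shows "X = Y"
proof (rule derivation_eq_on_generators[OF assms(1,2)[unfolded vector_fields_def]])
  fix k i assume "k < (1::nat)"
  then have k: "k = 0" by simp
  have "\<forall>\<^sub>F s in generic C 1 0. affine_vec s $ i = affine_vec (factor_point k s) $ i"
    using eventually_generic_points
    by (rule eventually_mono) (auto simp: k factor_point_const points_curve)
  from germ_cong[OF affine_vec_reps this] assms(3)[of i]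
  show "X (germ C 1 0 (\<lambda>s. affine_vec (factor_point k s) $ i)) =
    Y (germ C 1 0 (\<lambda>s. affine_vec (factor_point k s) $ i))" by simp
qed

definition vf_coords :: "('n ratfun \<Rightarrow> 'n ratfun) \<Rightarrow> 'n \<Rightarrow> 'n pt \<Rightarrow> complex" where
  "vf_coords X i = (SOME G. G \<in> reps 1 0 \<and> X (germ C 1 0 (\<lambda>s. affine_vec s $ i)) = germ C 1 0 G)"

lemma vf_coords:
  assumes "X \<in> vector_fields C"
  shows "vf_coords X i \<in> reps 1 0" "X (germ C 1 0 (\<lambda>s. affine_vec s $ i)) = germ C 1 0 (vf_coords X i)"
proof -
  obtain G where "G \<in> reps 1 0" "X (germ C 1 0 (\<lambda>s. affine_vec s $ i)) = germ C 1 0 G"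
    using derivation_germ_ex[OF assms[unfolded vector_fields_def] affine_vec_reps] .
  then have "\<exists>G. G \<in> reps 1 0 \<and> X (germ C 1 0 (\<lambda>s. affine_vec s $ i)) = germ C 1 0 G" by blast
  from someI_ex[OF this]
  show "vf_coords X i \<in> reps 1 0" "X (germ C 1 0 (\<lambda>s. affine_vec s $ i)) = germ C 1 0 (vf_coords X i)"
    unfolding vf_coords_def by blast+
qed

text \<open>The tangent vector of \<open>X\<close> in the affine chart. Its
  \<open>base_index\<close> entry vanishes generically, the corresponding affine coordinate being
  generically \<open>1\<close>.\<close>

definition vf_value :: "('n ratfun \<Rightarrow> 'n ratfun) \<Rightarrow> 'n pt \<Rightarrow> complex ^ 'n" where
  "vf_value X s = (\<chi> i. vf_coords X i s)"

text \<open>The chain rule: applying \<open>X\<close> is differentiating in the direction of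
  \<open>vf_value X\<close>. The regularity clause is proved along with it so that the result can be
  evaluated at a given point by \<open>regular_at_zero\<close>.\<close>

lemma vector_field_polynomial:
  assumes X: "X \<in> vector_fields C" and "P \<in> poly_funs {\<lambda>v. v $ i |i. True}"
  defines "dP \<equiv> \<lambda>s. deriv (\<lambda>t. P (affine_vec s + t *s vf_value X s)) 0"
  shows "(\<lambda>s. P (affine_vec s)) \<in> reps 1 0 \<and> dP \<in> reps 1 0 \<and>
    X (germ C 1 0 (\<lambda>s. P (affine_vec s))) = germ C 1 0 dP \<and>
    (\<forall>s. (\<forall>i. regular_at C 1 0 s (\<lambda>s. affine_vec s $ i) \<and> regular_at C 1 0 s (vf_coords X i)) \<longrightarrow>
      regular_at C 1 0 s (\<lambda>s. P (affine_vec s)) \<and> regular_at C 1 0 s dP)"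
  using assms(2) unfolding dP_def
proof induction
  case (const c)
  have "regular_at C 1 0 s (\<lambda>_. a)" if "\<forall>i. regular_at C 1 0 s (vf_coords X i)" for s a
    using that regular_at_const[OF regular_at_points] by blast
  then show ?case
    using derivation_const[OF X[unfolded vector_fields_def]] by (simp add: reps_const)
next
  case (coord x)
  then obtain i where x: "x = (\<lambda>v. v $ i)" by blast
  have "((\<lambda>t. (affine_vec s + t *s vf_value X s) $ i) has_field_derivative vf_value X s $ i) (at 0)" for s
    by (auto intro!: derivative_eq_intros)
  then have "(\<lambda>s. deriv (\<lambda>t. x (affine_vec s + t *s vf_value X s)) 0) = vf_coords X i"
    unfolding x by (auto simp: vf_value_def fun_eq_iff dest!: DERIV_imp_deriv)
  then show ?case using vf_coords[OF X, of i] affine_vec_reps[of i] by (simp add: x)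
next
  case (add P Q)
  note diff = poly_funs_line_differentiable[OF add.hyps(1)] poly_funs_line_differentiable[OF add.hyps(2)]
  have *: "deriv (\<lambda>t. P (affine_vec s + t *s vf_value X s) + Q (affine_vec s + t *s vf_value X s)) 0 =
      deriv (\<lambda>t. P (affine_vec s + t *s vf_value X s)) 0 + deriv (\<lambda>t. Q (affine_vec s + t *s vf_value X s)) 0" for s
    by (rule deriv_add[OF diff])
  show ?case unfolding *
    using add.IH derivation_germ_add[OF X[unfolded vector_fields_def]]
    by (auto intro!: reps_add regular_at_add)
next
  case (mult P Q)
  note diff = poly_funs_line_differentiable[OF mult.hyps(1)] poly_funs_line_differentiable[OF mult.hyps(2)]
  have *: "deriv (\<lambda>t. P (affine_vec s + t *s vf_value X s) * Q (affine_vec s + t *s vf_value X s)) 0 =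
      deriv (\<lambda>t. P (affine_vec s + t *s vf_value X s)) 0 * Q (affine_vec s) +
      P (affine_vec s) * deriv (\<lambda>t. Q (affine_vec s + t *s vf_value X s)) 0" for s
    by (subst deriv_mult[OF diff]) simp
  show ?case unfolding *
    using mult.IH derivation_germ_mult[OF X[unfolded vector_fields_def]]
    by (auto intro!: reps_add reps_mult regular_at_add regular_at_mult)
qed

text \<open>Equations of the curve are differentiated to zero, so the values of a vector field are tangent
  vectors of the cone.\<close>

lemma vf_value_cone_tangent:
  assumes X: "X \<in> vector_fields C"
    and s: "\<And>i. regular_at C 1 0 s (\<lambda>s. affine_vec s $ i)" "\<And>i. regular_at C 1 0 s (vf_coords X i)"
  shows "vf_value X s \<in> cone_tangent C (affine_vec s)"
  unfolding cone_tangent_def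
proof (intro CollectI allI ballI impI)
  fix e P assume "P \<in> forms e" and zero: "\<forall>p\<in>C. \<forall>u\<in>hcoords p. P u = 0"
  then have "P \<in> poly_funs {\<lambda>v. v $ i |i. True}" by (simp add: forms_def)
  note P = vector_field_polynomial[OF X this]
  have "\<forall>\<^sub>F s in generic C 1 0. P (affine_vec s) = 0"
    using affine_point_eventually
  proof (rule eventually_mono)
    fix s assume s: "affine_point s \<and> s \<in> points C 1 0"
    then have "fst s 0 \<in> C" by (simp add: points_iff)
    then show "P (affine_vec s) = 0" using s affine_vec_hcoords zero by blast
  qed
  then have "germ C 1 0 (\<lambda>s. P (affine_vec s)) = \<zero>\<^bsub>\<F> 1\<^esub>"
    using germ_eq_zero_iff[OF P[THEN conjunct1]] by blast
  then have "germ C 1 0 (\<lambda>s. deriv (\<lambda>t. P (affine_vec s + t *s vf_value X s)) 0) = \<zero>\<^bsub>\<F> 1\<^esub>"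
    using P derivation_zero[OF X[unfolded vector_fields_def]] by simp
  then have "\<forall>\<^sub>F s in generic C 1 0. deriv (\<lambda>t. P (affine_vec s + t *s vf_value X s)) 0 = 0"
    using germ_eq_zero_iff P by blast
  then show "deriv (\<lambda>t. P (affine_vec s + t *s vf_value X s)) 0 = 0"
    by (rule regular_at_zero[rotated]) (use P s in blast)
qed

text \<open>Euler's relation: a form vanishing at a point vanishes on the line through it.\<close>

lemma affine_vec_cone_tangent:
  assumes "affine_point s" "s \<in> points C 1 0"
  shows "affine_vec s \<in> cone_tangent C (affine_vec s)"
  unfolding cone_tangent_def
proof (intro CollectI allI ballI impI)
  fix e P assume P: "P \<in> forms e" and zero: "\<forall>p\<in>C. \<forall>u\<in>hcoords p. P u = 0"
  have "fst s 0 \<in> C" using assms(2) by (simp add: points_iff)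
  then have P0: "P (affine_vec s) = 0" using affine_vec_hcoords[OF assms(1)] zero by blast
  have "P (affine_vec s + t *s affine_vec s) = 0" for t
  proof -
    have "affine_vec s + t *s affine_vec s = (1 + t) *s affine_vec s"
      by (simp add: Finite_Cartesian_Product.vec_eq_iff algebra_simps)
    moreover have "P ((1 + t) *s affine_vec s) = (1 + t) ^ e * P (affine_vec s)"
      using P unfolding forms_def by blast
    ultimately show ?thesis using P0 by simp
  qed
  then show "deriv (\<lambda>t. P (affine_vec s + t *s affine_vec s)) 0 = 0" by simp
qed

text \<open>At a generic point the position vector and the values of \<open>X\<close> and
  \<open>Y\<close> lie in a tangent space of dimension two. The position vector has base entry
  \<open>1\<close> and the values have base entry \<open>0\<close>, so the two values are
  proportional.\<close>

lemma vf_coords_proportional: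
  assumes smooth: "\<forall>p\<in>C. \<forall>v\<in>hcoords p. vec.dim (cone_tangent C v) = 2"
    and X: "X \<in> vector_fields C" and Y: "Y \<in> vector_fields C"
  shows "\<forall>\<^sub>F s in generic C 1 0. vf_coords X i s * vf_coords Y j s = vf_coords X j s * vf_coords Y i s"
proof -
  \<comment> \<open>The base affine coordinate is generically the constant \<open>1\<close>, so
    every vector field kills it.\<close>
  have base: "\<forall>\<^sub>F s in generic C 1 0. vf_coords Z base_index s = 0" if Z: "Z \<in> vector_fields C" for Z
  proof -
    have "\<forall>\<^sub>F s in generic C 1 0. affine_vec s $ base_index = 1"
      using affine_point_eventually by (rule eventually_mono) (simp add: affine_vec_base)
    from germ_cong[OF affine_vec_reps this]
    have "germ C 1 0 (vf_coords Z base_index) = germ C 1 0 (\<lambda>_. 0)"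
      using derivation_const[OF Z[unfolded vector_fields_def], where c = 1] vf_coords(2)[OF Z, of base_index] by simp
    then show ?thesis using germ_eq_iff[OF vf_coords(1)[OF Z] reps_const] by blast
  qed
  have reg: "\<forall>\<^sub>F s in generic C 1 0. \<forall>i\<in>UNIV. regular_at C 1 0 s (vf_coords Z i)" if "Z \<in> vector_fields C" for Z
    by (rule eventually_ball_finite) (use vf_coords(1)[OF that] in \<open>auto simp: reps_iff\<close>)
  show ?thesis
    using affine_point_eventually base[OF X] base[OF Y] reg[OF X] reg[OF Y]
  proof eventually_elim
    case (elim s)
    have p: "fst s 0 \<in> C" using elim(1) by (simp add: points_iff)
    have aff: "regular_at C 1 0 s (\<lambda>s. affine_vec s $ i)" for i
      using affine_vec_regular_at elim(1) by blast
    have "vf_value X s $ i * vf_value Y s $ j = vf_value X s $ j * vf_value Y s $ i"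
    proof (rule minors_zero_of_dim_two[where b = base_index])
      show "vec.dim (cone_tangent C (affine_vec s)) = 2"
        using smooth p affine_vec_hcoords elim(1) by blast
      show "affine_vec s \<in> cone_tangent C (affine_vec s)"
        using affine_vec_cone_tangent elim(1) by blast
      show "vf_value X s \<in> cone_tangent C (affine_vec s)" "vf_value Y s \<in> cone_tangent C (affine_vec s)"
        using vf_value_cone_tangent[OF X aff] vf_value_cone_tangent[OF Y aff] elim(4,5) by blast+
      show "affine_vec s $ base_index \<noteq> 0" using affine_vec_base elim(1) by simp
    qed (use elim(2,3) in \<open>simp_all add: vf_value_def\<close>)
    then show ?case by (simp add: vf_value_def)
  qed
qed

lemma vf_smult_vector_field:
  assumes X: "X \<in> vector_fields C" and g: "g \<in> carrier (\<F> 1)"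
  shows "vf_smult C g X \<in> vector_fields C"
proof -
  interpret F: cring "\<F> 1" by (rule cring_rat_field)
  note D = X[unfolded vector_fields_def]
  note cl = derivation_closed[OF D]
  show ?thesis
    unfolding vector_fields_def derivations_def
  proof (intro CollectI conjI ballI allI)
    show "vf_smult C g X (germ C 1 0 (\<lambda>_. c)) = \<zero>\<^bsub>\<F> 1\<^esub>" for c
      using derivation_const[OF D, where c = c] germ_closed[OF reps_const[of c]] g
      by (simp add: vf_smult_def zero_rat_field[symmetric])
    fix a b assume ab: "a \<in> carrier (\<F> 1)" "b \<in> carrier (\<F> 1)"
    note c = ab g cl[OF ab(1)] cl[OF ab(2)]
    show "vf_smult C g X (a \<oplus>\<^bsub>\<F> 1\<^esub> b) =
        vf_smult C g X a \<oplus>\<^bsub>\<F> 1\<^esub> vf_smult C g X b"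
      using c by (simp add: vf_smult_def derivation_add[OF D] F.r_distr)
    have "g \<otimes>\<^bsub>\<F> 1\<^esub> (X a \<otimes>\<^bsub>\<F> 1\<^esub> b \<oplus>\<^bsub>\<F> 1\<^esub> a \<otimes>\<^bsub>\<F> 1\<^esub> X b)
      = g \<otimes>\<^bsub>\<F> 1\<^esub> X a \<otimes>\<^bsub>\<F> 1\<^esub> b \<oplus>\<^bsub>\<F> 1\<^esub>
        a \<otimes>\<^bsub>\<F> 1\<^esub> (g \<otimes>\<^bsub>\<F> 1\<^esub> X b)"
      using c by algebra
    then show "vf_smult C g X (a \<otimes>\<^bsub>\<F> 1\<^esub> b) =
        vf_smult C g X a \<otimes>\<^bsub>\<F> 1\<^esub> b \<oplus>\<^bsub>\<F> 1\<^esub>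
        a \<otimes>\<^bsub>\<F> 1\<^esub> vf_smult C g X b"
      using c by (simp add: vf_smult_def derivation_mult[OF D])
  qed (use cl g in \<open>auto simp: vf_smult_def\<close>)
qed

text \<open>The factor is the quotient of the \<open>j\<close>-th entries, for some \<open>j\<close>
  where the entry of \<open>X\<close> is a nonzero germ; the other entries follow from
  proportionality.\<close>

lemma vector_field_multiple:
  assumes smooth: "\<forall>p\<in>C. \<forall>v\<in>hcoords p. vec.dim (cone_tangent C v) = 2"
    and X: "X \<in> vector_fields C" "X \<noteq> zero_op C 1" and Y: "Y \<in> vector_fields C"
  shows "\<exists>g\<in>carrier (\<F> 1). Y = vf_smult C g X"
proof -
  have "\<exists>j. germ C 1 0 (vf_coords X j) \<noteq> \<zero>\<^bsub>\<F> 1\<^esub>"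
  proof (rule ccontr)
    assume neg: "\<not> ?thesis"
    have "X = zero_op C 1"
    proof (rule vector_field_eq_on_generators[OF X(1)])
      show "zero_op C 1 \<in> vector_fields C" unfolding vector_fields_def by (rule zero_op_derivation)
      show "X (germ C 1 0 (\<lambda>s. affine_vec s $ i)) = zero_op C 1 (germ C 1 0 (\<lambda>s. affine_vec s $ i))" for i
        using neg vf_coords(2)[OF X(1)] by (simp add: zero_op_def germ_closed affine_vec_reps)
    qed
    then show False using X(2) by blast
  qed
  then obtain j where "germ C 1 0 (vf_coords X j) \<noteq> \<zero>\<^bsub>\<F> 1\<^esub>" by blast
  then have nz: "\<forall>\<^sub>F s in generic C 1 0. vf_coords X j s \<noteq> 0"
    using germ_eq_zero_iff[OF vf_coords(1)[OF X(1)]] reps_zero_or_nonzero[OF vf_coords(1)[OF X(1)]] by blast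
  let ?G = "\<lambda>s. vf_coords Y j s * inverse (vf_coords X j s)"
  have G: "?G \<in> reps 1 0" by (intro reps_mult reps_inverse vf_coords X Y)
  have "Y = vf_smult C (germ C 1 0 ?G) X"
  proof (rule vector_field_eq_on_generators[OF Y vf_smult_vector_field[OF X(1) germ_closed[OF G]]])
    fix i
    have "\<forall>\<^sub>F s in generic C 1 0. vf_coords Y i s = ?G s * vf_coords X i s"
      using nz vf_coords_proportional[OF smooth X(1) Y, where i = i and j = j]
      by eventually_elim (simp add: field_simps)
    from germ_cong[OF vf_coords(1)[OF Y] this]
    have "germ C 1 0 (vf_coords Y i) = germ C 1 0 ?G \<otimes>\<^bsub>\<F> 1\<^esub> germ C 1 0 (vf_coords X i)"
      using germ_mult[OF G vf_coords(1)[OF X(1)]] by simp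
    then show "Y (germ C 1 0 (\<lambda>s. affine_vec s $ i)) =
        vf_smult C (germ C 1 0 ?G) X (germ C 1 0 (\<lambda>s. affine_vec s $ i))"
      using vf_coords(2)[OF X(1)] vf_coords(2)[OF Y] by (simp add: vf_smult_def germ_closed affine_vec_reps)
  qed
  then show ?thesis using germ_closed[OF G] by blast
qed

text \<open>Each argument of \<open>\<omega>\<close> is a multiple of \<open>X\<close>, and
  \<open>G\<close> is the product of the factors. The order of quantifiers matters: \<open>G\<close>
  depends on \<open>Y\<close> alone, so a relation between contractions carries over to the
  differentials.\<close>

lemma differential_eq_contract:
  assumes smooth: "\<forall>p\<in>C. \<forall>v\<in>hcoords p. vec.dim (cone_tangent C v) = 2"
    and X: "X \<in> vector_fields C" "X \<noteq> zero_op C 1" and Y: "Y \<in> {..<d} \<rightarrow>\<^sub>E vector_fields C"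
  shows "\<exists>G\<in>carrier (\<F> 1). \<forall>\<omega>\<in>rat_differentials C d.
    \<omega> Y = G \<otimes>\<^bsub>\<F> 1\<^esub> contract d X \<omega>"
proof -
  interpret F: cring "\<F> 1" by (rule cring_rat_field)
  have XX: "(\<lambda>i\<in>{..<d}. X) \<in> {..<d} \<rightarrow>\<^sub>E vector_fields C" using X by simp
  have cl: "\<omega> Z \<in> carrier (\<F> 1)"
    if "\<omega> \<in> rat_differentials C d" "Z \<in> {..<d} \<rightarrow>\<^sub>E vector_fields C" for \<omega> Z
    using that unfolding rat_differentials_def by blast
  have "\<exists>G\<in>carrier (\<F> 1). \<forall>\<omega>\<in>rat_differentials C d.
      \<omega> Z = G \<otimes>\<^bsub>\<F> 1\<^esub> contract d X \<omega>"
    if "m \<le> d" "Z \<in> {..<d} \<rightarrow>\<^sub>E vector_fields C" "\<forall>i\<in>{m..<d}. Z i = X" for m Z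
    using that
  \<comment> \<open>Induction on the number of leading arguments that may differ from
    \<open>X\<close>.\<close>
  proof (induction m arbitrary: Z)
    case 0
    have "Z i = (\<lambda>i\<in>{..<d}. X) i" for i
      using 0 by (cases "i < d") (auto simp: PiE_def extensional_def)
    then have "Z = (\<lambda>i\<in>{..<d}. X)" by (rule ext)
    then have "\<omega> Z = \<one>\<^bsub>\<F> 1\<^esub> \<otimes>\<^bsub>\<F> 1\<^esub> contract d X \<omega>"
      if "\<omega> \<in> rat_differentials C d" for \<omega>
      using cl[OF that XX] by (simp add: contract_def)
    then show ?case by blast
  next
    case (Suc m)
    let ?Z = "Z(m := X)"
    have m: "m < d" using Suc.prems(1) by simp
    have Z: "?Z \<in> {..<d} \<rightarrow>\<^sub>E vector_fields C"
      using Suc.prems(2) X(1) m by (auto simp: PiE_def extensional_def Pi_def)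
    moreover have "\<forall>i\<in>{m..<d}. ?Z i = X" using Suc.prems(3) by (auto simp: less_eq_Suc_le)
    ultimately obtain G where G: "G \<in> carrier (\<F> 1)"
      "\<And>\<omega>. \<omega> \<in> rat_differentials C d \<Longrightarrow> \<omega> ?Z = G \<otimes>\<^bsub>\<F> 1\<^esub> contract d X \<omega>"
      using Suc.IH[OF less_imp_le[OF m], of ?Z] by blast
    have "Z m \<in> vector_fields C" using Suc.prems(2) m by (auto dest: PiE_mem)
    then obtain g where g: "g \<in> carrier (\<F> 1)" "Z m = vf_smult C g X"
      using vector_field_multiple[OF smooth X] by blast
    have "\<omega> Z = (g \<otimes>\<^bsub>\<F> 1\<^esub> G) \<otimes>\<^bsub>\<F> 1\<^esub> contract d X \<omega>"
      if w: "\<omega> \<in> rat_differentials C d" for \<omega>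
    proof -
      have "Z = ?Z(m := vf_smult C g (?Z m))" by (simp add: g(2)[symmetric])
      moreover have "\<omega> (?Z(m := vf_smult C g (?Z m))) = g \<otimes>\<^bsub>\<F> 1\<^esub> \<omega> ?Z"
        using w Z m g(1) unfolding rat_differentials_def by blast
      ultimately have "\<omega> Z = g \<otimes>\<^bsub>\<F> 1\<^esub> \<omega> ?Z" by metis
      then show ?thesis using G(2)[OF w] g(1) G(1) cl[OF w XX] by (simp add: F.m_assoc contract_def)
    qed
    then show ?case using g(1) G(1) by blast
  qed
  from this[of d Y] show ?thesis using Y by simp
qed

lemma contract_closed:
  assumes "\<omega> \<in> rat_differentials C d" "X \<in> vector_fields C"
  shows "contract d X \<omega> \<in> carrier (\<F> 1)"
proof -
  have "(\<lambda>i\<in>{..<d}. X) \<in> {..<d} \<rightarrow>\<^sub>E vector_fields C" using assms(2) by simp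
  then show ?thesis using assms(1) unfolding rat_differentials_def contract_def by blast
qed

text \<open>A basis is given here by unique expansions. A relation between the contractions is a
  relation between the differentials, and adding it to the expansion of an element leaves the
  element unchanged; uniqueness then makes its coefficients zero.\<close>

lemma H0_basis_contract_independent:
  assumes smooth: "\<forall>p\<in>C. \<forall>v\<in>hcoords p. vec.dim (cone_tangent C v) = 2"
    and X: "X \<in> vector_fields C" "X \<noteq> zero_op C 1"
    and basis: "is_basis_H0 C d N \<omega>"
    and rel: "(\<Oplus>\<^bsub>\<F> 1\<^esub>i\<in>{..<N}. germ C 1 0 (\<lambda>_. c i) \<otimes>\<^bsub>\<F> 1\<^esub> contract d X (\<omega> i))
      = \<zero>\<^bsub>\<F> 1\<^esub>"
    and i: "i < N"
  shows "c i = 0"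
proof -
  interpret F: cring "\<F> 1" by (rule cring_rat_field)
  have w: "\<omega> j \<in> rat_differentials C d" if "j < N" for j
    using basis that by (simp add: is_basis_H0_def H0_def)
  have cf: "contract d X (\<omega> j) \<in> carrier (\<F> 1)" if "j < N" for j
    by (rule contract_closed[OF w[OF that] X(1)])
  have gc: "germ C 1 0 (\<lambda>_. a) \<in> carrier (\<F> 1)" for a by (rule germ_closed[OF reps_const])
  \<comment> \<open>Some section with an expansion is needed, and \<open>\<omega> i\<close> is
    one.\<close>
  have "\<omega> i \<in> H0 C d" using basis i by (simp add: is_basis_H0_def)
  then obtain a where a: "a \<in> {..<N} \<rightarrow>\<^sub>E UNIV" "\<omega> i = lincomb_diff C d N a \<omega>"
    and uniq: "\<And>a'. a' \<in> {..<N} \<rightarrow>\<^sub>E UNIV \<Longrightarrow> \<omega> i = lincomb_diff C d N a' \<omega> \<Longrightarrow> a' = a"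
    using basis unfolding is_basis_H0_def by metis
  let ?a = "\<lambda>j\<in>{..<N}. a j + c j"
  have "lincomb_diff C d N ?a \<omega> = lincomb_diff C d N a \<omega>"
    unfolding lincomb_diff_def
  proof (rule restrict_ext)
    fix Y assume Y: "Y \<in> {..<d} \<rightarrow>\<^sub>E vector_fields C"
    obtain G where G: "G \<in> carrier (\<F> 1)"
      "\<forall>\<omega>\<in>rat_differentials C d. \<omega> Y = G \<otimes>\<^bsub>\<F> 1\<^esub> contract d X \<omega>"
      using differential_eq_contract[OF smooth X Y] by blast
    have wY: "\<omega> j Y = G \<otimes>\<^bsub>\<F> 1\<^esub> contract d X (\<omega> j)" if "j < N" for j using G(2) w[OF that] by blast
    have summand: "germ C 1 0 (\<lambda>_. ?a j) \<otimes>\<^bsub>\<F> 1\<^esub> \<omega> j Y =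
        germ C 1 0 (\<lambda>_. a j) \<otimes>\<^bsub>\<F> 1\<^esub> \<omega> j Y \<oplus>\<^bsub>\<F> 1\<^esub>
        G \<otimes>\<^bsub>\<F> 1\<^esub> (germ C 1 0 (\<lambda>_. c j) \<otimes>\<^bsub>\<F> 1\<^esub> contract d X (\<omega> j))"
      if j: "j < N" for j
    proof -
      have "germ C 1 0 (\<lambda>_. ?a j) = germ C 1 0 (\<lambda>_. a j) \<oplus>\<^bsub>\<F> 1\<^esub> germ C 1 0 (\<lambda>_. c j)"
        using j by (simp add: germ_add reps_const)
      moreover have "(x \<oplus>\<^bsub>\<F> 1\<^esub> y) \<otimes>\<^bsub>\<F> 1\<^esub> (G \<otimes>\<^bsub>\<F> 1\<^esub> z) =
          x \<otimes>\<^bsub>\<F> 1\<^esub> (G \<otimes>\<^bsub>\<F> 1\<^esub> z) \<oplus>\<^bsub>\<F> 1\<^esub>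
          G \<otimes>\<^bsub>\<F> 1\<^esub> (y \<otimes>\<^bsub>\<F> 1\<^esub> z)"
        if "x \<in> carrier (\<F> 1)" "y \<in> carrier (\<F> 1)"
          "z \<in> carrier (\<F> 1)" for x y z
        using that G(1) by algebra
      ultimately show ?thesis
        unfolding wY[OF j] using cf[OF j] gc[of "a j"] gc[of "c j"] by simp
    qed
    have "(\<Oplus>\<^bsub>\<F> 1\<^esub>j\<in>{..<N}. germ C 1 0 (\<lambda>_. ?a j) \<otimes>\<^bsub>\<F> 1\<^esub> \<omega> j Y) =
      (\<Oplus>\<^bsub>\<F> 1\<^esub>j\<in>{..<N}. germ C 1 0 (\<lambda>_. a j) \<otimes>\<^bsub>\<F> 1\<^esub> \<omega> j Y \<oplus>\<^bsub>\<F> 1\<^esub>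
        G \<otimes>\<^bsub>\<F> 1\<^esub> (germ C 1 0 (\<lambda>_. c j) \<otimes>\<^bsub>\<F> 1\<^esub> contract d X (\<omega> j)))"
      by (rule F.finsum_cong') (use summand wY cf gc G(1) in auto)
    also have "\<dots> = (\<Oplus>\<^bsub>\<F> 1\<^esub>j\<in>{..<N}. germ C 1 0 (\<lambda>_. a j) \<otimes>\<^bsub>\<F> 1\<^esub> \<omega> j Y)
      \<oplus>\<^bsub>\<F> 1\<^esub> (\<Oplus>\<^bsub>\<F> 1\<^esub>j\<in>{..<N}.
        G \<otimes>\<^bsub>\<F> 1\<^esub> (germ C 1 0 (\<lambda>_. c j) \<otimes>\<^bsub>\<F> 1\<^esub> contract d X (\<omega> j)))"
      by (rule F.finsum_addf) (use wY cf gc G(1) in auto)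
    also have "(\<Oplus>\<^bsub>\<F> 1\<^esub>j\<in>{..<N}.
        G \<otimes>\<^bsub>\<F> 1\<^esub> (germ C 1 0 (\<lambda>_. c j) \<otimes>\<^bsub>\<F> 1\<^esub> contract d X (\<omega> j))) =
        G \<otimes>\<^bsub>\<F> 1\<^esub> \<zero>\<^bsub>\<F> 1\<^esub>"
      unfolding rel[symmetric] by (rule F.finsum_rdistr[symmetric]) (use cf gc G(1) in auto)
    finally show "(\<Oplus>\<^bsub>\<F> 1\<^esub>j\<in>{..<N}. germ C 1 0 (\<lambda>_. ?a j) \<otimes>\<^bsub>\<F> 1\<^esub> \<omega> j Y) =
        (\<Oplus>\<^bsub>\<F> 1\<^esub>j\<in>{..<N}. germ C 1 0 (\<lambda>_. a j) \<otimes>\<^bsub>\<F> 1\<^esub> \<omega> j Y)"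
      using G(1) wY cf gc by (simp add: F.finsum_closed)
  qed
  with a(2) have "\<omega> i = lincomb_diff C d N ?a \<omega>" by simp
  from uniq[OF _ this] have "?a = a" by simp
  from fun_cong[OF this, of i] show ?thesis using i by simp
qed

text \<open>Independence yields one tuple with nonzero determinant, and regularity there spreads the
  nonvanishing to generic points.\<close>

lemma independent_factor_det_nonzero:
  assumes F: "\<And>j. j < N \<Longrightarrow> F j \<in> reps 1 0"
    and indep: "\<And>c. \<forall>\<^sub>F s in generic C 1 0. (\<Sum>j<N. c j * F j s) = 0 \<Longrightarrow> \<forall>j<N. c j = 0"
  shows "\<forall>\<^sub>F z in generic C N 0. fun_det N (\<lambda>k j. F j (factor_point k z)) \<noteq> 0"
proof -
  \<comment> \<open>Tuples are sought among points where every \<open>F j\<close> is regular.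
    Generic points are such, so a relation holding on \<open>?G\<close> holds generically.\<close>
  let ?G = "{s. s \<in> points C 1 0 \<and> (\<forall>j\<in>{..<N}. regular_at C 1 0 s (F j))}"
  have "\<forall>\<^sub>F s in generic C 1 0. \<forall>j\<in>{..<N}. regular_at C 1 0 s (F j)"
    by (rule eventually_ball_finite) (use F in \<open>auto simp: reps_iff\<close>)
  then have G: "\<forall>\<^sub>F s in generic C 1 0. s \<in> ?G"
    using eventually_generic_points by eventually_elim simp
  have "\<exists>z. (\<forall>k<N. z k \<in> ?G) \<and> fun_det N (\<lambda>k j. F j (z k)) \<noteq> 0"
  proof (rule independent_functions_det)
    fix c assume c: "\<And>s. s \<in> ?G \<Longrightarrow> (\<Sum>j<N. c j * F j s) = 0"
    show "\<forall>j<N. c j = 0" by (rule indep) (use G c in \<open>rule eventually_mono\<close>)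
  qed
  then obtain z where z: "\<And>k. k < N \<Longrightarrow> z k \<in> ?G" "fun_det N (\<lambda>k j. F j (z k)) \<noteq> 0" by blast
  \<comment> \<open>The tuple of points of the curve is assembled into one point of the
    power.\<close>
  define x where "x = (\<lambda>k\<in>{..<N}. fst (z k) 0, \<lambda>j\<in>{..<0::nat}. 0 :: complex)"
  have x: "x \<in> points C N 0" using z(1) by (auto simp: x_def points_iff)
  have fx: "factor_point k x = z k" if k: "k < N" for k
  proof -
    obtain p where "z k = const_point p" using z(1)[OF k] points_curve by blast
    then show ?thesis using k by (simp add: factor_point_const x_def)
  qed
  have "regular_at C N 0 x (\<lambda>z. F j (factor_point k z))" if "k < N" "j < N" for k j
    by (rule factor_point_regular_at[OF that(1) x]) (use fx z(1) that in auto)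
  then have "regular_at C N 0 x (\<lambda>z. fun_det N (\<lambda>k j. F j (factor_point k z)))"
    unfolding fun_det_permutations
    by (intro regular_at_sum regular_at_mult regular_at_prod regular_at_const x)
      (auto dest: permutes_in_image)
  moreover have "fun_det N (\<lambda>k j. F j (factor_point k x)) \<noteq> 0"
    using z(2) fx fun_det_cong[of N "\<lambda>k j. F j (factor_point k x)" "\<lambda>k j. F j (z k)"] by simp
  ultimately show ?thesis by (rule regular_at_nonzero_eventually)
qed

end

section \<open>Commuting combinations of commuting operators\<close>

context cring
begin

lemma finsum_swap:
  assumes "finite I" "finite J" "\<And>i j. i \<in> I \<Longrightarrow> j \<in> J \<Longrightarrow> f i j \<in> carrier R"
  shows "(\<Oplus>i\<in>I. \<Oplus>j\<in>J. f i j) = (\<Oplus>j\<in>J. \<Oplus>i\<in>I. f i j)"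
  using assms(1,3)
proof (induction I rule: finite_induct)
  case empty
  then show ?case by (simp add: finsum_zero')
next
  case (insert i I)
  have cl: "(\<lambda>j. f i j) \<in> J \<rightarrow> carrier R" "(\<lambda>j. \<Oplus>i\<in>I. f i j) \<in> J \<rightarrow> carrier R"
    using insert.prems by (auto intro!: finsum_closed)
  have "(\<Oplus>i\<in>insert i I. \<Oplus>j\<in>J. f i j) = (\<Oplus>j\<in>J. f i j) \<oplus> (\<Oplus>j\<in>J. \<Oplus>i\<in>I. f i j)"
    using insert cl by (subst finsum_insert) (auto intro!: finsum_closed)
  also have "\<dots> = (\<Oplus>j\<in>J. f i j \<oplus> (\<Oplus>i\<in>I. f i j))"
    by (rule finsum_addf[symmetric, OF cl])
  also have "\<dots> = (\<Oplus>j\<in>J. \<Oplus>i\<in>insert i I. f i j)"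
  proof (rule finsum_cong')
    fix j assume "j \<in> J"
    then show "f i j \<oplus> (\<Oplus>i\<in>I. f i j) = (\<Oplus>i\<in>insert i I. f i j)"
      using insert by (subst finsum_insert) auto
  qed (use insert.prems insert.hyps in \<open>auto intro!: finsum_closed\<close>)
  finally show ?case .
qed

text \<open>Associativity in the form \<open>B (A y) = (B A) y\<close>, with the double sum
  exchanged.\<close>

lemma finsum_inverse_matrix:
  assumes A: "\<And>k j. k < (N::nat) \<Longrightarrow> j < N \<Longrightarrow> A k j \<in> carrier R"
    and B: "\<And>k j. k < N \<Longrightarrow> j < N \<Longrightarrow> B k j \<in> carrier R"
    and y: "\<And>j. j < N \<Longrightarrow> y j \<in> carrier R"
    and BA: "\<And>i j. i < N \<Longrightarrow> j < N \<Longrightarrow> (\<Oplus>k\<in>{..<N}. B i k \<otimes> A k j) = (if i = j then \<one> else \<zero>)"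
    and i: "i < N"
  shows "(\<Oplus>k\<in>{..<N}. B i k \<otimes> (\<Oplus>j\<in>{..<N}. A k j \<otimes> y j)) = y i"
proof -
  have "(\<Oplus>k\<in>{..<N}. B i k \<otimes> (\<Oplus>j\<in>{..<N}. A k j \<otimes> y j)) =
      (\<Oplus>k\<in>{..<N}. \<Oplus>j\<in>{..<N}. B i k \<otimes> A k j \<otimes> y j)"
    by (rule finsum_cong')
      (use A B y i in \<open>auto simp: finsum_rdistr m_assoc intro!: finsum_closed finsum_cong'\<close>)
  also have "\<dots> = (\<Oplus>j\<in>{..<N}. \<Oplus>k\<in>{..<N}. B i k \<otimes> A k j \<otimes> y j)"
    by (rule finsum_swap) (use A B y i in auto)
  also have "\<dots> = (\<Oplus>j\<in>{..<N}. if i = j then y j else \<zero>)"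
  proof (rule finsum_cong')
    fix j assume "j \<in> {..<N}"
    then have j: "j < N" by simp
    have "(\<Oplus>k\<in>{..<N}. B i k \<otimes> A k j \<otimes> y j) = (\<Oplus>k\<in>{..<N}. B i k \<otimes> A k j) \<otimes> y j"
      by (rule finsum_ldistr[symmetric]) (use A B y i j in auto)
    then show "(\<Oplus>k\<in>{..<N}. B i k \<otimes> A k j \<otimes> y j) = (if i = j then y j else \<zero>)"
      using BA[OF i j] y[OF j] by simp
  qed (use y in auto)
  also have "\<dots> = y i" by (rule finsum_singleton) (use y i in auto)
  finally show ?thesis .
qed

lemma finsum_matrix_cancel:
  assumes "\<And>k j. k < (N::nat) \<Longrightarrow> j < N \<Longrightarrow> A k j \<in> carrier R"
    and "\<And>k j. k < N \<Longrightarrow> j < N \<Longrightarrow> B k j \<in> carrier R"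
    and "\<And>i j. i < N \<Longrightarrow> j < N \<Longrightarrow> (\<Oplus>k\<in>{..<N}. B i k \<otimes> A k j) = (if i = j then \<one> else \<zero>)"
    and "\<And>j. j < N \<Longrightarrow> y j \<in> carrier R" "\<And>j. j < N \<Longrightarrow> y' j \<in> carrier R"
    and "\<And>k. k < N \<Longrightarrow> (\<Oplus>j\<in>{..<N}. A k j \<otimes> y j) = (\<Oplus>j\<in>{..<N}. A k j \<otimes> y' j)"
    and "i < N"
  shows "y i = y' i"
proof -
  have "(\<Oplus>k\<in>{..<N}. B i k \<otimes> (\<Oplus>j\<in>{..<N}. A k j \<otimes> y j)) =
      (\<Oplus>k\<in>{..<N}. B i k \<otimes> (\<Oplus>j\<in>{..<N}. A k j \<otimes> y' j))"
    by (rule finsum_cong') (use assms in \<open>auto intro!: finsum_closed\<close>)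
  then show ?thesis
    using finsum_inverse_matrix[of N A B y i, OF assms(1,2,4,3,7)]
      finsum_inverse_matrix[of N A B y' i, OF assms(1,2,5,3,7)] by simp
qed

text \<open>Write \<open>Q\<^sub>k = (\<Sum>i. A\<^sub>k\<^sub>i H\<^sub>i)\<close>.  As \<open>Q\<^sub>k\<close> commutes with \<open>A\<^sub>l\<^sub>j\<close> for \<open>l \<noteq> k\<close>, the equation
  \<open>Q\<^sub>k Q\<^sub>l = Q\<^sub>l Q\<^sub>k\<close> reads \<open>(\<Sum>i j. A\<^sub>k\<^sub>i A\<^sub>l\<^sub>j [H\<^sub>i, H\<^sub>j]) = 0\<close>, which is also true for \<open>k = l\<close> by
  antisymmetry; and \<open>A\<close> is invertible.\<close>

lemma separated_operators_commute:
  fixes N :: nat and Q H :: "nat \<Rightarrow> 'a \<Rightarrow> 'a"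
  assumes A: "\<And>k j. k < N \<Longrightarrow> j < N \<Longrightarrow> A k j \<in> carrier R"
    and B: "\<And>k j. k < N \<Longrightarrow> j < N \<Longrightarrow> B k j \<in> carrier R"
    and BA: "\<And>i j. i < N \<Longrightarrow> j < N \<Longrightarrow> (\<Oplus>k\<in>{..<N}. B i k \<otimes> A k j) = (if i = j then \<one> else \<zero>)"
    and AB: "\<And>i j. i < N \<Longrightarrow> j < N \<Longrightarrow> (\<Oplus>k\<in>{..<N}. A i k \<otimes> B k j) = (if i = j then \<one> else \<zero>)"
    and Q: "\<And>k g. k < N \<Longrightarrow> g \<in> carrier R \<Longrightarrow> Q k g \<in> carrier R"
    and Q_add: "\<And>k f g. k < N \<Longrightarrow> f \<in> carrier R \<Longrightarrow> g \<in> carrier R \<Longrightarrow> Q k (f \<oplus> g) = Q k f \<oplus> Q k g"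
    and Q_zero: "\<And>k. k < N \<Longrightarrow> Q k \<zero> = \<zero>"
    and Q_A: "\<And>k l j g. k < N \<Longrightarrow> l < N \<Longrightarrow> j < N \<Longrightarrow> k \<noteq> l \<Longrightarrow> g \<in> carrier R \<Longrightarrow>
      Q k (A l j \<otimes> g) = A l j \<otimes> Q k g"
    and Q_comm: "\<And>k l g. k < N \<Longrightarrow> l < N \<Longrightarrow> g \<in> carrier R \<Longrightarrow> Q k (Q l g) = Q l (Q k g)"
    and H: "\<And>i g. i < N \<Longrightarrow> g \<in> carrier R \<Longrightarrow> H i g = (\<Oplus>k\<in>{..<N}. B i k \<otimes> Q k g)"
    and ij: "i < N" "j < N" and g: "g \<in> carrier R"
  shows "H i (H j g) = H j (H i g)"
proof -
  have Hc: "H i g \<in> carrier R" if "i < N" "g \<in> carrier R" for i g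
    unfolding H[OF that] by (rule finsum_closed) (use B Q that in auto)
  have AH: "(\<Oplus>i\<in>{..<N}. A k i \<otimes> H i g) = Q k g" if k: "k < N" and g: "g \<in> carrier R" for k g
  proof -
    have "(\<Oplus>i\<in>{..<N}. A k i \<otimes> H i g) = (\<Oplus>i\<in>{..<N}. A k i \<otimes> (\<Oplus>l\<in>{..<N}. B i l \<otimes> Q l g))"
      by (rule finsum_cong') (use A Hc k g in \<open>auto simp: H[symmetric]\<close>)
    also have "\<dots> = Q k g"
      by (rule finsum_inverse_matrix[of N B A "\<lambda>l. Q l g" k]) (use A B AB Q k g in auto)
    finally show ?thesis .
  qed
  have Q_sum: "Q k (\<Oplus>j\<in>I. f j) = (\<Oplus>j\<in>I. Q k (f j))"
    if k: "k < N" and "finite I" and f: "\<And>j. j \<in> I \<Longrightarrow> f j \<in> carrier R" for k I f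
    using that(2,3)
  proof (induction I rule: finite_induct)
    case empty
    then show ?case by (simp add: Q_zero[OF k])
  next
    case (insert j I)
    then have "Q k (f j \<oplus> (\<Oplus>j\<in>I. f j)) = Q k (f j) \<oplus> Q k (\<Oplus>j\<in>I. f j)"
      by (intro Q_add[OF k] finsum_closed) auto
    then show ?case using insert Q[OF k] by (auto simp: Pi_def)
  qed
  have QQ: "Q k (Q l g) = (\<Oplus>j\<in>{..<N}. A l j \<otimes> (\<Oplus>i\<in>{..<N}. A k i \<otimes> H i (H j g)))"
    if k: "k < N" and l: "l < N" and kl: "k \<noteq> l" for k l
  proof -
    have "Q k (Q l g) = (\<Oplus>j\<in>{..<N}. Q k (A l j \<otimes> H j g))"
      unfolding AH[OF l g, symmetric] by (rule Q_sum[OF k]) (use A Hc l g in auto)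
    also have "\<dots> = (\<Oplus>j\<in>{..<N}. A l j \<otimes> (\<Oplus>i\<in>{..<N}. A k i \<otimes> H i (H j g)))"
      by (rule finsum_cong') (use A Hc Q k l g kl in \<open>auto simp: Q_A AH\<close>)
    finally show ?thesis .
  qed
  \<comment> \<open>\<open>?y\<close> and \<open>?y'\<close> differ in the order of the two
    operators; the aim is to cancel \<open>A\<close> twice.\<close>
  let ?y = "\<lambda>k j. \<Oplus>i\<in>{..<N}. A k i \<otimes> H i (H j g)"
  let ?y' = "\<lambda>k j. \<Oplus>i\<in>{..<N}. A k i \<otimes> H j (H i g)"
  have yc: "?y k j \<in> carrier R" "?y' k j \<in> carrier R" if "k < N" "j < N" for k j
    by (rule finsum_closed, use A Hc g that in auto)+
  \<comment> \<open>Only the order of summation and the names of the indices change.\<close>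
  have swap: "(\<Oplus>j\<in>{..<N}. A k j \<otimes> ?y l j) = (\<Oplus>j\<in>{..<N}. A l j \<otimes> ?y' k j)" if k: "k < N" and l: "l < N" for k l
  proof -
    have "(\<Oplus>j\<in>{..<N}. A k j \<otimes> ?y l j) = (\<Oplus>j\<in>{..<N}. \<Oplus>i\<in>{..<N}. A l i \<otimes> (A k j \<otimes> H i (H j g)))"
      by (rule finsum_cong')
        (use A Hc g k l in \<open>auto simp: finsum_rdistr m_lcomm intro!: finsum_closed finsum_cong'\<close>)
    also have "\<dots> = (\<Oplus>i\<in>{..<N}. \<Oplus>j\<in>{..<N}. A l i \<otimes> (A k j \<otimes> H i (H j g)))"
      by (rule finsum_swap) (use A Hc g k l in auto)
    also have "\<dots> = (\<Oplus>i\<in>{..<N}. A l i \<otimes> ?y' k i)"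
      by (rule finsum_cong')
        (use A Hc g k l in \<open>auto simp: finsum_rdistr intro!: finsum_closed finsum_cong'\<close>)
    finally show ?thesis .
  qed
  have eq: "(\<Oplus>j\<in>{..<N}. A l j \<otimes> ?y k j) = (\<Oplus>j\<in>{..<N}. A l j \<otimes> ?y' k j)" if k: "k < N" and l: "l < N" for k l
  proof (cases "k = l")
    case True
    then show ?thesis using swap[OF k l] by simp
  next
    case False
    then have "(\<Oplus>j\<in>{..<N}. A l j \<otimes> ?y k j) = (\<Oplus>j\<in>{..<N}. A k j \<otimes> ?y l j)"
      using QQ[OF k l] QQ[OF l k] Q_comm[OF k l g] by simp
    then show ?thesis using swap[OF k l] by simp
  qed
  \<comment> \<open>The sum over the second index is cancelled here, with \<open>l\<close> varying;
    the sum over the first index is cancelled last, with \<open>k\<close> varying.\<close>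
  have "?y k j = ?y' k j" if k: "k < N" for k
    by (rule finsum_matrix_cancel[of N A B "?y k" "?y' k" j]) (use A B BA yc eq k ij in auto)
  then show ?thesis
    by (intro finsum_matrix_cancel[of N A B "\<lambda>i. H i (H j g)" "\<lambda>i. H j (H i g)" i])
      (use A B BA Hc g ij in auto)
qed

end

section \<open>Independence of the monomials in commuting derivations\<close>

text \<open>\<open>t k\<close> is a function of the \<open>k\<close>-th variable only, with derivative \<open>u k\<close>; \<open>\<iota>\<close> is the
  canonical map from the natural numbers.\<close>

locale coordinate_derivations = field R for R (structure) +
  fixes N :: nat and D :: "nat \<Rightarrow> 'a \<Rightarrow> 'a" and t u :: "nat \<Rightarrow> 'a" and \<iota> :: "nat \<Rightarrow> 'a"
  assumes D_closed: "k < N \<Longrightarrow> f \<in> carrier R \<Longrightarrow> D k f \<in> carrier R"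
    and D_add: "k < N \<Longrightarrow> f \<in> carrier R \<Longrightarrow> g \<in> carrier R \<Longrightarrow> D k (f \<oplus> g) = D k f \<oplus> D k g"
    and D_mult: "k < N \<Longrightarrow> f \<in> carrier R \<Longrightarrow> g \<in> carrier R \<Longrightarrow> D k (f \<otimes> g) = D k f \<otimes> g \<oplus> f \<otimes> D k g"
    and t_closed: "k < N \<Longrightarrow> t k \<in> carrier R"
    and D_t: "k < N \<Longrightarrow> l < N \<Longrightarrow> D k (t l) = (if k = l then u k else \<zero>)"
    and u_nonzero: "k < N \<Longrightarrow> u k \<noteq> \<zero>"
    and \<iota>_closed: "\<iota> n \<in> carrier R" and \<iota>_0: "\<iota> 0 = \<zero>" and \<iota>_Suc: "\<iota> (Suc n) = \<iota> n \<oplus> \<one>"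
    and \<iota>_nonzero: "n > 0 \<Longrightarrow> \<iota> n \<noteq> \<zero>"
begin

text \<open>The commutator of \<open>T\<close> with multiplication by \<open>t k\<close>. On
  differential operators it lowers the order by one.\<close>

definition ad :: "nat \<Rightarrow> ('a \<Rightarrow> 'a) \<Rightarrow> 'a \<Rightarrow> 'a" where
  "ad k T g = T (t k \<otimes> g) \<ominus> t k \<otimes> T g"

primrec iter_ad :: "nat list \<Rightarrow> ('a \<Rightarrow> 'a) \<Rightarrow> 'a \<Rightarrow> 'a" where
  "iter_ad [] T = T"
| "iter_ad (k # v) T = iter_ad v (ad k T)"

text \<open>Words in place of exponents allow derivations to be peeled off one at a time; a monomial
  is recovered as the multiset of letters.\<close>

abbreviation word_op :: "nat list \<Rightarrow> 'a \<Rightarrow> 'a" where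
  "word_op w \<equiv> foldr D w"

definition endo :: "('a \<Rightarrow> 'a) \<Rightarrow> bool" where
  "endo T \<longleftrightarrow> (\<forall>g\<in>carrier R. T g \<in> carrier R)"

lemma u_closed: "k < N \<Longrightarrow> u k \<in> carrier R"
  using D_closed[of k "t k"] D_t[of k k] t_closed[of k] by simp

lemma D_zero: "k < N \<Longrightarrow> D k \<zero> = \<zero>"
  using D_add[of k \<zero> \<zero>] D_closed[of k \<zero>] by (simp add: add.l_cancel_one')

lemma D_minus: "k < N \<Longrightarrow> f \<in> carrier R \<Longrightarrow> D k (\<ominus> f) = \<ominus> D k f"
  using D_add[of k "\<ominus> f" f] D_closed[of k] D_zero[of k]
  by (intro minus_equality[symmetric]) (simp_all add: l_neg)

lemma word_op_endo: "set w \<subseteq> {..<N} \<Longrightarrow> endo (word_op w)"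
  by (induction w) (auto simp: endo_def D_closed)

lemma ad_endo: "k < N \<Longrightarrow> endo T \<Longrightarrow> endo (ad k T)"
  by (simp add: endo_def ad_def t_closed)

lemma iter_ad_endo: "set v \<subseteq> {..<N} \<Longrightarrow> endo T \<Longrightarrow> endo (iter_ad v T)"
  by (induction v arbitrary: T) (simp_all add: ad_endo)

lemma ad_cong:
  assumes "k < N" "\<And>g. g \<in> carrier R \<Longrightarrow> T g = S g" "g \<in> carrier R"
  shows "ad k T g = ad k S g"
  using assms by (simp add: ad_def t_closed)

lemma iter_ad_cong:
  assumes "set v \<subseteq> {..<N}" "\<And>g. g \<in> carrier R \<Longrightarrow> T g = S g" "g \<in> carrier R"
  shows "iter_ad v T g = iter_ad v S g"
  using assms
proof (induction v arbitrary: T S)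
  case (Cons k v)
  have "iter_ad v (ad k T) g = iter_ad v (ad k S) g"
    by (rule Cons.IH) (use Cons.prems ad_cong[of k T S] in auto)
  then show ?case by simp
qed simp

lemma iter_ad_add:
  assumes "set v \<subseteq> {..<N}" "endo T" "endo S" "g \<in> carrier R"
  shows "iter_ad v (\<lambda>g. T g \<oplus> S g) g = iter_ad v T g \<oplus> iter_ad v S g"
  using assms
proof (induction v arbitrary: T S)
  case (Cons k v)
  then have k: "k < N" by simp
  have "ad k (\<lambda>g. T g \<oplus> S g) h = ad k T h \<oplus> ad k S h" if h: "h \<in> carrier R" for h
  proof -
    have "T h \<in> carrier R" "S h \<in> carrier R" "T (t k \<otimes> h) \<in> carrier R" "S (t k \<otimes> h) \<in> carrier R"
      using Cons.prems k h by (auto simp: endo_def t_closed)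
    then show ?thesis unfolding ad_def using h t_closed[OF k] by algebra
  qed
  then have "iter_ad v (ad k (\<lambda>g. T g \<oplus> S g)) g = iter_ad v (\<lambda>g. ad k T g \<oplus> ad k S g) g"
    by (intro iter_ad_cong) (use Cons.prems in auto)
  also have "\<dots> = iter_ad v (ad k T) g \<oplus> iter_ad v (ad k S) g"
    by (rule Cons.IH) (use Cons.prems ad_endo k in auto)
  finally show ?case by simp
qed simp

lemma iter_ad_smult:
  assumes "set v \<subseteq> {..<N}" "endo T" "c \<in> carrier R" "g \<in> carrier R"
  shows "iter_ad v (\<lambda>g. c \<otimes> T g) g = c \<otimes> iter_ad v T g"
  using assms
proof (induction v arbitrary: T)
  case (Cons k v)
  then have k: "k < N" by simp
  have "ad k (\<lambda>g. c \<otimes> T g) h = c \<otimes> ad k T h" if h: "h \<in> carrier R" for h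
  proof -
    have "T h \<in> carrier R" "T (t k \<otimes> h) \<in> carrier R"
      using Cons.prems k h by (auto simp: endo_def t_closed)
    then show ?thesis unfolding ad_def using h t_closed[OF k] Cons.prems(3) by algebra
  qed
  then have "iter_ad v (ad k (\<lambda>g. c \<otimes> T g)) g = iter_ad v (\<lambda>g. c \<otimes> ad k T g) g"
    by (intro iter_ad_cong) (use Cons.prems in auto)
  also have "\<dots> = c \<otimes> iter_ad v (ad k T) g"
    by (rule Cons.IH) (use Cons.prems ad_endo k in auto)
  finally show ?case by simp
qed simp

lemma iter_ad_zero:
  assumes "set v \<subseteq> {..<N}" "g \<in> carrier R"
  shows "iter_ad v (\<lambda>_. \<zero>) g = \<zero>"
  using iter_ad_smult[OF assms(1), of "\<lambda>_. \<zero>" \<zero> g] assms iter_ad_endo[OF assms(1), of "\<lambda>_. \<zero>"]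
  by (simp add: endo_def)

lemma iter_ad_finsum:
  assumes "set v \<subseteq> {..<N}" "finite I" "\<And>i. i \<in> I \<Longrightarrow> endo (T i)" "g \<in> carrier R"
  shows "iter_ad v (\<lambda>g. \<Oplus>i\<in>I. T i g) g = (\<Oplus>i\<in>I. iter_ad v (T i) g)"
  using assms(2,3)
proof (induction I rule: finite_induct)
  case empty
  then show ?case by (simp add: iter_ad_zero assms)
next
  case (insert i I)
  have "(\<Oplus>i\<in>insert i I. T i h) = T i h \<oplus> (\<Oplus>i\<in>I. T i h)" if "h \<in> carrier R" for h
    by (rule finsum_insert) (use insert that in \<open>auto simp: endo_def\<close>)
  then have "iter_ad v (\<lambda>g. \<Oplus>i\<in>insert i I. T i g) g = iter_ad v (\<lambda>g. T i g \<oplus> (\<Oplus>i\<in>I. T i g)) g"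
    by (intro iter_ad_cong assms)
  also have "\<dots> = iter_ad v (T i) g \<oplus> iter_ad v (\<lambda>g. \<Oplus>i\<in>I. T i g) g"
    by (rule iter_ad_add) (use insert assms in \<open>auto simp: endo_def intro!: finsum_closed\<close>)
  also have "\<dots> = iter_ad v (T i) g \<oplus> (\<Oplus>i\<in>I. iter_ad v (T i) g)"
    using insert by simp
  also have "\<dots> = (\<Oplus>i\<in>insert i I. iter_ad v (T i) g)"
    by (rule finsum_insert[symmetric]) (use insert assms iter_ad_endo in \<open>auto simp: endo_def\<close>)
  finally show ?case .
qed

lemma ad_commute:
  assumes k: "k < N" and l: "l < N" and T: "endo T" and g: "g \<in> carrier R"
  shows "ad k (ad l T) g = ad l (ad k T) g"
proof -
  note c = g t_closed[OF k] t_closed[OF l]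
  have "T g \<in> carrier R" "T (t k \<otimes> g) \<in> carrier R" "T (t l \<otimes> g) \<in> carrier R"
    "T (t k \<otimes> (t l \<otimes> g)) \<in> carrier R" using T c by (auto simp: endo_def)
  moreover have "t l \<otimes> (t k \<otimes> g) = t k \<otimes> (t l \<otimes> g)" using c by (simp add: m_lcomm)
  ultimately show ?thesis unfolding ad_def using c by (simp, algebra)
qed

text \<open>Commutators with the various \<open>t\<close> can be taken in any order, multiplications
  being commutative, so one occurrence of \<open>l\<close> may come first.\<close>

lemma iter_ad_remove1:
  assumes "set v \<subseteq> {..<N}" "l \<in> set v" "endo T" "g \<in> carrier R"
  shows "iter_ad (remove1 l v) (ad l T) g = iter_ad v T g"
  using assms
proof (induction v arbitrary: T)
  case (Cons k v)
  then have k: "k < N" and v: "set v \<subseteq> {..<N}" by simp_all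
  show ?case
  proof (cases "k = l")
    case False
    then have l: "l < N" "l \<in> set v" using Cons.prems by auto
    have "iter_ad (remove1 l v) (ad k (ad l T)) g = iter_ad (remove1 l v) (ad l (ad k T)) g"
      by (rule iter_ad_cong) (use v set_remove1_subset ad_commute k l Cons.prems in fastforce)+
    also have "\<dots> = iter_ad v (ad k T) g"
      by (rule Cons.IH[OF v l(2)]) (use ad_endo k Cons.prems in auto)
    finally show ?thesis using False by simp
  qed simp
qed simp

text \<open>The Leibniz rule for commutators; the commutator of \<open>D l\<close> with
  \<open>t k\<close> is multiplication by \<open>D l (t k)\<close>.\<close>

lemma ad_D:
  assumes k: "k < N" and l: "l < N" and T: "endo T" and g: "g \<in> carrier R"
  shows "ad k (\<lambda>g. D l (T g)) g = D l (ad k T g) \<oplus> (if k = l then u l \<otimes> T g else \<zero>)"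
proof -
  note c = g t_closed[OF k] u_closed[OF l]
  have T1: "T g \<in> carrier R" "T (t k \<otimes> g) \<in> carrier R" using T c by (auto simp: endo_def)
  note T2 = D_closed[OF l T1(1)] D_closed[OF l T1(2)]
  let ?q = "if k = l then u l \<otimes> T g else \<zero>"
  have "D l (t k) = (if k = l then u l else \<zero>)" using D_t[OF l k] by auto
  then have "D l (t k) \<otimes> T g = ?q" using T1 by simp
  then have 1: "D l (ad k T g) = D l (T (t k \<otimes> g)) \<ominus> (?q \<oplus> t k \<otimes> D l (T g))"
    unfolding ad_def a_minus_def using c T1 by (simp add: D_add D_minus D_mult l)
  have "p \<ominus> r = p \<ominus> (q \<oplus> r) \<oplus> q" if "p \<in> carrier R" "q \<in> carrier R" "r \<in> carrier R" for p q r
    using that by algebra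
  from this[OF T2(2), of ?q "t k \<otimes> D l (T g)"] show ?thesis
    unfolding 1 using c T1 T2 by (simp add: ad_def)
qed

text \<open>Iterating the Leibniz rule, at most one occurrence of \<open>l\<close> in
  \<open>v\<close> is spent on \<open>D l\<close>, which turns it into multiplication by
  \<open>u l\<close>, and that commutes with the \<open>t\<close>. All occurrences give the same
  term, whence the multiplicity.\<close>

lemma iter_ad_D:
  assumes "set v \<subseteq> {..<N}" and l: "l < N" and "endo T" and g: "g \<in> carrier R"
  shows "iter_ad v (\<lambda>g. D l (T g)) g =
    D l (iter_ad v T g) \<oplus> \<iota> (count_list v l) \<otimes> (u l \<otimes> iter_ad (remove1 l v) T g)"
  using assms(1,3)
proof (induction v arbitrary: T)
  case Nil
  then show ?case using g l by (simp add: \<iota>_0 D_closed u_closed endo_def)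
next
  case (Cons k v)
  then have k: "k < N" and v: "set v \<subseteq> {..<N}" by simp_all
  have rv: "set (remove1 l v) \<subseteq> {..<N}" using v set_remove1_subset by fast
  have T: "endo T" "endo (ad k T)" "endo (\<lambda>g. D l (ad k T g))" "endo (\<lambda>g. if k = l then u l \<otimes> T g else \<zero>)"
    using Cons.prems ad_endo[OF k Cons.prems(2)] by (auto simp: endo_def D_closed l u_closed)
  define a where "a = D l (iter_ad v (ad k T) g)"
  define b where "b = iter_ad (remove1 l v) (ad k T) g"
  define c where "c = iter_ad v T g"
  have cl: "a \<in> carrier R" "b \<in> carrier R" "c \<in> carrier R" "u l \<in> carrier R"
    unfolding a_def b_def c_def
    using iter_ad_endo[OF v T(2)] iter_ad_endo[OF rv T(2)] iter_ad_endo[OF v T(1)] g l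
    by (auto simp: endo_def D_closed u_closed)
  have "iter_ad v (ad k (\<lambda>g. D l (T g))) g =
      iter_ad v (\<lambda>g. D l (ad k T g) \<oplus> (if k = l then u l \<otimes> T g else \<zero>)) g"
    by (rule iter_ad_cong[OF v _ g]) (rule ad_D[OF k l T(1)])
  also have "\<dots> = iter_ad v (\<lambda>g. D l (ad k T g)) g \<oplus> iter_ad v (\<lambda>g. if k = l then u l \<otimes> T g else \<zero>) g"
    by (rule iter_ad_add[OF v T(3,4) g])
  also have "iter_ad v (\<lambda>g. D l (ad k T g)) g = a \<oplus> \<iota> (count_list v l) \<otimes> (u l \<otimes> b)"
    unfolding a_def b_def by (rule Cons.IH[OF v T(2)])
  also have "iter_ad v (\<lambda>g. if k = l then u l \<otimes> T g else \<zero>) g = (if k = l then u l \<otimes> c else \<zero>)"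
    unfolding c_def using iter_ad_smult[OF v T(1) u_closed[OF l] g] iter_ad_zero[OF v g] by simp
  finally have main: "iter_ad (k # v) (\<lambda>g. D l (T g)) g =
      a \<oplus> \<iota> (count_list v l) \<otimes> (u l \<otimes> b) \<oplus> (if k = l then u l \<otimes> c else \<zero>)" by simp
  show ?case
  proof (cases "k = l")
    case False
    then show ?thesis using main cl \<iota>_closed by (simp add: a_def[symmetric] b_def[symmetric])
  next
    case True
    \<comment> \<open>Either \<open>l\<close> occurs in \<open>v\<close>, and taking that commutator
      earlier changes nothing, or the coefficient is \<open>0\<close>.\<close>
    have "\<iota> (count_list v l) \<otimes> (u l \<otimes> b) = \<iota> (count_list v l) \<otimes> (u l \<otimes> c)"
    proof (cases "l \<in> set v")
      case True
      then have "b = c" unfolding b_def c_def \<open>k = l\<close> by (intro iter_ad_remove1[OF v _ T(1) g])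
      then show ?thesis by simp
    next
      case False
      then show ?thesis using cl by (simp add: \<iota>_0)
    qed
    moreover have "\<iota> (count_list v l) \<in> carrier R" by (rule \<iota>_closed)
    ultimately have "iter_ad (k # v) (\<lambda>g. D l (T g)) g = a \<oplus> (\<iota> (count_list v l) \<oplus> \<one>) \<otimes> (u l \<otimes> c)"
      unfolding main using True cl by (simp add: l_distr a_assoc)
    then show ?thesis using True by (simp add: a_def c_def \<iota>_Suc flip: Suc_eq_plus1)
  qed
qed

text \<open>A word of length \<open>n\<close> has order at most \<open>n\<close>, and each
  commutator lowers the order by one.\<close>

lemma iter_ad_word_op_longer:
  assumes "set w \<subseteq> {..<N}" "set v \<subseteq> {..<N}" "length w < length v" "g \<in> carrier R"
  shows "iter_ad v (word_op w) g = \<zero>"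
  using assms
proof (induction w arbitrary: v g)
  case Nil
  then obtain k v' where v: "v = k # v'" by (cases v) auto
  then have "iter_ad v' (ad k (word_op [])) g = iter_ad v' (\<lambda>_. \<zero>) g"
    by (intro iter_ad_cong) (use Nil t_closed in \<open>auto simp: ad_def r_neg a_minus_def\<close>)
  then show ?case using v Nil iter_ad_zero by (simp add: id_def)
next
  case (Cons l w)
  then have l: "l < N" and w: "set w \<subseteq> {..<N}" by simp_all
  have *: "iter_ad v (word_op (l # w)) g =
    D l (iter_ad v (word_op w) g) \<oplus> \<iota> (count_list v l) \<otimes> (u l \<otimes> iter_ad (remove1 l v) (word_op w) g)"
    using iter_ad_D[OF Cons.prems(2) l word_op_endo[OF w] Cons.prems(4)] by (simp add: comp_def)
  have "iter_ad v (word_op w) g = \<zero>" by (rule Cons.IH) (use Cons.prems in auto)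
  moreover have "\<iota> (count_list v l) \<otimes> (u l \<otimes> iter_ad (remove1 l v) (word_op w) g) = \<zero>"
  proof (cases "l \<in> set v")
    case True
    have "iter_ad (remove1 l v) (word_op w) g = \<zero>"
      by (rule Cons.IH)
        (use Cons.prems True set_remove1_subset[of l v] in \<open>auto simp: length_remove1\<close>)
    then show ?thesis using u_closed[OF l] \<iota>_closed by simp
  next
    case False
    then have r: "remove1 l v = v" by (simp add: remove1_idem)
    show ?thesis using False iter_ad_endo[OF Cons.prems(2) word_op_endo[OF w]] u_closed[OF l] Cons.prems(4)
      by (simp add: \<iota>_0 r endo_def)
  qed
  ultimately show ?case unfolding * using D_zero[OF l] by simp
qed

text \<open>At full length every letter of \<open>w\<close> has to be spent on an equal letter of
  \<open>v\<close>. When the letters match, \<open>c\<close> is a product of multiplicities and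
  values of \<open>u\<close>, nonzero because of characteristic zero; otherwise a factor
  \<open>\<iota> 0\<close> appears.\<close>

lemma iter_ad_word_op:
  assumes "set w \<subseteq> {..<N}" "set v \<subseteq> {..<N}" "length w = length v"
  shows "\<exists>c\<in>carrier R. (c \<noteq> \<zero> \<longleftrightarrow> mset v = mset w) \<and> (\<forall>g\<in>carrier R. iter_ad v (word_op w) g = c \<otimes> g)"
  using assms
proof (induction w arbitrary: v)
  case Nil
  then show ?case by (intro bexI[of _ \<one>]) auto
next
  case (Cons l w)
  then have l: "l < N" and w: "set w \<subseteq> {..<N}" by simp_all
  have *: "iter_ad v (word_op (l # w)) g = \<iota> (count_list v l) \<otimes> (u l \<otimes> iter_ad (remove1 l v) (word_op w) g)"
    if g: "g \<in> carrier R" for g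
  proof -
    have r: "set (remove1 l v) \<subseteq> {..<N}" using Cons.prems(2) set_remove1_subset by fast
    have "iter_ad v (word_op w) g = \<zero>"
      by (rule iter_ad_word_op_longer) (use w Cons.prems g in auto)
    then show ?thesis
      using iter_ad_D[OF Cons.prems(2) l word_op_endo[OF w] g] D_zero[OF l] u_closed[OF l] \<iota>_closed
        iter_ad_endo[OF r word_op_endo[OF w]] g
      by (simp add: comp_def endo_def)
  qed
  show ?case
  proof (cases "l \<in> set v")
    case True
    have "\<exists>c\<in>carrier R. (c \<noteq> \<zero> \<longleftrightarrow> mset (remove1 l v) = mset w) \<and>
        (\<forall>g\<in>carrier R. iter_ad (remove1 l v) (word_op w) g = c \<otimes> g)"
      by (rule Cons.IH[OF w])
        (use Cons.prems True set_remove1_subset[of l v] in \<open>auto simp: length_remove1\<close>)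
    then obtain c where c: "c \<in> carrier R" "c \<noteq> \<zero> \<longleftrightarrow> mset (remove1 l v) = mset w"
      "\<And>g. g \<in> carrier R \<Longrightarrow> iter_ad (remove1 l v) (word_op w) g = c \<otimes> g" by blast
    have "mset v = mset (l # w) \<longleftrightarrow> mset (remove1 l v) = mset w"
      using True by (auto simp: insert_DiffM dest: arg_cong[of _ _ "add_mset l"])
    moreover have "count_list v l > 0" using True by (simp add: count_list_0_iff neq0_conv[symmetric] del: neq0_conv)
    then have "\<iota> (count_list v l) \<otimes> (u l \<otimes> c) \<noteq> \<zero> \<longleftrightarrow> c \<noteq> \<zero>"
      using c(1) u_closed[OF l] u_nonzero[OF l] \<iota>_closed \<iota>_nonzero by (simp add: integral_iff)
    moreover have "iter_ad v (word_op (l # w)) g = \<iota> (count_list v l) \<otimes> (u l \<otimes> c) \<otimes> g"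
      if g: "g \<in> carrier R" for g
      unfolding *[OF g] c(3)[OF g]
      using c(1) \<iota>_closed[of "count_list v l"] u_closed[OF l] g by (simp add: m_assoc)
    moreover have "\<iota> (count_list v l) \<otimes> (u l \<otimes> c) \<in> carrier R"
      using c(1) \<iota>_closed u_closed[OF l] by simp
    ultimately show ?thesis using c(2) by blast
  next
    case False
    then have r: "remove1 l v = v" by (simp add: remove1_idem)
    have "mset v \<noteq> mset (l # w)" using False by (metis list.set_intros(1) mset_eq_setD)
    moreover have "iter_ad v (word_op (l # w)) g = \<zero> \<otimes> g" if "g \<in> carrier R" for g
    proof -
      have "iter_ad v (word_op w) g \<in> carrier R"
        using iter_ad_endo[OF Cons.prems(2) word_op_endo[OF w]] that by (simp add: endo_def)
      then show ?thesis unfolding *[OF that] r using False u_closed[OF l] that by (simp add: \<iota>_0)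
    qed
    ultimately show ?thesis using zero_closed by blast
  qed
qed

text \<open>Commutators with the \<open>t k\<close> taken along a word of maximal length isolate its coefficient.\<close>

lemma word_ops_independent:
  assumes S: "finite S" and W: "\<And>\<alpha>. \<alpha> \<in> S \<Longrightarrow> set (W \<alpha>) \<subseteq> {..<N}"
    and inj: "inj_on (\<lambda>\<alpha>. mset (W \<alpha>)) S"
    and f: "\<And>\<alpha>. \<alpha> \<in> S \<Longrightarrow> f \<alpha> \<in> carrier R"
    and zero: "\<And>g. g \<in> carrier R \<Longrightarrow> (\<Oplus>\<alpha>\<in>S. f \<alpha> \<otimes> word_op (W \<alpha>) g) = \<zero>"
    and "\<alpha> \<in> S"
  shows "f \<alpha> = \<zero>"
proof (rule ccontr)
  assume "f \<alpha> \<noteq> \<zero>"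
  then have ne: "finite {\<alpha>\<in>S. f \<alpha> \<noteq> \<zero>}" "{\<alpha>\<in>S. f \<alpha> \<noteq> \<zero>} \<noteq> {}" using S \<open>\<alpha> \<in> S\<close> by auto
  define m where "m = Max ((\<lambda>\<alpha>. length (W \<alpha>)) ` {\<alpha>\<in>S. f \<alpha> \<noteq> \<zero>})"
  have "m \<in> (\<lambda>\<alpha>. length (W \<alpha>)) ` {\<alpha>\<in>S. f \<alpha> \<noteq> \<zero>}" unfolding m_def using ne by (intro Max_in) auto
  then obtain \<beta> where b: "\<beta> \<in> S" "f \<beta> \<noteq> \<zero>" "length (W \<beta>) = m" by auto
  have max: "length (W \<gamma>) \<le> length (W \<beta>)" if "\<gamma> \<in> S" "f \<gamma> \<noteq> \<zero>" for \<gamma>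
    unfolding b(3) m_def using ne that by (intro Max_ge) auto
  obtain c where c: "c \<in> carrier R" "c \<noteq> \<zero>" "\<And>g. g \<in> carrier R \<Longrightarrow> iter_ad (W \<beta>) (word_op (W \<beta>)) g = c \<otimes> g"
    using iter_ad_word_op[OF W[OF b(1)] W[OF b(1)] refl] by blast
  have endo: "endo (\<lambda>g. f \<gamma> \<otimes> word_op (W \<gamma>) g)" if "\<gamma> \<in> S" for \<gamma>
    using word_op_endo[OF W[OF that]] f[OF that] by (simp add: endo_def)
  have other: "iter_ad (W \<beta>) (\<lambda>g. f \<gamma> \<otimes> word_op (W \<gamma>) g) \<one> = (if \<beta> = \<gamma> then f \<gamma> \<otimes> c else \<zero>)"
    if g: "\<gamma> \<in> S" for \<gamma>
  proof -
    have "iter_ad (W \<beta>) (\<lambda>g. f \<gamma> \<otimes> word_op (W \<gamma>) g) \<one> = f \<gamma> \<otimes> iter_ad (W \<beta>) (word_op (W \<gamma>)) \<one>"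
      by (rule iter_ad_smult[OF W[OF b(1)] word_op_endo[OF W[OF g]] f[OF g] one_closed])
    also have "\<dots> = (if \<beta> = \<gamma> then f \<gamma> \<otimes> c else \<zero>)"
    proof (cases "\<beta> = \<gamma>")
      case True
      then show ?thesis using c by simp
    next
      case False
      have icl: "iter_ad (W \<beta>) (word_op (W \<gamma>)) \<one> \<in> carrier R"
        using iter_ad_endo[OF W[OF b(1)] word_op_endo[OF W[OF g]]] by (simp add: endo_def)
      \<comment> \<open>Longer words have zero coefficient by the choice of \<open>\<beta>\<close>;
        shorter ones are killed by too many commutators, and equally long ones by a mismatch of
        letters.\<close>
      consider "f \<gamma> = \<zero>" | "length (W \<gamma>) < length (W \<beta>)" | "length (W \<gamma>) = length (W \<beta>)"
        using max[OF g] by linarith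
      then show ?thesis
      proof cases
        case 1
        then show ?thesis using icl False by simp
      next
        case 2
        then show ?thesis
          using iter_ad_word_op_longer[OF W[OF g] W[OF b(1)] 2 one_closed] f[OF g] False by simp
      next
        case 3
        have "mset (W \<beta>) \<noteq> mset (W \<gamma>)" using inj_onD[OF inj _ b(1) g] False by blast
        then have "iter_ad (W \<beta>) (word_op (W \<gamma>)) \<one> = \<zero>"
          using iter_ad_word_op[OF W[OF g] W[OF b(1)] 3] by auto
        then show ?thesis using f[OF g] False by simp
      qed
    qed
    finally show ?thesis .
  qed
  \<comment> \<open>Evaluation at \<open>\<one>\<close> suffices, the surviving operator being a
    multiplication.\<close>
  have "\<zero> = iter_ad (W \<beta>) (\<lambda>g. \<Oplus>\<gamma>\<in>S. f \<gamma> \<otimes> word_op (W \<gamma>) g) \<one>"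
    using iter_ad_cong[OF W[OF b(1)] zero one_closed] iter_ad_zero[OF W[OF b(1)] one_closed] by simp
  also have "\<dots> = (\<Oplus>\<gamma>\<in>S. iter_ad (W \<beta>) (\<lambda>g. f \<gamma> \<otimes> word_op (W \<gamma>) g) \<one>)"
    by (rule iter_ad_finsum[OF W[OF b(1)] S endo one_closed])
  also have "\<dots> = (\<Oplus>\<gamma>\<in>S. if \<beta> = \<gamma> then f \<gamma> \<otimes> c else \<zero>)"
    by (rule finsum_cong') (use other f c(1) in auto)
  also have "\<dots> = f \<beta> \<otimes> c"
    by (rule finsum_singleton) (use S b(1) f c(1) in auto)
  finally show False using integral[of "f \<beta>" c] b(2) c(1,2) f[OF b(1)] by simp
qed

end

section \<open>Differential operators\<close>

definition index_word :: "nat \<Rightarrow> (nat \<Rightarrow> nat) \<Rightarrow> nat list" where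
  "index_word N \<alpha> = concat (map (\<lambda>k. replicate (\<alpha> k) k) [0..<N])"

lemma set_index_word: "set (index_word N \<alpha>) \<subseteq> {..<N}"
  by (auto simp: index_word_def split: if_splits)

lemma count_index_word: "k < N \<Longrightarrow> count (mset (index_word N \<alpha>)) k = \<alpha> k"
proof -
  have "count (mset (concat (map (\<lambda>k. replicate (\<alpha> k) k) ks))) k = (if k \<in> set ks then \<alpha> k else 0)"
    if "distinct ks" for ks
    using that by (induction ks) auto
  then show "k < N \<Longrightarrow> count (mset (index_word N \<alpha>)) k = \<alpha> k" by (simp add: index_word_def)
qed

lemma inj_index_word: "inj_on (\<lambda>\<alpha>. mset (index_word N \<alpha>)) (multi_indices N)"
proof (rule inj_onI)
  fix \<alpha> \<beta> assume ab: "\<alpha> \<in> multi_indices N" "\<beta> \<in> multi_indices N" and eq: "mset (index_word N \<alpha>) = mset (index_word N \<beta>)"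
  show "\<alpha> = \<beta>"
  proof (rule PiE_ext)
    show "\<alpha> \<in> {..<N} \<rightarrow>\<^sub>E UNIV" "\<beta> \<in> {..<N} \<rightarrow>\<^sub>E UNIV" using ab by (simp_all add: multi_indices_def)
    show "\<alpha> k = \<beta> k" if "k \<in> {..<N}" for k
      using count_index_word[of k N \<alpha>] count_index_word[of k N \<beta>] eq that by simp
  qed
qed

lemma foldr_funpow: "foldr (\<lambda>k. D k ^^ \<alpha> k) ks x = foldr D (concat (map (\<lambda>k. replicate (\<alpha> k) k) ks)) x"
proof -
  have "foldr D (replicate n k) y = (D k ^^ n) y" for n k y by (induction n) auto
  then show ?thesis by (induction ks) auto
qed

lemma vf_monomial_word: "vf_monomial C N X \<alpha> = foldr (vf_at C N X) (index_word N \<alpha>)"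
  unfolding vf_monomial_def index_word_def by (rule ext) (rule foldr_funpow)

definition pure_index :: "nat \<Rightarrow> nat \<Rightarrow> nat \<Rightarrow> nat \<Rightarrow> nat" where
  "pure_index N d k = (\<lambda>l\<in>{..<N}. if l = k then d else 0)"

lemma pure_index_multi: "pure_index N d k \<in> multi_indices N"
  by (simp add: pure_index_def multi_indices_def)

text \<open>Positivity of \<open>d\<close> is essential: for \<open>d = 0\<close> all these indices
  coincide.\<close>

lemma inj_pure_index: "d \<ge> 1 \<Longrightarrow> inj_on (pure_index N d) {..<N}"
proof (rule inj_onI)
  fix k l assume d: "d \<ge> 1" and k: "k \<in> {..<N}" and "l \<in> {..<N}" "pure_index N d k = pure_index N d l"
  from fun_cong[OF this(4), of k] d k show "k = l" by (auto simp: pure_index_def split: if_splits)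
qed

lemma sum_pure_index: "k < N \<Longrightarrow> (\<Sum>l<N. pure_index N d k l) = d"
proof -
  assume k: "k < N"
  have "(\<Sum>l<N. pure_index N d k l) = (\<Sum>l<N. if l = k then d else 0)"
    by (rule sum.cong) (auto simp: pure_index_def)
  then show ?thesis using k by simp
qed

lemma vf_monomial_pure_index:
  assumes "k < N"
  shows "vf_monomial C N X (pure_index N d k) \<phi> = (vf_at C N X k ^^ d) \<phi>"
proof -
  have "foldr (\<lambda>l. D l ^^ pure_index N d k l) ks \<phi> = (if k \<in> set ks then (D k ^^ d) \<phi> else \<phi>)"
    if "distinct ks" "set ks \<subseteq> {..<N}" for D :: "nat \<Rightarrow> 'b \<Rightarrow> 'b" and ks \<phi>
    using that by (induction ks) (auto simp: pure_index_def)
  from this[of "[0..<N]"] show ?thesis using assms unfolding vf_monomial_def by (simp add: subset_eq)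
qed

lemma (in abelian_group) minus_zero_imp_eq:
  assumes "x \<in> carrier G" "y \<in> carrier G" "x \<ominus> y = \<zero>"
  shows "x = y"
  using minus_equality[of x "\<ominus> y"] assms by (simp add: a_minus_def)

context irreducible_curve
begin

text \<open>A function on the curve is generically zero or generically nonzero, and either
  alternative pulls back to the power.\<close>

lemma at_var_zero_iff:
  assumes "k < N" "f \<in> carrier (\<F> 1)"
  shows "at_var C N k f = \<zero>\<^bsub>\<F> N\<^esub> \<longleftrightarrow> f = \<zero>\<^bsub>\<F> 1\<^esub>"
proof -
  obtain F where F: "F \<in> reps 1 0" "f = germ C 1 0 F" using assms(2) unfolding carrier_rat_field by blast
  show ?thesis
    unfolding F(2) at_var_germ[OF assms(1) F(1)] germ_eq_zero_iff[OF F(1)]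
      germ_eq_zero_iff[OF factor_point_reps[OF assms(1) F(1)]]
    using reps_zero_or_nonzero[OF F(1)] factor_point_eventually[OF assms(1), of "\<lambda>s. F s = 0"]
      factor_point_eventually[OF assms(1), of "\<lambda>s. F s \<noteq> 0"] generic_neq_bot[of N 0]
      eventually_conj[of "\<lambda>z. F (factor_point k z) = 0" "generic C N 0" "\<lambda>z. F (factor_point k z) \<noteq> 0"]
    by (auto dest: eventually_generic_ex)
qed

text \<open>Any function with nonzero derivative, placed in each variable, can serve as the family
  of coordinates. Positive integers are nonzero as germs of constants because the generic filter is
  proper.\<close>

lemma coordinate_derivations_vf_at:
  assumes X: "X \<in> vector_fields C" and f: "f \<in> carrier (\<F> 1)" "X f \<noteq> \<zero>\<^bsub>\<F> 1\<^esub>"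
  shows "coordinate_derivations (\<F> N) N (vf_at C N X)
    (\<lambda>k. at_var C N k f) (\<lambda>k. at_var C N k (X f)) (\<lambda>n. germ C N 0 (\<lambda>_. of_nat n))"
proof (intro coordinate_derivations.intro field_rat_field coordinate_derivations_axioms.intro)
  have Xf: "X f \<in> carrier (\<F> 1)" by (rule derivation_closed[OF X[unfolded vector_fields_def] f(1)])
  show "vf_at C N X k (at_var C N l f) = (if k = l then at_var C N k (X f) else \<zero>\<^bsub>\<F> N\<^esub>)"
    if "k < N" "l < N" for k l
    using vf_at_at_var[OF that X f(1)] by auto
  show "at_var C N k (X f) \<noteq> \<zero>\<^bsub>\<F> N\<^esub>" if "k < N" for k
    using at_var_zero_iff[OF that Xf] f(2) by simp
  show "germ C N 0 (\<lambda>_. of_nat (Suc n)) = germ C N 0 (\<lambda>_. of_nat n) \<oplus>\<^bsub>\<F> N\<^esub> \<one>\<^bsub>\<F> N\<^esub>" for n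
    by (simp add: one_rat_field germ_add reps_const add.commute)
  show "germ C N 0 (\<lambda>_. of_nat n) \<noteq> \<zero>\<^bsub>\<F> N\<^esub>" if "n > 0" for n
    using that generic_neq_bot[of N 0] by (simp add: germ_eq_zero_iff reps_const eventually_False)
qed (simp_all add: zero_rat_field germ_closed reps_const at_var_closed f(1)
    derivation_closed[OF vf_at_derivation[OF _ X]] derivation_add[OF vf_at_derivation[OF _ X]]
    derivation_mult[OF vf_at_derivation[OF _ X]])

lemma vector_field_nonzero_value:
  assumes "X \<in> vector_fields C" "X \<noteq> zero_op C 1"
  shows "\<exists>f\<in>carrier (\<F> 1). X f \<noteq> \<zero>\<^bsub>\<F> 1\<^esub>"
proof (rule ccontr)
  assume "\<not> ?thesis"
  then have "X f = zero_op C 1 f" for f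
    using assms(1) by (cases "f \<in> carrier (\<F> 1)")
      (auto simp: zero_op_def vector_fields_def derivations_def PiE_def extensional_def)
  then show False using assms(2) by blast
qed

lemma vf_monomial_closed:
  assumes X: "X \<in> vector_fields C" and g: "g \<in> carrier (\<F> N)"
  shows "vf_monomial C N X \<alpha> g \<in> carrier (\<F> N)"
proof -
  have "foldr (vf_at C N X) w g \<in> carrier (\<F> N)" if "set w \<subseteq> {..<N}" for w
    using that by (induction w) (auto intro: g derivation_closed[OF vf_at_derivation[OF _ X]])
  then show ?thesis unfolding vf_monomial_word using set_index_word by blast
qed

lemma coeff_families_closed:
  "f \<in> coeff_families C N \<Longrightarrow> \<alpha> \<in> multi_indices N \<Longrightarrow> f \<alpha> \<in> carrier (\<F> N)"
  unfolding coeff_families_def by (auto dest: PiE_mem)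

text \<open>Enlarging the index set allows operators with different supports to be compared term by
  term.\<close>

lemma diff_op_superset:
  assumes X: "X \<in> vector_fields C" and f: "f \<in> coeff_families C N"
    and S: "finite S" "coeff_support C N f \<subseteq> S" "S \<subseteq> multi_indices N" and g: "g \<in> carrier (\<F> N)"
  shows "diff_op C N X f g = (\<Oplus>\<^bsub>\<F> N\<^esub>\<alpha>\<in>S. f \<alpha> \<otimes>\<^bsub>\<F> N\<^esub> vf_monomial C N X \<alpha> g)"
proof -
  interpret F: cring "\<F> N" by (rule cring_rat_field)
  have "diff_op C N X f g = (\<Oplus>\<^bsub>\<F> N\<^esub>\<alpha>\<in>coeff_support C N f.
      f \<alpha> \<otimes>\<^bsub>\<F> N\<^esub> vf_monomial C N X \<alpha> g)"
    using g by (simp add: diff_op_def)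
  also have "\<dots> = (\<Oplus>\<^bsub>\<F> N\<^esub>\<alpha>\<in>S. f \<alpha> \<otimes>\<^bsub>\<F> N\<^esub> vf_monomial C N X \<alpha> g)"
  proof (rule F.add.finprod_mono_neutral_cong_left[OF S(1,2)])
    fix \<alpha> assume "\<alpha> \<in> S - coeff_support C N f"
    then have "f \<alpha> = \<zero>\<^bsub>\<F> N\<^esub>" using S(3) by (auto simp: coeff_support_def)
    then show "f \<alpha> \<otimes>\<^bsub>\<F> N\<^esub> vf_monomial C N X \<alpha> g = \<zero>\<^bsub>\<F> N\<^esub>"
      using vf_monomial_closed[OF X g] by simp
  qed (use vf_monomial_closed[OF X g] coeff_families_closed[OF f] S(3) in auto)
  finally show ?thesis .
qed

text \<open>The uniqueness behind \<open>do_coeffs\<close>: the differences of the coefficients form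
  a relation between monomials, and these are independent.\<close>

lemma diff_op_inj:
  assumes X: "X \<in> vector_fields C" "X \<noteq> zero_op C 1"
    and f: "f \<in> coeff_families C N" and f': "f' \<in> coeff_families C N"
    and eq: "diff_op C N X f = diff_op C N X f'"
  shows "f = f'"
proof -
  interpret F: cring "\<F> N" by (rule cring_rat_field)
  obtain h where h: "h \<in> carrier (\<F> 1)" "X h \<noteq> \<zero>\<^bsub>\<F> 1\<^esub>"
    using vector_field_nonzero_value[OF X] by blast
  interpret W: coordinate_derivations "\<F> N" N "vf_at C N X"
    "\<lambda>k. at_var C N k h" "\<lambda>k. at_var C N k (X h)" "\<lambda>n. germ C N 0 (\<lambda>_. of_nat n)"
    by (rule coordinate_derivations_vf_at[OF X(1) h])
  define S where "S = coeff_support C N f \<union> coeff_support C N f'"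
  have S: "finite S" "coeff_support C N f \<subseteq> S" "coeff_support C N f' \<subseteq> S" "S \<subseteq> multi_indices N"
    using f f' by (auto simp: S_def coeff_families_def coeff_support_def)
  note cl = coeff_families_closed[OF f] coeff_families_closed[OF f']
  have zero: "(\<Oplus>\<^bsub>\<F> N\<^esub>\<alpha>\<in>S. (f \<alpha> \<ominus>\<^bsub>\<F> N\<^esub> f' \<alpha>) \<otimes>\<^bsub>\<F> N\<^esub>
      foldr (vf_at C N X) (index_word N \<alpha>) g) = \<zero>\<^bsub>\<F> N\<^esub>"
    if g: "g \<in> carrier (\<F> N)" for g
  proof -
    note m = vf_monomial_closed[OF X(1) g, unfolded vf_monomial_word]
    let ?s = "\<lambda>f. \<Oplus>\<^bsub>\<F> N\<^esub>\<alpha>\<in>S. f \<alpha> \<otimes>\<^bsub>\<F> N\<^esub> foldr (vf_at C N X) (index_word N \<alpha>) g"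
    have "?s f = ?s f'"
      using diff_op_superset[OF X(1) f S(1,2,4) g] diff_op_superset[OF X(1) f' S(1,3,4) g] eq
      unfolding vf_monomial_word by simp
    moreover have "?s f = ?s f' \<oplus>\<^bsub>\<F> N\<^esub> ?s (\<lambda>\<alpha>. f \<alpha> \<ominus>\<^bsub>\<F> N\<^esub> f' \<alpha>)"
    proof -
      have *: "x \<otimes>\<^bsub>\<F> N\<^esub> z = y \<otimes>\<^bsub>\<F> N\<^esub> z \<oplus>\<^bsub>\<F> N\<^esub>
          (x \<ominus>\<^bsub>\<F> N\<^esub> y) \<otimes>\<^bsub>\<F> N\<^esub> z"
        if "x \<in> carrier (\<F> N)" "y \<in> carrier (\<F> N)"
          "z \<in> carrier (\<F> N)" for x y z
        using that by algebra
      have "?s f = (\<Oplus>\<^bsub>\<F> N\<^esub>\<alpha>\<in>S.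
          f' \<alpha> \<otimes>\<^bsub>\<F> N\<^esub> foldr (vf_at C N X) (index_word N \<alpha>) g \<oplus>\<^bsub>\<F> N\<^esub>
          (f \<alpha> \<ominus>\<^bsub>\<F> N\<^esub> f' \<alpha>) \<otimes>\<^bsub>\<F> N\<^esub> foldr (vf_at C N X) (index_word N \<alpha>) g)"
      proof (rule F.finsum_cong'[OF refl])
        show "f \<alpha> \<otimes>\<^bsub>\<F> N\<^esub> foldr (vf_at C N X) (index_word N \<alpha>) g =
            f' \<alpha> \<otimes>\<^bsub>\<F> N\<^esub> foldr (vf_at C N X) (index_word N \<alpha>) g \<oplus>\<^bsub>\<F> N\<^esub>
            (f \<alpha> \<ominus>\<^bsub>\<F> N\<^esub> f' \<alpha>) \<otimes>\<^bsub>\<F> N\<^esub> foldr (vf_at C N X) (index_word N \<alpha>) g"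
          if "\<alpha> \<in> S" for \<alpha>
          by (rule *[OF cl m]) (use that S(4) in auto)
      qed (use cl m S(4) in \<open>auto simp: subset_eq\<close>)
      also have "\<dots> = ?s f' \<oplus>\<^bsub>\<F> N\<^esub> ?s (\<lambda>\<alpha>. f \<alpha> \<ominus>\<^bsub>\<F> N\<^esub> f' \<alpha>)"
        by (rule F.finsum_addf) (use cl m S(4) in \<open>auto simp: subset_eq\<close>)
      finally show ?thesis .
    qed
    ultimately have eq: "?s f' = ?s f' \<oplus>\<^bsub>\<F> N\<^esub> ?s (\<lambda>\<alpha>. f \<alpha> \<ominus>\<^bsub>\<F> N\<^esub> f' \<alpha>)"
      by simp
    have "?s f' \<in> carrier (\<F> N)"
      "?s (\<lambda>\<alpha>. f \<alpha> \<ominus>\<^bsub>\<F> N\<^esub> f' \<alpha>) \<in> carrier (\<F> N)"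
      by (rule F.finsum_closed, use cl m S(4) in \<open>auto simp: subset_eq\<close>)+
    from F.add.l_cancel_one'[THEN iffD1, OF this eq] show ?thesis .
  qed
  show ?thesis
  proof (rule PiE_ext)
    show "f \<in> multi_indices N \<rightarrow>\<^sub>E carrier (\<F> N)"
      "f' \<in> multi_indices N \<rightarrow>\<^sub>E carrier (\<F> N)" using f f' by (simp_all add: coeff_families_def)
    fix \<alpha> assume a: "\<alpha> \<in> multi_indices N"
    show "f \<alpha> = f' \<alpha>"
    proof (cases "\<alpha> \<in> S")
      case True
      have "f \<alpha> \<ominus>\<^bsub>\<F> N\<^esub> f' \<alpha> = \<zero>\<^bsub>\<F> N\<^esub>"
        by (rule W.word_ops_independent[OF S(1) set_index_word inj_on_subset[OF inj_index_word S(4)] _ zero True])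
          (use cl S(4) in \<open>auto simp: subset_eq\<close>)
      then show ?thesis by (rule F.minus_zero_imp_eq[OF cl[OF a]])
    next
      case False
      then show ?thesis using a by (simp add: S_def coeff_support_def)
    qed
  qed
qed

lemma do_coeffs_diff_op:
  assumes "X \<in> vector_fields C" "X \<noteq> zero_op C 1" "f \<in> coeff_families C N"
  shows "do_coeffs C N X (diff_op C N X f) = f"
  unfolding do_coeffs_def by (rule the_equality) (use assms diff_op_inj[OF assms(1,2)] in auto)

section \<open>Operators in pure powers\<close>

text \<open>The coefficient family of \<open>\<Sum>k<N. b k X_k^d\<close>, an operator in which only
  powers of a single derivation occur in each term.\<close>

definition pure_coeffs :: "nat \<Rightarrow> nat \<Rightarrow> (nat \<Rightarrow> 'n ratfun) \<Rightarrow> (nat \<Rightarrow> nat) \<Rightarrow> 'n ratfun" where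
  "pure_coeffs N d b = (\<lambda>\<alpha>\<in>multi_indices N. if \<alpha> \<in> pure_index N d ` {..<N}
     then b (inv_into {..<N} (pure_index N d) \<alpha>) else \<zero>\<^bsub>\<F> N\<^esub>)"

lemma pure_coeffs_pure_index:
  "d \<ge> 1 \<Longrightarrow> k < N \<Longrightarrow> pure_coeffs N d b (pure_index N d k) = b k"
  by (simp add: pure_coeffs_def pure_index_multi inv_into_f_f[OF inj_pure_index])

lemma pure_coeffs_support:
  assumes "d \<ge> 1"
  shows "coeff_support C N (pure_coeffs N d b) = pure_index N d ` {k\<in>{..<N}. b k \<noteq> \<zero>\<^bsub>\<F> N\<^esub>}"
proof
  show "coeff_support C N (pure_coeffs N d b) \<subseteq> pure_index N d ` {k\<in>{..<N}. b k \<noteq> \<zero>\<^bsub>\<F> N\<^esub>}"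
  proof
    fix \<alpha> assume "\<alpha> \<in> coeff_support C N (pure_coeffs N d b)"
    then have a: "\<alpha> \<in> multi_indices N" "pure_coeffs N d b \<alpha> \<noteq> \<zero>\<^bsub>\<F> N\<^esub>"
      by (simp_all add: coeff_support_def)
    then obtain k where "k < N" "\<alpha> = pure_index N d k" by (auto simp: pure_coeffs_def split: if_splits)
    with a show "\<alpha> \<in> pure_index N d ` {k\<in>{..<N}. b k \<noteq> \<zero>\<^bsub>\<F> N\<^esub>}"
      using pure_coeffs_pure_index[OF assms] by auto
  qed
qed (auto simp: coeff_support_def pure_index_multi pure_coeffs_pure_index assms)

lemma pure_coeffs_family:
  assumes d: "d \<ge> 1" and b: "\<And>k. k < N \<Longrightarrow> b k \<in> carrier (\<F> N)"
  shows "pure_coeffs N d b \<in> coeff_families C N"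
proof -
  interpret F: cring "\<F> N" by (rule cring_rat_field)
  have "pure_coeffs N d b \<alpha> \<in> carrier (\<F> N)" if "\<alpha> \<in> multi_indices N" for \<alpha>
    using that b pure_coeffs_pure_index[OF d]
    by (cases "\<alpha> \<in> pure_index N d ` {..<N}") (auto simp: pure_coeffs_def inv_into_f_f[OF inj_pure_index[OF d]])
  then show ?thesis
    unfolding coeff_families_def using pure_coeffs_support[OF d]
    by (auto simp: pure_coeffs_def)
qed

lemma diff_op_pure_coeffs:
  assumes X: "X \<in> vector_fields C" and d: "d \<ge> 1"
    and b: "\<And>k. k < N \<Longrightarrow> b k \<in> carrier (\<F> N)" and g: "g \<in> carrier (\<F> N)"
  shows "diff_op C N X (pure_coeffs N d b) g =
    (\<Oplus>\<^bsub>\<F> N\<^esub>k\<in>{..<N}. b k \<otimes>\<^bsub>\<F> N\<^esub> (vf_at C N X k ^^ d) g)"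
proof -
  interpret F: cring "\<F> N" by (rule cring_rat_field)
  have m: "(vf_at C N X k ^^ d) g \<in> carrier (\<F> N)" if "k < N" for k
    using vf_monomial_closed[OF X g, of "pure_index N d k"] vf_monomial_pure_index[OF that] by metis
  have "diff_op C N X (pure_coeffs N d b) g = (\<Oplus>\<^bsub>\<F> N\<^esub>\<alpha>\<in>pure_index N d ` {..<N}.
      pure_coeffs N d b \<alpha> \<otimes>\<^bsub>\<F> N\<^esub> vf_monomial C N X \<alpha> g)"
    by (rule diff_op_superset[OF X pure_coeffs_family[OF d b] _ _ _ g])
      (auto simp: pure_coeffs_support[OF d] pure_index_multi)
  also have "\<dots> = (\<Oplus>\<^bsub>\<F> N\<^esub>k\<in>{..<N}. pure_coeffs N d b (pure_index N d k)
      \<otimes>\<^bsub>\<F> N\<^esub> vf_monomial C N X (pure_index N d k) g)"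
    by (rule F.finsum_reindex[OF _ inj_pure_index[OF d]])
      (auto simp: pure_coeffs_pure_index[OF d] b vf_monomial_closed[OF X g])
  also have "\<dots> = (\<Oplus>\<^bsub>\<F> N\<^esub>k\<in>{..<N}. b k \<otimes>\<^bsub>\<F> N\<^esub> (vf_at C N X k ^^ d) g)"
    by (rule F.finsum_cong') (auto simp: pure_coeffs_pure_index[OF d] vf_monomial_pure_index b m)
  finally show ?thesis .
qed

section \<open>Symbols of operators in pure powers\<close>

lemma multiforms_fibre_coord: "k < N \<Longrightarrow> (\<lambda>(v, \<xi>). \<xi> k) \<in> multiforms N' N (\<lambda>_. 0)"
  unfolding multiforms_def by (auto intro!: poly_funs.coord)

lemma fibre_coord_reps: "k < N \<Longrightarrow> (\<lambda>x. snd x k) \<in> reps N' N"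
proof -
  assume k: "k < N"
  obtain x where "x \<in> points C N' N" using points_nonempty by blast
  then have "regular_at C N' N x (\<lambda>x. snd x k)"
    by (intro regular_atI[OF multiforms_fibre_coord[OF k] multiforms_const[of 1]])
      (auto simp: nonvanishing_def case_prod_beta)
  then show ?thesis by (rule regular_at_reps)
qed

lemma fibre_coord_nonzero:
  assumes "k < N"
  shows "\<forall>\<^sub>F x in generic C N' N. snd x k \<noteq> 0"
proof -
  obtain x where x: "x \<in> points C N' N" using points_nonempty by blast
  let ?x = "(fst x, \<lambda>j\<in>{..<N}. 1)"
  have "?x \<in> points C N' N" using x by (simp add: points_iff)
  then have "?x \<in> nonvanishing C N' N (\<lambda>(v, \<xi>). \<xi> k)"
    using assms by (simp add: nonvanishing_iff[OF multiforms_fibre_coord] case_prod_beta)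
  then show ?thesis
    by (rule eventually_genericI[OF multiforms_fibre_coord[OF assms]])
      (simp add: nonvanishing_iff[OF multiforms_fibre_coord[OF assms]] case_prod_beta)
qed

lemma xi_germ: "xi C N k = germ C N N (\<lambda>x. snd x k)"
  by (simp add: xi_def case_prod_unfold)

lemma inv_xi:
  assumes "k < N"
  shows "inv\<^bsub>cone_field C N\<^esub> xi C N k = germ C N N (\<lambda>x. inverse (snd x k))"
proof -
  have "\<not> (\<forall>\<^sub>F x in generic C N N. snd x k = 0)"
  proof
    assume "\<forall>\<^sub>F x in generic C N N. snd x k = 0"
    from eventually_conj[OF this fibre_coord_nonzero[OF assms]] show False
      using eventually_generic_ex by fastforce
  qed
  then show ?thesis
    unfolding xi_germ by (intro germ_inv fibre_coord_reps assms) (simp add: germ_eq_zero_iff fibre_coord_reps assms)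
qed

text \<open>All nonzero coefficients have total degree \<open>d\<close>, and there is at least one,
  so the order is exactly \<open>d\<close> and no term is lost in passing to the symbol.\<close>

lemma symbol_pure_coeffs:
  assumes X: "X \<in> vector_fields C" "X \<noteq> zero_op C 1" and d: "d \<ge> 1"
    and b: "\<And>k. k < N \<Longrightarrow> b k \<in> reps N 0"
    and nz: "k < N" "germ C N 0 (b k) \<noteq> \<zero>\<^bsub>\<F> N\<^esub>"
  shows "symbol C N X (diff_op C N X (pure_coeffs N d (\<lambda>k. germ C N 0 (b k)))) =
    germ C N N (\<lambda>x. \<Sum>k<N. b k (drop_fibre x) * snd x k ^ d)"
proof -
  interpret F: cring "cone_field C N" by (rule cring_rat_field)
  let ?c = "pure_coeffs N d (\<lambda>k. germ C N 0 (b k))"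
  let ?D = "diff_op C N X ?c"
  have fam: "?c \<in> coeff_families C N" by (rule pure_coeffs_family[OF d germ_closed[OF b]])
  note co = do_coeffs_diff_op[OF X fam]
  note supp = pure_coeffs_support[OF d, of N "\<lambda>k. germ C N 0 (b k)"]
  have DO: "?D \<in> DO_rat C N X" unfolding DO_rat_def using fam by blast
  have ord: "do_order C N X ?D = d"
    unfolding do_order_def
  proof (rule Least_equality)
    have "?c \<alpha> = \<zero>\<^bsub>\<F> N\<^esub>" if "\<alpha> \<in> multi_indices N" "(\<Sum>k<N. \<alpha> k) > d" for \<alpha>
    proof (rule ccontr)
      assume "?c \<alpha> \<noteq> \<zero>\<^bsub>\<F> N\<^esub>"
      then have "\<alpha> \<in> coeff_support C N ?c" using that(1) by (simp add: coeff_support_def)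
      then show False using that(2) sum_pure_index unfolding supp by fastforce
    qed
    then show "?D \<in> Fil C N X d" unfolding Fil_def using DO co by simp
    fix m assume "?D \<in> Fil C N X m"
    \<comment> \<open>A nonzero coefficient of degree \<open>d\<close> keeps the operator out of
      every smaller filtration step.\<close>
    then have "\<not> m < (\<Sum>l<N. pure_index N d k l)"
      unfolding Fil_def using co nz pure_index_multi pure_coeffs_pure_index[OF d nz(1)] by auto
    then show "d \<le> m" using sum_pure_index[OF nz(1)] by simp
  qed
  have set_eq: "{\<alpha> \<in> coeff_support C N ?c. (\<Sum>k<N. \<alpha> k) = d} =
      pure_index N d ` {k\<in>{..<N}. germ C N 0 (b k) \<noteq> \<zero>\<^bsub>\<F> N\<^esub>}"
    unfolding supp by (auto simp: sum_pure_index)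
  let ?t = "\<lambda>k. germ C N N (\<lambda>x. b k (drop_fibre x) * snd x k ^ d)"
  have tr: "(\<lambda>x. b k (drop_fibre x) * snd x k ^ d) \<in> reps N N" if "k < N" for k
    by (intro reps_mult reps_power fibre_coord_reps drop_fibre_reps b that)
  have summand: "cone_incl C N (?c (pure_index N d k)) \<otimes>\<^bsub>cone_field C N\<^esub>
      (\<Otimes>\<^bsub>cone_field C N\<^esub>l\<in>{..<N}. xi C N l [^]\<^bsub>cone_field C N\<^esub> pure_index N d k l) = ?t k" if k: "k < N" for k
  proof -
    have "(\<Otimes>\<^bsub>cone_field C N\<^esub>l\<in>{..<N}. xi C N l [^]\<^bsub>cone_field C N\<^esub> pure_index N d k l) =
        (\<Otimes>\<^bsub>cone_field C N\<^esub>l\<in>{..<N}. germ C N N (\<lambda>x. snd x l ^ pure_index N d k l))"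
      by (rule F.finprod_cong') (auto simp: xi_germ germ_pow fibre_coord_reps intro!: germ_closed reps_power)
    also have "\<dots> = germ C N N (\<lambda>x. \<Prod>l<N. snd x l ^ pure_index N d k l)"
      by (rule germ_finprod) (auto intro: reps_power fibre_coord_reps)
    also have "(\<lambda>x. \<Prod>l<N. snd x l ^ pure_index N d k l) = (\<lambda>x :: 'n pt. snd x k ^ d)"
    proof
      fix x :: "'n pt"
      have "(\<Prod>l<N. snd x l ^ pure_index N d k l) = (\<Prod>l<N. if l = k then snd x k ^ d else 1)"
        by (rule prod.cong) (auto simp: pure_index_def)
      then show "(\<Prod>l<N. snd x l ^ pure_index N d k l) = snd x k ^ d" using k by simp
    qed
    finally show ?thesis
      using k by (simp add: pure_coeffs_pure_index[OF d] cone_incl_germ b germ_mult drop_fibre_reps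
          reps_power fibre_coord_reps)
  qed
  have "symbol C N X ?D = (\<Oplus>\<^bsub>cone_field C N\<^esub>\<alpha>\<in>pure_index N d `
      {k\<in>{..<N}. germ C N 0 (b k) \<noteq> \<zero>\<^bsub>\<F> N\<^esub>}.
      cone_incl C N (?c \<alpha>) \<otimes>\<^bsub>cone_field C N\<^esub>
      (\<Otimes>\<^bsub>cone_field C N\<^esub>l\<in>{..<N}. xi C N l [^]\<^bsub>cone_field C N\<^esub> \<alpha> l))"
    unfolding symbol_def Let_def co ord set_eq ..
  also have "\<dots> = (\<Oplus>\<^bsub>cone_field C N\<^esub>k\<in>{k\<in>{..<N}. germ C N 0 (b k) \<noteq> \<zero>\<^bsub>\<F> N\<^esub>}.
      cone_incl C N (?c (pure_index N d k)) \<otimes>\<^bsub>cone_field C N\<^esub>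
      (\<Otimes>\<^bsub>cone_field C N\<^esub>l\<in>{..<N}. xi C N l [^]\<^bsub>cone_field C N\<^esub> pure_index N d k l))"
    by (rule F.finsum_reindex[OF _ inj_on_subset[OF inj_pure_index[OF d]]])
      (auto simp: summand intro!: germ_closed tr)
  \<comment> \<open>Zero coefficients are put back so that the sum runs over all
    \<open>k\<close>.\<close>
  also have "\<dots> = (\<Oplus>\<^bsub>cone_field C N\<^esub>k\<in>{..<N}. ?t k)"
  proof (rule F.add.finprod_mono_neutral_cong_left)
    fix k assume "k \<in> {..<N} - {k\<in>{..<N}. germ C N 0 (b k) \<noteq> \<zero>\<^bsub>\<F> N\<^esub>}"
    then have k: "k < N" "\<forall>\<^sub>F z in generic C N 0. b k z = 0" using germ_eq_zero_iff[OF b] by auto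
    have "\<forall>\<^sub>F x in generic C N N. b k (drop_fibre x) * snd x k ^ d = 0"
      using drop_fibre_eventually[OF k(2)] by (rule eventually_mono) simp
    then show "?t k = \<zero>\<^bsub>cone_field C N\<^esub>" using germ_eq_zero_iff[OF tr[OF k(1)]] by simp
  qed (auto simp: summand intro!: germ_closed tr)
  also have "\<dots> = germ C N N (\<lambda>x. \<Sum>k<N. b k (drop_fibre x) * snd x k ^ d)"
    by (rule germ_finsum) (use tr in auto)
  finally show ?thesis .
qed

section \<open>The classical Hamiltonians\<close>

text \<open>\<open>place\<close> sums over the nonzero components, so there is a single term, or
  none at all when \<open>\<omega>\<close> is zero. In that case the right-hand side has to be shown
  to vanish too.\<close>

lemma place_homogeneous:
  assumes X: "X \<in> vector_fields C" and k: "k < N" and F: "F \<in> reps 1 0" "contract d X \<omega> = germ C 1 0 F"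
  shows "place C N X k (homogeneous_elt C d \<omega>) =
    germ C N N (\<lambda>x. F (factor_point k (drop_fibre x)) * inverse (snd x k) ^ d)"
proof -
  interpret F: cring "cone_field C N" by (rule cring_rat_field)
  have r: "(\<lambda>x. F (factor_point k (drop_fibre x)) * inverse (snd x k) ^ d) \<in> reps N N"
    by (intro reps_mult reps_power reps_inverse fibre_coord_reps k
        drop_fibre_reps[OF factor_point_reps[OF k F(1)]])
  have "cone_incl C N (at_var C N k (contract d X \<omega>)) \<otimes>\<^bsub>cone_field C N\<^esub>
      (inv\<^bsub>cone_field C N\<^esub> xi C N k) [^]\<^bsub>cone_field C N\<^esub> d =
      germ C N N (\<lambda>x. F (factor_point k (drop_fibre x)) * inverse (snd x k) ^ d)"
    by (simp add: F(2) at_var_germ k F(1) cone_incl_germ factor_point_reps inv_xi germ_pow reps_inverse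
        fibre_coord_reps germ_mult reps_power drop_fibre_reps[OF factor_point_reps[OF k F(1)]])
  moreover have "{i. homogeneous_elt C d \<omega> i \<noteq> zero_differential C i} =
      (if \<omega> = zero_differential C d then {} else {d})"
    by (auto simp: homogeneous_elt_def)
  moreover have "germ C N N (\<lambda>x. F (factor_point k (drop_fibre x)) * inverse (snd x k) ^ d) =
      \<zero>\<^bsub>cone_field C N\<^esub>" if "\<omega> = zero_differential C d"
  proof -
    have "contract d X \<omega> = \<zero>\<^bsub>\<F> 1\<^esub>"
      using X that by (simp add: contract_def zero_differential_def)
    then have "\<forall>\<^sub>F s in generic C 1 0. F s = 0" using germ_eq_zero_iff[OF F(1)] F(2) by simp
    from drop_fibre_eventually[OF factor_point_eventually[OF k this]]
    show ?thesis unfolding germ_eq_zero_iff[OF r] by (rule eventually_mono) simp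
  qed
  ultimately show ?thesis
    unfolding place_def by (simp add: homogeneous_elt_def germ_closed[OF r])
qed

text \<open>Variables index the rows and entries of the list the columns, which matches the
  permutation expansion of \<open>fun_det\<close> sign for sign.\<close>

lemma bracket_germ:
  assumes "length gs = N"
    and G: "\<And>k j. k < N \<Longrightarrow> j < N \<Longrightarrow> G k j \<in> reps N N"
      "\<And>k j. k < N \<Longrightarrow> j < N \<Longrightarrow> place C N X k (gs ! j) = germ C N N (G k j)"
  shows "bracket C X gs = germ C N N (\<lambda>x. fun_det N (\<lambda>k j. G k j x))"
proof -
  interpret F: cring "cone_field C N" by (rule cring_rat_field)
  have p: "\<sigma> k < N" if "\<sigma> permutes {..<N}" "k < N" for \<sigma> k
    using permutes_in_image[OF that(1), of k] that(2) by simp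
  have r: "(\<lambda>x. \<Prod>k<N. G k (\<sigma> k) x) \<in> reps N N" if "\<sigma> permutes {..<N}" for \<sigma>
    by (rule reps_prod) (use G(1) p[OF that] in auto)
  have summand: "germ C N N (\<lambda>_. of_int (sign \<sigma>)) \<otimes>\<^bsub>cone_field C N\<^esub>
      (\<Otimes>\<^bsub>cone_field C N\<^esub>k\<in>{..<N}. place C N X k (gs ! \<sigma> k)) =
      germ C N N (\<lambda>x. of_int (sign \<sigma>) * (\<Prod>k<N. G k (\<sigma> k) x))" if s: "\<sigma> permutes {..<N}" for \<sigma>
  proof -
    have "(\<Otimes>\<^bsub>cone_field C N\<^esub>k\<in>{..<N}. place C N X k (gs ! \<sigma> k)) =
        (\<Otimes>\<^bsub>cone_field C N\<^esub>k\<in>{..<N}. germ C N N (G k (\<sigma> k)))"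
      by (rule F.finprod_cong') (use G p[OF s] germ_closed in auto)
    also have "\<dots> = germ C N N (\<lambda>x. \<Prod>k<N. G k (\<sigma> k) x)"
      by (rule germ_finprod) (use G(1) p[OF s] in auto)
    finally show ?thesis using r[OF s] by (simp add: germ_mult reps_const)
  qed
  have "bracket C X gs = (\<Oplus>\<^bsub>cone_field C N\<^esub>\<sigma>\<in>{\<sigma>. \<sigma> permutes {..<N}}.
      germ C N N (\<lambda>x. of_int (sign \<sigma>) * (\<Prod>k<N. G k (\<sigma> k) x)))"
    unfolding bracket_def Let_def assms(1)
    by (rule F.finsum_cong') (auto simp: summand intro!: germ_closed reps_mult reps_const r)
  also have "\<dots> = germ C N N (\<lambda>x. \<Sum>\<sigma>\<in>{\<sigma>. \<sigma> permutes {..<N}}. of_int (sign \<sigma>) * (\<Prod>k<N. G k (\<sigma> k) x))"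
    by (rule germ_finsum) (auto intro: reps_mult reps_const r)
  finally show ?thesis unfolding fun_det_permutations .
qed

lemma fun_det_reps:
  assumes "\<And>k j. k < n \<Longrightarrow> j < n \<Longrightarrow> G k j \<in> reps N M"
  shows "(\<lambda>x. fun_det n (\<lambda>k j. G k j x)) \<in> reps N M"
  unfolding fun_det_permutations
proof (intro reps_sum reps_mult reps_const reps_prod)
  fix \<sigma> k assume "\<sigma> \<in> {\<sigma>. \<sigma> permutes {..<n}}" "k \<in> {..<n}"
  then show "G k (\<sigma> k) \<in> reps N M" using assms permutes_in_image[of \<sigma> "{..<n}" k] by simp
qed

lemma fun_cofactor_reps:
  assumes "\<And>k j. k < n \<Longrightarrow> j < n \<Longrightarrow> G k j \<in> reps N M" "k < n" "j < n"
  shows "(\<lambda>x. fun_cofactor n (\<lambda>k j. G k j x) k j) \<in> reps N M"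
  unfolding fun_cofactor_det[OF assms(2,3)]
  by (intro reps_mult reps_const fun_det_reps) (use assms in auto)

end

lemma fun_det_scale_rows:
  "fun_det n (\<lambda>k j. a k j * r k) = (\<Prod>k<n. r k) * fun_det n a"
  by (simp add: fun_det_permutations prod.distrib sum_distrib_left mult_ac)

context irreducible_curve
begin

text \<open>Row \<open>k\<close> of both determinants carries the factor \<open>\<xi>_k^{-d}\<close>
  outside the unit column, so Cramer's rule solves
  \<open>\<Sum>j. f_j(z_k) \<xi>_k^{-d} y_j = 1\<close>. Multiplied by \<open>\<xi>_k^d\<close> this
  is the system with right-hand side \<open>\<xi>_k^d\<close>, whose solution comes from the
  cofactors.\<close>

lemma H_class_germ:
  assumes X: "X \<in> vector_fields C" and F: "\<And>j. j < N \<Longrightarrow> F j \<in> reps 1 0"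
      "\<And>j. j < N \<Longrightarrow> contract d X (\<omega> j) = germ C 1 0 (F j)"
    and det: "\<forall>\<^sub>F z in generic C N 0. fun_det N (\<lambda>k j. F j (factor_point k z)) \<noteq> 0"
    and i: "i < N"
  shows "H_class C X d N \<omega> i = germ C N N (\<lambda>x. \<Sum>k<N.
    (-1) ^ i * fun_cofactor N (\<lambda>k j. F j (factor_point k (drop_fibre x))) k i *
      inverse (fun_det N (\<lambda>k j. F j (factor_point k (drop_fibre x)))) * snd x k ^ d)"
proof -
  define a where "a x k j = F j (factor_point k (drop_fibre x))" for x :: "'n pt" and k j
  define r where "r x k = inverse (snd x k) ^ d" for x :: "'n pt" and k :: nat
  \<comment> \<open>Column \<open>0\<close> is the unit, so column \<open>j\<close> carries the
    differential in position \<open>j - 1\<close> of the list that omits \<open>i\<close>.\<close>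
  define e where "e j = filter (\<lambda>j. j \<noteq> i) [0..<N] ! (j - 1)" for j
  let ?G = "\<lambda>k j x. a x k j * r x k"
  let ?G' = "\<lambda>k j x. if j = 0 then 1 else a x k (e j) * r x k"
  have ar: "(\<lambda>x. a x k j) \<in> reps N N" if "k < N" "j < N" for k j
    unfolding a_def using drop_fibre_reps[OF factor_point_reps[OF that(1) F(1)[OF that(2)]]] .
  have rr: "(\<lambda>x. r x k) \<in> reps N N" if "k < N" for k
    unfolding r_def by (intro reps_power reps_inverse fibre_coord_reps that)
  have G: "?G k j \<in> reps N N" if "k < N" "j < N" for k j
    by (intro reps_mult ar rr that)
  have len: "length (filter (\<lambda>j. j \<noteq> i) [0..<N]) = N - 1"
  proof -
    have "length (filter (\<lambda>j. j \<noteq> i) [0..<N]) = card ({..<N} - {i})"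
      by (subst distinct_card[symmetric]) (auto intro: arg_cong[of _ _ card])
    then show ?thesis using i by simp
  qed
  have e: "e j < N" if "0 < j" "j < N" for j
  proof -
    have "e j \<in> set (filter (\<lambda>j. j \<noteq> i) [0..<N])" unfolding e_def by (rule nth_mem) (use that len in simp)
    then show ?thesis by simp
  qed
  have G': "?G' k j \<in> reps N N" if "k < N" "j < N" for k j
    using ar[OF that(1) e] rr[OF that(1)] that by (cases "j = 0") (auto intro: reps_mult reps_const)
  have D0: "Delta0_class C X d N \<omega> = germ C N N (\<lambda>x. fun_det N (\<lambda>k j. ?G k j x))"
    unfolding Delta0_class_def
    by (rule bracket_germ[OF _ G]) (simp_all add: place_homogeneous[OF X _ F] a_def r_def)
  \<comment> \<open>The unit is placed as a differential of degree \<open>0\<close>, hence without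
    any factor \<open>\<xi>_k\<close>.\<close>
  have unit: "contract 0 X (\<lambda>Y \<in> {..<0} \<rightarrow>\<^sub>E vector_fields C. \<one>\<^bsub>\<F> 1\<^esub>) = germ C 1 0 (\<lambda>_. 1)"
    by (simp add: contract_def one_rat_field)
  have D: "Delta_class C X d N \<omega> i = germ C N N (\<lambda>x. fun_det N (\<lambda>k j. ?G' k j x))"
    unfolding Delta_class_def
  proof (rule bracket_germ[OF _ G'])
    show "length (unit_elt C # map (\<lambda>j. homogeneous_elt C d (\<omega> j)) (filter (\<lambda>j. j \<noteq> i) [0..<N])) = N"
      using len i by simp
    fix k j assume kj: "k < N" "j < N"
    show "place C N X k ((unit_elt C # map (\<lambda>j. homogeneous_elt C d (\<omega> j)) (filter (\<lambda>j. j \<noteq> i) [0..<N])) ! j) =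
        germ C N N (?G' k j)"
    proof (cases "j = 0")
      case True
      then show ?thesis
        using place_homogeneous[OF X kj(1) reps_const unit] by (simp add: unit_elt_def)
    next
      case False
      then have "(unit_elt C # map (\<lambda>j. homogeneous_elt C d (\<omega> j)) (filter (\<lambda>j. j \<noteq> i) [0..<N])) ! j =
          homogeneous_elt C d (\<omega> (e j))"
        using kj len by (simp add: nth_Cons' e_def)
      then show ?thesis
        using False place_homogeneous[OF X kj(1) F(1)[OF e] F(2)[OF e]] kj by (simp add: a_def r_def)
    qed
  qed
  have gen: "\<forall>\<^sub>F x in generic C N N. fun_det N (a x) \<noteq> 0 \<and> (\<forall>k\<in>{..<N}. snd x k \<noteq> 0)"
  proof (rule eventually_conj)
    show "\<forall>\<^sub>F x in generic C N N. fun_det N (a x) \<noteq> 0"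
      using drop_fibre_eventually[OF det] by (simp add: a_def[abs_def])
    show "\<forall>\<^sub>F x in generic C N N. \<forall>k\<in>{..<N}. snd x k \<noteq> 0"
      by (rule eventually_ball_finite) (auto intro: fibre_coord_nonzero)
  qed
  have nz: "fun_det N (\<lambda>k j. ?G k j x) \<noteq> 0" if "fun_det N (a x) \<noteq> 0 \<and> (\<forall>k\<in>{..<N}. snd x k \<noteq> 0)" for x
    unfolding fun_det_scale_rows using that by (simp add: r_def)
  have dr: "(\<lambda>x. fun_det N (\<lambda>k j. ?G k j x)) \<in> reps N N" "(\<lambda>x. fun_det N (\<lambda>k j. ?G' k j x)) \<in> reps N N"
    by (rule fun_det_reps, use G G' in blast)+
  have "germ C N N (\<lambda>x. fun_det N (\<lambda>k j. ?G k j x)) \<noteq> \<zero>\<^bsub>cone_field C N\<^esub>"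
  proof
    assume "germ C N N (\<lambda>x. fun_det N (\<lambda>k j. ?G k j x)) = \<zero>\<^bsub>cone_field C N\<^esub>"
    then have "\<forall>\<^sub>F x in generic C N N. fun_det N (\<lambda>k j. ?G k j x) = 0" using germ_eq_zero_iff[OF dr(1)] by simp
    from eventually_conj[OF this gen] show False using nz eventually_generic_ex by blast
  qed
  then have "H_class C X d N \<omega> i =
      germ C N N (\<lambda>x. fun_det N (\<lambda>k j. ?G' k j x) * inverse (fun_det N (\<lambda>k j. ?G k j x)))"
    unfolding H_class_def D0 D using dr by (simp add: germ_inv germ_mult reps_inverse)
  also have "\<dots> = germ C N N (\<lambda>x. \<Sum>k<N. (-1) ^ i * fun_cofactor N (a x) k i * inverse (fun_det N (a x)) * snd x k ^ d)"
  proof (rule germ_cong)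
    show "(\<lambda>x. fun_det N (\<lambda>k j. ?G' k j x) * inverse (fun_det N (\<lambda>k j. ?G k j x))) \<in> reps N N"
      by (intro reps_mult reps_inverse dr)
    show "\<forall>\<^sub>F x in generic C N N. fun_det N (\<lambda>k j. ?G' k j x) * inverse (fun_det N (\<lambda>k j. ?G k j x)) =
        (\<Sum>k<N. (-1) ^ i * fun_cofactor N (a x) k i * inverse (fun_det N (a x)) * snd x k ^ d)"
      using gen
    proof eventually_elim
      case (elim x)
      \<comment> \<open>The cofactor solution of
        \<open>\<Sum>j. a x k j y_j = \<xi>_k^d\<close>.\<close>
      define y where "y j = (\<Sum>l<N. fun_cofactor N (a x) l j * inverse (fun_det N (a x)) * snd x l ^ d)" for j
      have "(\<Sum>j<N. (a x k j * r x k) * y j) = 1" if k: "k < N" for k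
      proof -
        have "(\<Sum>j<N. (a x k j * r x k) * y j) = (\<Sum>j<N. \<Sum>l<N. (a x k j * fun_cofactor N (a x) l j) *
            (inverse (fun_det N (a x)) * snd x l ^ d * r x k))"
          unfolding y_def sum_distrib_left by (simp add: mult_ac)
        also have "\<dots> = (\<Sum>l<N. (\<Sum>j<N. a x k j * fun_cofactor N (a x) l j) *
            (inverse (fun_det N (a x)) * snd x l ^ d * r x k))"
          by (subst sum.swap) (simp add: sum_distrib_right)
        also have "\<dots> = (\<Sum>l<N. if l = k then 1 else 0)"
          by (rule sum.cong) (use elim k in \<open>auto simp: fun_mat_mult_cofactor r_def field_simps\<close>)
        finally show ?thesis using k by simp
      qed
      from fun_det_unit_column[OF i this]
      have "fun_det N (\<lambda>k j. ?G' k j x) = (-1) ^ i * y i * fun_det N (\<lambda>k j. ?G k j x)"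
        unfolding e_def .
      then have "fun_det N (\<lambda>k j. ?G' k j x) * inverse (fun_det N (\<lambda>k j. ?G k j x)) = (-1) ^ i * y i"
        using nz[OF elim] by simp
      then show ?case by (simp add: y_def sum_distrib_left mult.assoc)
    qed
  qed
  finally show ?thesis by (simp add: a_def[abs_def])
qed

section \<open>Powers of the lifted vector field and the quantized Hamiltonians\<close>

lemma funpow_vf_at:
  assumes X: "X \<in> vector_fields C" and k: "k < N"
  shows "g \<in> carrier (\<F> N) \<Longrightarrow> (vf_at C N X k ^^ n) g \<in> carrier (\<F> N)"
    and "f \<in> carrier (\<F> N) \<Longrightarrow> g \<in> carrier (\<F> N) \<Longrightarrow>
      (vf_at C N X k ^^ n) (f \<oplus>\<^bsub>\<F> N\<^esub> g) =
      (vf_at C N X k ^^ n) f \<oplus>\<^bsub>\<F> N\<^esub> (vf_at C N X k ^^ n) g"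
    and "(vf_at C N X k ^^ n) \<zero>\<^bsub>\<F> N\<^esub> = \<zero>\<^bsub>\<F> N\<^esub>"
    and "l < N \<Longrightarrow> k \<noteq> l \<Longrightarrow> h \<in> carrier (\<F> 1) \<Longrightarrow> g \<in> carrier (\<F> N) \<Longrightarrow>
      (vf_at C N X k ^^ n) (at_var C N l h \<otimes>\<^bsub>\<F> N\<^esub> g) =
      at_var C N l h \<otimes>\<^bsub>\<F> N\<^esub> (vf_at C N X k ^^ n) g"
proof -
  interpret F: cring "\<F> N" by (rule cring_rat_field)
  note D = vf_at_derivation[OF k X]
  show cl: "(vf_at C N X k ^^ n) g \<in> carrier (\<F> N)"
    if "g \<in> carrier (\<F> N)" for g n
    by (induction n) (simp_all add: that derivation_closed[OF D])
  show "f \<in> carrier (\<F> N) \<Longrightarrow> g \<in> carrier (\<F> N) \<Longrightarrow>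
      (vf_at C N X k ^^ n) (f \<oplus>\<^bsub>\<F> N\<^esub> g) =
      (vf_at C N X k ^^ n) f \<oplus>\<^bsub>\<F> N\<^esub> (vf_at C N X k ^^ n) g"
    by (induction n) (simp_all add: derivation_add[OF D] cl)
  show "(vf_at C N X k ^^ n) \<zero>\<^bsub>\<F> N\<^esub> = \<zero>\<^bsub>\<F> N\<^esub>"
    by (induction n) (simp_all add: derivation_zero[OF D])
  show "(vf_at C N X k ^^ n) (at_var C N l h \<otimes>\<^bsub>\<F> N\<^esub> g) =
      at_var C N l h \<otimes>\<^bsub>\<F> N\<^esub> (vf_at C N X k ^^ n) g"
    if l: "l < N" "k \<noteq> l" and h: "h \<in> carrier (\<F> 1)" and g: "g \<in> carrier (\<F> N)"
  proof (induction n)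
    case (Suc n)
    have "vf_at C N X k (at_var C N l h) = \<zero>\<^bsub>\<F> N\<^esub>"
      using vf_at_at_var[OF k l(1) X h] l(2) by simp
    then show ?case
      using Suc derivation_mult[OF D at_var_closed[OF l(1) h] cl[OF g]]
        at_var_closed[OF l(1) h] cl[OF g] derivation_closed[OF D cl[OF g]] by simp
  qed simp
qed

lemma funpow_vf_at_commute:
  assumes X: "X \<in> vector_fields C" and k: "k < N" and l: "l < N" and g: "g \<in> carrier (\<F> N)"
  shows "(vf_at C N X k ^^ m) ((vf_at C N X l ^^ n) g) = (vf_at C N X l ^^ n) ((vf_at C N X k ^^ m) g)"
proof -
  note clk = funpow_vf_at(1)[OF X k] and cll = funpow_vf_at(1)[OF X l]
  have one: "vf_at C N X k ((vf_at C N X l ^^ n) g) = (vf_at C N X l ^^ n) (vf_at C N X k g)"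
    if g: "g \<in> carrier (\<F> N)" for g
    by (induction n) (simp_all add: vf_at_commute[OF k l X cll[OF g]])
  show ?thesis
    by (induction m) (simp_all add: one clk g)
qed

lemma quantized_hamiltonians_exist:
  assumes smooth: "\<forall>p\<in>C. \<forall>v\<in>hcoords p. vec.dim (cone_tangent C v) = 2"
    and d: "d \<ge> 1" and basis: "is_basis_H0 C d N \<omega>"
    and X: "X \<in> vector_fields C" "X \<noteq> zero_op C 1"
  shows "\<exists>H. (\<forall>i<N. H i \<in> DO_rat C N X) \<and>
    (\<forall>i<N. \<forall>j<N. op_comp C N (H i) (H j) = op_comp C N (H j) (H i)) \<and>
    (\<forall>i<N. H i \<noteq> zero_op C N \<and> symbol C N X (H i) = H_class C X d N \<omega> i)"
proof -
  interpret F: cring "\<F> N" by (rule cring_rat_field)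
  have "\<forall>j. \<exists>F. j < N \<longrightarrow> F \<in> reps 1 0 \<and> contract d X (\<omega> j) = germ C 1 0 F"
  proof (intro allI)
    fix j
    have "\<omega> j \<in> rat_differentials C d" if "j < N"
      using basis that by (simp add: is_basis_H0_def H0_def)
    then show "\<exists>F. j < N \<longrightarrow> F \<in> reps 1 0 \<and> contract d X (\<omega> j) = germ C 1 0 F"
      using contract_closed[OF _ X(1)] unfolding carrier_rat_field by blast
  qed
  then obtain Fr where Fr: "\<And>j. j < N \<Longrightarrow> Fr j \<in> reps 1 0"
    "\<And>j. j < N \<Longrightarrow> contract d X (\<omega> j) = germ C 1 0 (Fr j)" by metis
  define a where "a z k j = Fr j (factor_point k z)" for z :: "'n pt" and k j
  have ar: "(\<lambda>z. a z k j) \<in> reps N 0" if "k < N" "j < N" for k j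
    unfolding a_def by (rule factor_point_reps[OF that(1) Fr(1)[OF that(2)]])
  have det: "\<forall>\<^sub>F z in generic C N 0. fun_det N (a z) \<noteq> 0"
    unfolding a_def
  proof (rule independent_factor_det_nonzero[OF Fr(1)])
    fix c assume c: "\<forall>\<^sub>F s in generic C 1 0. (\<Sum>j<N. c j * Fr j s) = 0"
    have cr: "(\<lambda>s. c j * Fr j s) \<in> reps 1 0" if "j < N" for j
      by (intro reps_mult reps_const Fr(1) that)
    interpret K: cring "\<F> 1" by (rule cring_rat_field)
    have "(\<Oplus>\<^bsub>\<F> 1\<^esub>j\<in>{..<N}. germ C 1 0 (\<lambda>_. c j) \<otimes>\<^bsub>\<F> 1\<^esub> contract d X (\<omega> j)) =
        (\<Oplus>\<^bsub>\<F> 1\<^esub>j\<in>{..<N}. germ C 1 0 (\<lambda>_. c j) \<otimes>\<^bsub>\<F> 1\<^esub> germ C 1 0 (Fr j))"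
      by (rule K.finsum_cong') (auto simp: Fr intro!: germ_closed reps_const)
    also have "\<dots> = germ C 1 0 (\<lambda>s. \<Sum>j<N. c j * Fr j s)"
      by (rule germ_finsum_mult) (auto simp: Fr reps_const)
    also have "\<dots> = \<zero>\<^bsub>\<F> 1\<^esub>"
      using germ_eq_zero_iff[OF reps_sum[of "{..<N}" "\<lambda>j s. c j * Fr j s"]] cr c by simp
    finally show "\<forall>j<N. c j = 0"
      using H0_basis_contract_independent[OF smooth X basis] by blast
  qed
  \<comment> \<open>Entries of the inverse of the matrix \<open>a\<close>, with the sign of the
    classical Hamiltonian attached to row \<open>i\<close>.\<close>
  define b where "b i k z = (-1) ^ i * fun_cofactor N (a z) k i * inverse (fun_det N (a z))" for i k z
  have br: "b i k \<in> reps N 0" if "i < N" "k < N" for i k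
    unfolding b_def[abs_def]
    by (intro reps_mult reps_const reps_inverse fun_cofactor_reps fun_det_reps ar that)
  \<comment> \<open>The same sign is put on the \<open>j\<close>-th column of the matrix, so that it
    stays inverse to \<open>b\<close>.\<close>
  define h where "h j = germ C 1 0 (\<lambda>s. (-1) ^ j * Fr j s)" for j
  have hr: "(\<lambda>s. (-1) ^ j * Fr j s) \<in> reps 1 0" if "j < N" for j
    by (intro reps_mult reps_const Fr(1) that)
  have hc: "h j \<in> carrier (\<F> 1)" if "j < N" for j
    unfolding h_def by (rule germ_closed[OF hr[OF that]])
  have ah: "at_var C N k (h j) = germ C N 0 (\<lambda>z. (-1) ^ j * a z k j)" if "k < N" "j < N" for k j
    unfolding h_def a_def by (rule at_var_germ[OF that(1) hr[OF that(2)]])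
  have har: "(\<lambda>z. (-1) ^ j * a z k j) \<in> reps N 0" if "k < N" "j < N" for k j
    by (intro reps_mult reps_const ar that)
  have BA: "(\<Oplus>\<^bsub>\<F> N\<^esub>k\<in>{..<N}. germ C N 0 (b i k) \<otimes>\<^bsub>\<F> N\<^esub> at_var C N k (h j)) =
      (if i = j then \<one>\<^bsub>\<F> N\<^esub> else \<zero>\<^bsub>\<F> N\<^esub>)" if ij: "i < N" "j < N" for i j
  proof -
    have "(\<Oplus>\<^bsub>\<F> N\<^esub>k\<in>{..<N}. germ C N 0 (b i k) \<otimes>\<^bsub>\<F> N\<^esub> at_var C N k (h j)) =
        (\<Oplus>\<^bsub>\<F> N\<^esub>k\<in>{..<N}. germ C N 0 (b i k) \<otimes>\<^bsub>\<F> N\<^esub>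
          germ C N 0 (\<lambda>z. (-1) ^ j * a z k j))"
      by (rule F.finsum_cong') (auto simp: ah ij intro!: germ_closed br har)
    also have "\<dots> = germ C N 0 (\<lambda>z. \<Sum>k<N. b i k z * ((-1) ^ j * a z k j))"
      by (rule germ_finsum_mult) (auto intro: br har ij)
    also have "\<dots> = germ C N 0 (\<lambda>_. if i = j then 1 else 0)"
    proof (rule germ_cong[OF reps_sum])
      show "\<forall>\<^sub>F z in generic C N 0. (\<Sum>k<N. b i k z * ((-1) ^ j * a z k j)) = (if i = j then 1 else 0)"
        using det
      proof eventually_elim
        case (elim z)
        have "(\<Sum>k<N. b i k z * ((-1) ^ j * a z k j)) =
            (-1) ^ i * (-1) ^ j * inverse (fun_det N (a z)) * (\<Sum>k<N. fun_cofactor N (a z) k i * a z k j)"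
          unfolding sum_distrib_left by (rule sum.cong) (simp_all add: b_def)
        then show ?case using elim fun_cofactor_mult_mat[OF ij, of "a z"]
          by (auto simp: power_add[symmetric])
      qed
    qed (auto intro!: reps_mult br har ij)
    finally show ?thesis by (simp add: one_rat_field zero_rat_field)
  qed
  have AB: "(\<Oplus>\<^bsub>\<F> N\<^esub>j\<in>{..<N}. at_var C N k (h j) \<otimes>\<^bsub>\<F> N\<^esub> germ C N 0 (b j l)) =
      (if k = l then \<one>\<^bsub>\<F> N\<^esub> else \<zero>\<^bsub>\<F> N\<^esub>)" if kl: "k < N" "l < N" for k l
  proof -
    have "(\<Oplus>\<^bsub>\<F> N\<^esub>j\<in>{..<N}. at_var C N k (h j) \<otimes>\<^bsub>\<F> N\<^esub> germ C N 0 (b j l)) =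
        (\<Oplus>\<^bsub>\<F> N\<^esub>j\<in>{..<N}. germ C N 0 (\<lambda>z. (-1) ^ j * a z k j) \<otimes>\<^bsub>\<F> N\<^esub>
          germ C N 0 (b j l))"
      by (rule F.finsum_cong') (auto simp: ah kl intro!: germ_closed br har)
    also have "\<dots> = germ C N 0 (\<lambda>z. \<Sum>j<N. ((-1) ^ j * a z k j) * b j l z)"
      by (rule germ_finsum_mult) (auto intro: br har kl)
    also have "\<dots> = germ C N 0 (\<lambda>_. if k = l then 1 else 0)"
    proof (rule germ_cong[OF reps_sum])
      show "\<forall>\<^sub>F z in generic C N 0. (\<Sum>j<N. ((-1) ^ j * a z k j) * b j l z) = (if k = l then 1 else 0)"
        using det
      proof eventually_elim
        case (elim z)
        have "(-1) ^ j * ((-1) ^ j * x) = x" for x :: complex and j by (simp add: power_add[symmetric] mult.assoc[symmetric])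
        then have "(\<Sum>j<N. ((-1) ^ j * a z k j) * b j l z) =
            inverse (fun_det N (a z)) * (\<Sum>j<N. a z k j * fun_cofactor N (a z) l j)"
          unfolding sum_distrib_left by (intro sum.cong) (simp_all add: b_def mult_ac)
        then show ?case using elim fun_mat_mult_cofactor[OF kl, of "a z"] by auto
      qed
    qed (auto intro!: reps_mult br har kl)
    finally show ?thesis by (simp add: one_rat_field zero_rat_field)
  qed
  define H where "H i = diff_op C N X (pure_coeffs N d (\<lambda>k. germ C N 0 (b i k)))" for i
  have bc: "germ C N 0 (b i k) \<in> carrier (\<F> N)" if "i < N" "k < N" for i k
    by (rule germ_closed[OF br[OF that]])
  have fam: "pure_coeffs N d (\<lambda>k. germ C N 0 (b i k)) \<in> coeff_families C N" if "i < N" for i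
    by (rule pure_coeffs_family[OF d bc[OF that]])
  have H: "H i g = (\<Oplus>\<^bsub>\<F> N\<^esub>k\<in>{..<N}. germ C N 0 (b i k) \<otimes>\<^bsub>\<F> N\<^esub> (vf_at C N X k ^^ d) g)"
    if "i < N" "g \<in> carrier (\<F> N)" for i g
    unfolding H_def by (rule diff_op_pure_coeffs[OF X(1) d bc[OF that(1)] that(2)])
  \<comment> \<open>The powers \<open>X_k^d\<close> commute and are linear over functions of the
    other variables, as separation requires.\<close>
  have comm: "H i (H j g) = H j (H i g)" if "i < N" "j < N" "g \<in> carrier (\<F> N)" for i j g
    by (rule F.separated_operators_commute[of N "\<lambda>k j. at_var C N k (h j)" "\<lambda>i k. germ C N 0 (b i k)"
          "\<lambda>k. vf_at C N X k ^^ d" H i j g])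
      (use that H BA AB bc hc at_var_closed funpow_vf_at[OF X(1)] funpow_vf_at_commute[OF X(1)] in auto)
  \<comment> \<open>A row of an invertible matrix is not zero; a nonzero entry is what fixes the
    order of the operator at \<open>d\<close>.\<close>
  have nz: "\<exists>k<N. germ C N 0 (b i k) \<noteq> \<zero>\<^bsub>\<F> N\<^esub>" if i: "i < N" for i
  proof (rule ccontr)
    assume "\<not> ?thesis"
    then have "(\<Oplus>\<^bsub>\<F> N\<^esub>k\<in>{..<N}. germ C N 0 (b i k) \<otimes>\<^bsub>\<F> N\<^esub> at_var C N k (h i)) =
        (\<Oplus>\<^bsub>\<F> N\<^esub>k\<in>{..<N}. \<zero>\<^bsub>\<F> N\<^esub>)"
      by (intro F.finsum_cong') (auto simp: at_var_closed hc i)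
    then show False
      using BA[OF i i] domain.one_not_zero[OF field.axioms(1)[OF field_rat_field[of N 0]]]
      by (simp add: F.finsum_zero)
  qed
  show ?thesis
  proof (intro exI[of _ H] conjI allI impI)
    fix i assume i: "i < N"
    show "H i \<in> DO_rat C N X" unfolding H_def DO_rat_def using fam[OF i] by blast
    obtain k where k: "k < N" "germ C N 0 (b i k) \<noteq> \<zero>\<^bsub>\<F> N\<^esub>" using nz[OF i] by blast
    \<comment> \<open>Vanishing of the operator would force its coefficients to vanish, by their
      uniqueness.\<close>
    show "H i \<noteq> zero_op C N"
    proof
      assume "H i = zero_op C N"
      moreover have "pure_coeffs N d (\<lambda>_. \<zero>\<^bsub>\<F> N\<^esub>) \<in> coeff_families C N"
        by (rule pure_coeffs_family[OF d]) simp
      moreover have "diff_op C N X (pure_coeffs N d (\<lambda>_. \<zero>\<^bsub>\<F> N\<^esub>)) = zero_op C N"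
        unfolding diff_op_def zero_op_def pure_coeffs_support[OF d] by simp
      ultimately have "pure_coeffs N d (\<lambda>k. germ C N 0 (b i k)) = pure_coeffs N d (\<lambda>_. \<zero>\<^bsub>\<F> N\<^esub>)"
        using diff_op_inj[OF X fam[OF i]] unfolding H_def by metis
      from fun_cong[OF this, of "pure_index N d k"] k(2) show False
        by (simp add: pure_coeffs_pure_index[OF d k(1)])
    qed
    have "symbol C N X (H i) = germ C N N (\<lambda>x. \<Sum>k<N. b i k (drop_fibre x) * snd x k ^ d)"
      unfolding H_def by (rule symbol_pure_coeffs[where b = "b i", OF X d br[OF i] k])
    moreover have "H_class C X d N \<omega> i = germ C N N (\<lambda>x. \<Sum>k<N.
        (-1) ^ i * fun_cofactor N (\<lambda>k j. Fr j (factor_point k (drop_fibre x))) k i *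
          inverse (fun_det N (\<lambda>k j. Fr j (factor_point k (drop_fibre x)))) * snd x k ^ d)"
      by (rule H_class_germ[OF X(1)]) (use Fr det i in \<open>simp_all add: a_def[abs_def]\<close>)
    ultimately show "symbol C N X (H i) = H_class C X d N \<omega> i"
      by (simp add: b_def a_def[abs_def])
  next
    fix i j assume "i < N" "j < N"
    then show "op_comp C N (H i) (H j) = op_comp C N (H j) (H i)"
      unfolding op_comp_def compose_def by (intro restrict_ext) (rule comm)
  qed
qed

end

theorem proposition4p1:
  fixes C :: "'n::finite proj set"
    and d N :: nat
    and \<omega> :: "nat \<Rightarrow> 'n differential"
    and X :: "'n ratfun \<Rightarrow> 'n ratfun"
  assumes "smooth_projective_curve C"
    and "genus C > 1"
    and "d \<ge> 1"
    and "N = dim_H0 C d"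
    and "is_basis_H0 C d N \<omega>"
    and "X \<in> vector_fields C"
    and "X \<noteq> zero_op C 1"
  shows "\<exists>H :: nat \<Rightarrow> 'n ratfun \<Rightarrow> 'n ratfun.
    (\<forall>i<N. H i \<in> DO_rat C N X) \<and>
    (\<forall>i<N. \<forall>j<N. op_comp C N (H i) (H j) = op_comp C N (H j) (H i)) \<and>
    (\<forall>i<N. H i \<noteq> zero_op C N \<and> symbol C N X (H i) = H_class C X d N \<omega> i)"
proof -
  have "irreducible_in zariski C" and "\<forall>p\<in>C. \<forall>v\<in>hcoords p. vec.dim (cone_tangent C v) = 2"
    using assms(1) by (simp_all add: smooth_projective_curve_def)
  with assms show ?thesis
    by (intro irreducible_curve.quantized_hamiltonians_exist) (simp_all add: irreducible_curve_def)
qed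

end
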